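(* Let $G$ be a nontrivial finite solvable group. Then $|\Delta(G)|\ge 2^{|\pi(G)|}-2$, with equality if and only if the odd part $|G|_{2'}$ of $|G|$ is square-free and the Sylow $2$-subgroup of $G$ is a cyclic or generalized quaternion $2$-group.
   Context: All groups and graphs are finite; graphs are simple and undirected. For a group $G$ and an inverse-closed subset $S\subseteq G\setminus\{1\}$, the Cayley graph $\mathrm{Cay}(G,S)$ has vertex set $G$, with distinct $x,y$ adjacent iff $yx^{-1}\in S$. A perfect code in a graph with vertex set $V$ is an independent set $C\subseteq V$ such that every vertex of $V\setminus C$ is adjacent to exactly one vertex of $C$. A subgroup $H\le G$ is a subgroup perfect code of $G$ if it is a perfect code in some Cayley graph of $G$; it is nontrivial if $1<H<G$. $\Delta(G)$ is the set of all conjugacy classes (in $G$) of nontrivial subgroup perfect codes of $G$, and $\pi(G)$ is the set of prime divisors of $|G|$. $n_{2'}$ denotes the odd part of a positive integer $n$. The trivial group counts as a cyclic $2$-group (so groups of odd order satisfy the condition on Sylow $2$-subgroups), and generalized quaternion groups have order $2^n$ with $n\ge3$. *)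

theory Defs
  imports
    "HOL-Algebra.Elementary_Groups"
    "HOL-Algebra.Solvable_Groups"
    "HOL-Computational_Algebra.Squarefree"
    "Graph_Theory.Pair_Digraph"
begin

section \<open>Cayley graphs and perfect codes\<close>

definition connection_set :: "('a, 'b) monoid_scheme \<Rightarrow> 'a set \<Rightarrow> bool" where
  "connection_set G S \<longleftrightarrow>
     S \<subseteq> carrier G - {\<one>\<^bsub>G\<^esub>} \<and> (\<forall>s\<in>S. inv\<^bsub>G\<^esub> s \<in> S)"

text \<open>
  An undirected simple graph is represented as a \<^locale>\<open>pair_graph\<close>, that is, by a finite vertex
  set together with a symmetric and irreflexive set of arcs.
\<close>

definition cayley_graph :: "('a, 'b) monoid_scheme \<Rightarrow> 'a set \<Rightarrow> 'a pair_pre_digraph" where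
  "cayley_graph G S =
     \<lparr> pverts = carrier G,
       parcs = {(x, y). x \<in> carrier G \<and> y \<in> carrier G \<and> x \<noteq> y \<and> y \<otimes>\<^bsub>G\<^esub> inv\<^bsub>G\<^esub> x \<in> S} \<rparr>"

lemma (in group) pair_graph_cayley_graph:
  assumes "finite (carrier G)" and "connection_set G S"
  shows "pair_graph (cayley_graph G S)"
proof
  show "finite (parcs (cayley_graph G S))"
    by (rule finite_subset[of _ "carrier G \<times> carrier G"])
      (use assms in \<open>auto simp: cayley_graph_def\<close>)
  have "x \<otimes> inv y \<in> S"
    if "x \<in> carrier G" "y \<in> carrier G" "y \<otimes> inv x \<in> S" for x y
  proof -
    have "inv (y \<otimes> inv x) \<in> S"
      using assms(2) that by (auto simp: connection_set_def)
    then show ?thesis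
      using that by (simp add: inv_mult_group)
  qed
  then show "symmetric (with_proj (cayley_graph G S))"
    by (auto simp: symmetric_def sym_def cayley_graph_def)
qed (use assms in \<open>auto simp: cayley_graph_def\<close>)

definition independent_set :: "'a pair_pre_digraph \<Rightarrow> 'a set \<Rightarrow> bool" where
  "independent_set \<Gamma> C \<longleftrightarrow> C \<subseteq> pverts \<Gamma> \<and> (\<forall>x\<in>C. \<forall>y\<in>C. (x, y) \<notin> parcs \<Gamma>)"

definition perfect_code :: "'a pair_pre_digraph \<Rightarrow> 'a set \<Rightarrow> bool" where
  "perfect_code \<Gamma> C \<longleftrightarrow>
     independent_set \<Gamma> C \<and> (\<forall>v\<in>pverts \<Gamma> - C. \<exists>!c. c \<in> C \<and> (v, c) \<in> parcs \<Gamma>)"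


section \<open>Subgroup perfect codes up to conjugacy\<close>

definition subgroup_perfect_code :: "('a, 'b) monoid_scheme \<Rightarrow> 'a set \<Rightarrow> bool" where
  "subgroup_perfect_code G H \<longleftrightarrow>
     subgroup H G \<and> (\<exists>S. connection_set G S \<and> perfect_code (cayley_graph G S) H)"

definition nontrivial_subgroup_perfect_codes :: "('a, 'b) monoid_scheme \<Rightarrow> 'a set set" where
  "nontrivial_subgroup_perfect_codes G =
     {H. subgroup_perfect_code G H \<and> H \<noteq> {\<one>\<^bsub>G\<^esub>} \<and> H \<noteq> carrier G}"

definition conjugacy_class :: "('a, 'b) monoid_scheme \<Rightarrow> 'a set \<Rightarrow> 'a set set" where
  "conjugacy_class G H = {g <#\<^bsub>G\<^esub> H #>\<^bsub>G\<^esub> inv\<^bsub>G\<^esub> g | g. g \<in> carrier G}"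

definition Delta :: "('a, 'b) monoid_scheme \<Rightarrow> 'a set set set" where
  "Delta G = conjugacy_class G ` nontrivial_subgroup_perfect_codes G"


section \<open>Arithmetic of the order and Sylow 2-subgroups\<close>

definition order_primes :: "('a, 'b) monoid_scheme \<Rightarrow> nat set" where
  "order_primes G = {p. Factorial_Ring.prime p \<and> p dvd Coset.order G}"

definition odd_part :: "nat \<Rightarrow> nat" where
  "odd_part n = n div 2 ^ multiplicity 2 n"

definition sylow_subgroup :: "nat \<Rightarrow> ('a, 'b) monoid_scheme \<Rightarrow> 'a set \<Rightarrow> bool" where
  "sylow_subgroup p G P \<longleftrightarrow>
     subgroup P G \<and> card P = p ^ multiplicity p (Coset.order G)"

definition cyclic_2_group :: "('a, 'b) monoid_scheme \<Rightarrow> bool" where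
  "cyclic_2_group Q \<longleftrightarrow>
     Group.group Q \<and> cyclic_group Q \<and> (\<exists>n. Coset.order Q = 2 ^ n)"

text \<open>
  The generalized quaternion group of order \<open>2 ^ n\<close>, where \<open>n \<ge> 3\<close>, has the presentation with
  generators \<open>a\<close>, \<open>b\<close> and relations \<open>a ^ (2 ^ (n - 1)) = 1\<close>, \<open>b ^ 2 = a ^ (2 ^ (n - 2))\<close>,
  \<open>b\<^sup>-\<^sup>1 a b = a\<^sup>-\<^sup>1\<close>. The presented group has order \<open>2 ^ n\<close>, so a group of that order generated
  by two elements satisfying these relations is isomorphic to it.
\<close>

definition generalized_quaternion_group :: "('a, 'b) monoid_scheme \<Rightarrow> bool" where
  "generalized_quaternion_group Q \<longleftrightarrow>
     Group.group Q \<and>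
     (\<exists>n\<ge>3. Coset.order Q = 2 ^ n \<and>
       (\<exists>a\<in>carrier Q. \<exists>b\<in>carrier Q.
          generate Q {a, b} = carrier Q \<and>
          a [^]\<^bsub>Q\<^esub> ((2::nat) ^ (n - 1)) = \<one>\<^bsub>Q\<^esub> \<and>
          b [^]\<^bsub>Q\<^esub> (2::nat) = a [^]\<^bsub>Q\<^esub> ((2::nat) ^ (n - 2)) \<and>
          inv\<^bsub>Q\<^esub> b \<otimes>\<^bsub>Q\<^esub> a \<otimes>\<^bsub>Q\<^esub> b = inv\<^bsub>Q\<^esub> a))"

end

theory Submission
  imports Defs "HOL-Algebra.Sylow" "HOL-Algebra.Group_Action" "HOL-Algebra.Multiplicative_Group"
begin

text \<open>
  A subgroup \<open>H\<close> is a perfect code iff it has an inverse-closed transversal, and such a transversal can be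
  built one double coset at a time. The only obstruction comes from a self-inverse double coset with
  an odd number of cosets of \<open>H\<close>, which must contain an element of square 1. Hence every subgroup
  of odd order or of odd index is a perfect code; in particular every Hall subgroup is one, and Hall's
  theorem for solvable groups gives one class for each nonempty proper subset of the set of primes.

  Equality therefore means that every nontrivial perfect code is a Hall subgroup. Subgroups of odd
  prime order force the odd part to be square-free. If the Sylow 2-subgroup has two involutions, then
  a maximal 2-subgroup with exactly one involution is a perfect code that is not Hall; and 2-groups
  with at most one involution are cyclic or generalized quaternion. Conversely, a parity argument
  shows that a perfect code of even order and even index yields two commuting involutions, which a
  cyclic or generalized quaternion Sylow 2-subgroup excludes.
\<close>

section \<open>Parity, conjugation and extensions of prime degree\<close>

text \<open>The obstruction is one of parity. Inversion maps the double coset of \<open>g\<close> to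
  that of \<open>inv g\<close>, and for any two cosets of \<open>H\<close>, one in each, some
  element of the first has its inverse in the second. So cosets pair off freely, and only a
  self-inverse double coset with an odd number of cosets leaves one over, which an element equal to
  its own inverse must represent. Such a double coset has a representative \<open>g\<close> whose
  square lies in \<open>H\<close>. Then \<open>g\<close> normalizes K, the intersection of
  \<open>H\<close> with its conjugate by \<open>g\<close>, and for \<open>g\<close> outside
  \<open>H\<close> the subgroup K<g> has order 2|K|. For odd index this order contradicts Lagrange;
  for a maximal 2-subgroup with one involution, K is \<open>H\<close> itself and K<g> has a further
  involution in the coset of \<open>g\<close>.

  Hall's theorem is reached by descending along normal subgroups of prime index. A Frattini argument
  gives existence, so existence in the larger group needs conjugacy in the smaller one; conjugacy
  comes from Sylow conjugacy inside a normalizer. Quotient groups are avoided: where one would pass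
  to a quotient of prime order, a power of an element outside the normal subgroup is used
  instead.\<close>

lemma involution_no_fixpoint_even_card:
  assumes "finite X" and "\<And>x. x \<in> X \<Longrightarrow> f x \<in> X" and "\<And>x. x \<in> X \<Longrightarrow> f (f x) = x"
    and "\<And>x. x \<in> X \<Longrightarrow> f x \<noteq> x"
  shows "even (card X)"
  using assms
proof (induction "card X" arbitrary: X rule: less_induct)
  case less
  show ?case
  proof (cases "X = {}")
    case False
    then obtain x where x: "x \<in> X" by blast
    define Y where "Y = X - {x, f x}"
    have c: "card X = card Y + 2"
    proof -
      have "card {x, f x} = 2" using x less.prems(4)[OF x] by (simp add: card_insert_if)
      moreover have "{x, f x} \<subseteq> X" using x less.prems(2) by simp
      ultimately show ?thesis unfolding Y_def using less.prems(1)
        by (metis card_Diff_subset card_mono finite.emptyI finite.insertI le_add_diff_inverse2)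
    qed
    have "even (card Y)"
    proof (rule less.hyps)
      show "card Y < card X" using c by simp
      show "finite Y" using less.prems(1) by (simp add: Y_def)
      fix y assume y: "y \<in> Y"
      then have yX: "y \<in> X" "y \<noteq> x" "y \<noteq> f x" by (auto simp: Y_def)
      show "f (f y) = y" "f y \<noteq> y" using less.prems(3,4) yX by blast+
      have "f y \<noteq> x" "f y \<noteq> f x" using less.prems(3) yX x by metis+
      then show "f y \<in> Y" using less.prems(2) yX by (simp add: Y_def)
    qed
    then show ?thesis using c by simp
  qed simp
qed

lemma involution_parity:
  assumes "finite X" and "\<And>x. x \<in> X \<Longrightarrow> f x \<in> X" and "\<And>x. x \<in> X \<Longrightarrow> f (f x) = x"
  shows "even (card X) \<longleftrightarrow> even (card {x \<in> X. f x = x})"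
proof -
  have "even (card {x \<in> X. f x \<noteq> x})"
    by (rule involution_no_fixpoint_even_card[of _ f]) (use assms in auto)
  moreover have "card X = card {x \<in> X. f x = x} + card {x \<in> X. f x \<noteq> x}"
    using assms(1) by (subst card_Un_disjoint[symmetric]) (auto intro: arg_cong[of _ _ card])
  ultimately show ?thesis by simp
qed

section \<open>Conjugates of subsets, and extensions by one normalizing element\<close>

context group
begin

lemma inv_mult_cancel:
  assumes "x \<in> carrier G" "y \<in> carrier G"
  shows "inv x \<otimes> (x \<otimes> y) = y" "x \<otimes> (inv x \<otimes> y) = y"
  using assms by (simp_all add: m_assoc[symmetric])

text \<open>An image under an injective map, so that cardinality, intersection and monotonicity are
  facts about images. \<open>conj_set_eq\<close> links it to the products of cosets in
  \<open>conjugacy_class\<close>.\<close>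

definition conj_set :: "'a \<Rightarrow> 'a set \<Rightarrow> 'a set" where
  "conj_set g H = (\<lambda>h. g \<otimes> h \<otimes> inv g) ` H"

lemma conj_set_eq: "g <# H #> inv g = conj_set g H"
  by (auto simp: conj_set_def l_coset_def r_coset_def)

lemma subgroup_conj_set: "g \<in> carrier G \<Longrightarrow> subgroup H G \<Longrightarrow> subgroup (conj_set g H) G"
  using subgroup_conjugation_is_surj2[of g H] by (simp add: conj_set_eq)

lemma conj_conj:
  assumes "g \<in> carrier G" "h \<in> carrier G" "x \<in> carrier G"
  shows "g \<otimes> (h \<otimes> x \<otimes> inv h) \<otimes> inv g = (g \<otimes> h) \<otimes> x \<otimes> inv (g \<otimes> h)"
  using assms by (simp add: inv_mult_group m_assoc)

lemma conj_set_mult: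
  assumes "g \<in> carrier G" "h \<in> carrier G" "H \<subseteq> carrier G"
  shows "conj_set g (conj_set h H) = conj_set (g \<otimes> h) H"
  unfolding conj_set_def image_image
  by (rule image_cong) (use assms conj_conj in auto)

lemma conj_set_one: "H \<subseteq> carrier G \<Longrightarrow> conj_set \<one> H = H"
  unfolding conj_set_def by (auto simp: image_iff subset_iff)

lemma conj_set_carrier: "g \<in> carrier G \<Longrightarrow> H \<subseteq> carrier G \<Longrightarrow> conj_set g H \<subseteq> carrier G"
  unfolding conj_set_def by auto

lemma conj_set_mono: "H \<subseteq> K \<Longrightarrow> conj_set g H \<subseteq> conj_set g K"
  unfolding conj_set_def by auto

lemma conj_set_inv:
  assumes "g \<in> carrier G" "H \<subseteq> carrier G"
  shows "conj_set (inv g) (conj_set g H) = H" "conj_set g (conj_set (inv g) H) = H"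
  using assms by (simp_all add: conj_set_mult conj_set_one)

lemma card_conj_set:
  assumes "g \<in> carrier G" "H \<subseteq> carrier G"
  shows "card (conj_set g H) = card H"
  unfolding conj_set_def by (rule card_image) (use assms in \<open>auto simp: inj_on_def subset_iff\<close>)

lemma conj_set_Int:
  assumes "g \<in> carrier G" "H \<subseteq> carrier G" "K \<subseteq> carrier G"
  shows "conj_set g (H \<inter> K) = conj_set g H \<inter> conj_set g K"
  unfolding conj_set_def
  by (rule inj_on_image_Int[of _ "carrier G"]) (use assms in \<open>auto simp: inj_on_def\<close>)

lemma mem_conj_set:
  assumes "g \<in> carrier G" "x \<in> carrier G" "H \<subseteq> carrier G"
  shows "x \<in> conj_set g H \<longleftrightarrow> inv g \<otimes> x \<otimes> g \<in> H"
proof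
  assume "x \<in> conj_set g H"
  then obtain h where h: "h \<in> H" "x = g \<otimes> h \<otimes> inv g" by (auto simp: conj_set_def)
  then have "h \<in> carrier G" using assms(3) by auto
  then have "inv g \<otimes> x \<otimes> g = h" using assms h(2)
    by (metis conjugation_is_surj inv_closed inv_inv)
  then show "inv g \<otimes> x \<otimes> g \<in> H" using h by simp
next
  assume "inv g \<otimes> x \<otimes> g \<in> H"
  moreover have "g \<otimes> (inv g \<otimes> x \<otimes> g) \<otimes> inv g = x"
    using assms conjugation_is_surj by auto
  ultimately show "x \<in> conj_set g H" unfolding conj_set_def by (metis image_eqI)
qed

lemma conj_set_fixI:
  assumes "finite H" "H \<subseteq> carrier G" "g \<in> carrier G"
    and "\<And>h. h \<in> H \<Longrightarrow> g \<otimes> h \<otimes> inv g \<in> H"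
  shows "conj_set g H = H"
  by (rule card_subset_eq) (use assms card_conj_set in \<open>auto simp: conj_set_def\<close>)

lemma conj_set_subgroup_self:
  assumes "subgroup H G" "h \<in> H"
  shows "conj_set h H = H"
proof
  interpret subgroup H G by fact
  show "conj_set h H \<subseteq> H" using assms(2) by (auto simp: conj_set_def)
  have "x \<in> conj_set h H" if "x \<in> H" for x
    using that assms(2) subset by (subst mem_conj_set) auto
  then show "H \<subseteq> conj_set h H" by blast
qed

lemma conj_pow:
  assumes "x \<in> carrier G" "a \<in> carrier G"
  shows "x \<otimes> a [^] (n::nat) \<otimes> inv x = (x \<otimes> a \<otimes> inv x) [^] n"
proof (induction n)
  case (Suc n)
  have "x \<otimes> a [^] Suc n \<otimes> inv x = (x \<otimes> a [^] n \<otimes> inv x) \<otimes> (x \<otimes> a \<otimes> inv x)"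
    using assms by (simp add: m_assoc inv_mult_cancel)
  then show ?case using Suc by simp
qed (use assms in simp)

lemma subgroup_pow_closed: "subgroup H G \<Longrightarrow> x \<in> H \<Longrightarrow> x [^] (n::nat) \<in> H"
  by (induction n) (auto simp: subgroup.one_closed subgroup.m_closed)

lemma card_subgroup_dvd:
  assumes "subgroup K G" "subgroup H G" "K \<subseteq> H"
  shows "card K dvd card H"
proof -
  interpret H: group "G\<lparr>carrier := H\<rparr>" using assms(2) by (rule subgroup_imp_group)
  have "subgroup K (G\<lparr>carrier := H\<rparr>)" using subgroup_incl[OF assms] .
  from H.lagrange[OF this]
  have "card (rcosets\<^bsub>G\<lparr>carrier := H\<rparr>\<^esub> K) * card K = card H" by (simp add: order_def)
  then show ?thesis by (metis dvd_triv_right)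
qed

lemma pow_card_subgroup:
  assumes "finite (carrier G)" "subgroup H G" "x \<in> H"
  shows "x [^] card H = \<one>"
proof -
  interpret H: group "G\<lparr>carrier := H\<rparr>" using assms(2) by (rule subgroup_imp_group)
  have "x [^]\<^bsub>G\<lparr>carrier := H\<rparr>\<^esub> order (G\<lparr>carrier := H\<rparr>) = \<one>\<^bsub>G\<lparr>carrier := H\<rparr>\<^esub>"
    by (rule H.pow_order_eq_1) (use assms in \<open>auto dest: subgroup.subset intro: finite_subset\<close>)
  then show ?thesis by (simp add: order_def nat_pow_consistent[symmetric])
qed

text \<open>The exponents sending \<open>x\<close> into \<open>M\<close> form an ideal; take \<open>y\<close> to be \<open>x\<close> to the power \<open>n / q\<close>,
  where \<open>n\<close> generates it and \<open>q\<close> is a prime factor of \<open>n\<close>.\<close>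

lemma power_step:
  assumes M: "subgroup M G" and x: "x \<in> carrier G" "x \<notin> M" and N: "x [^] (N::nat) \<in> M" "N > 0"
  shows "\<exists>(k::nat) (q::nat). Factorial_Ring.prime q \<and> q dvd N \<and> x [^] k \<notin> M \<and> (x [^] k) [^] q \<in> M"
proof -
  interpret subgroup M G by fact
  define n where "n = (LEAST n::nat. n > 0 \<and> x [^] n \<in> M)"
  have n: "n > 0" "x [^] n \<in> M" using LeastI[of "\<lambda>n::nat. n > 0 \<and> x [^] n \<in> M" N] N by (auto simp: n_def)
  have least: "x [^] m \<notin> M" if "0 < m" "m < n" for m
    using not_less_Least[of m "\<lambda>n::nat. n > 0 \<and> x [^] n \<in> M"] that unfolding n_def[symmetric] by auto
  have "n \<noteq> 1" using n x by auto
  then obtain q where q: "Factorial_Ring.prime q" "q dvd n" using prime_factor_nat by blast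
  have "x [^] (N mod n) \<in> M"
  proof -
    have "x [^] N = (x [^] n) [^] (N div n) \<otimes> x [^] (N mod n)"
      using x by (simp add: nat_pow_pow nat_pow_mult)
    moreover have "(x [^] n) [^] (N div n) \<in> M" using n(2) subgroup_pow_closed[OF M] by blast
    ultimately have "x [^] (N mod n) = inv ((x [^] n) [^] (N div n)) \<otimes> x [^] N"
      using x n by (metis inv_solve_left nat_pow_closed)
    then show ?thesis using N(1) \<open>(x [^] n) [^] (N div n) \<in> M\<close> by auto
  qed
  then have "N mod n = 0" using least[of "N mod n"] n(1) by auto
  then have "q dvd N" using q(2) dvd_trans by blast
  moreover have "x [^] (n div q) \<notin> M" using least[of "n div q"] q n
    by (metis div_less_dividend dvd_div_eq_0_iff neq0_conv prime_gt_1_nat)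
  moreover have "(x [^] (n div q)) [^] q \<in> M" using x n q by (simp add: nat_pow_pow)
  ultimately show ?thesis using q by blast
qed

text \<open>The subgroup M<x> when \<open>x\<close> normalizes \<open>M\<close>. Natural exponents
  suffice in a finite group, where \<open>inv a\<close> is the power of \<open>a\<close> with
  exponent \<open>order G - 1\<close>.\<close>

definition extend :: "'a set \<Rightarrow> 'a \<Rightarrow> 'a set" where
  "extend M x = {m \<otimes> x [^] (i::nat) | m i. m \<in> M}"

lemma extend_subset: "subgroup H G \<Longrightarrow> M \<subseteq> H \<Longrightarrow> x \<in> H \<Longrightarrow> extend M x \<subseteq> H"
  unfolding extend_def using subgroup_pow_closed[of H x] subgroup.m_closed by fastforce

lemma conj_set_pow:
  assumes "M \<subseteq> carrier G" "x \<in> carrier G" "conj_set x M = M"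
  shows "conj_set (x [^] (i::nat)) M = M"
proof (induction i)
  case (Suc i)
  have "conj_set (x [^] i \<otimes> x) M = conj_set (x [^] i) (conj_set x M)"
    using assms(1,2) by (simp add: conj_set_mult)
  then show ?case using Suc assms by simp
qed (use assms conj_set_one in simp)

text \<open>Exponents of \<open>x\<close> reduce modulo \<open>p\<close> because
  \<open>x [^] p\<close> lies in \<open>M\<close>, and the cosets of \<open>M\<close> by the first
  \<open>p\<close> powers of \<open>x\<close> are distinct. Hence \<open>M \<times> {0..<p}\<close>
  parametrizes the extension.\<close>

lemma extend_props:
  assumes fin: "finite (carrier G)" and M: "subgroup M G" and x: "x \<in> carrier G" "x \<notin> M"
    and norm: "conj_set x M = M" and p: "Factorial_Ring.prime (p::nat)" "x [^] p \<in> M"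
  shows "subgroup (extend M x) G" "M \<subseteq> extend M x" "x \<in> extend M x" "card (extend M x) = p * card M"
proof -
  interpret M: subgroup M G by fact
  have Mc: "\<And>m. m \<in> M \<Longrightarrow> m \<in> carrier G" by auto
  have conj: "x [^] i \<otimes> m \<otimes> inv (x [^] i) \<in> M" if "m \<in> M" for m and i::nat
    using conj_set_pow[of M x i] that norm x M.subset unfolding conj_set_def by blast
  show MU: "M \<subseteq> extend M x"
  proof
    fix m assume "m \<in> M"
    then have "m = m \<otimes> x [^] (0::nat)" by simp
    then show "m \<in> extend M x" unfolding extend_def using \<open>m \<in> M\<close> by blast
  qed
  have "x = \<one> \<otimes> x [^] (1::nat)" using x by simp
  then show xU: "x \<in> extend M x" unfolding extend_def using M.one_closed by blast
  have Uc: "extend M x \<subseteq> carrier G" unfolding extend_def using x by auto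
  have closed: "a \<otimes> b \<in> extend M x" if ab: "a \<in> extend M x" "b \<in> extend M x" for a b
  proof -
    obtain m i where a: "a = m \<otimes> x [^] (i::nat)" "m \<in> M" using ab(1) by (auto simp: extend_def)
    obtain n j where b: "b = n \<otimes> x [^] (j::nat)" "n \<in> M" using ab(2) by (auto simp: extend_def)
    have "x [^] i \<otimes> n \<otimes> x [^] j = (x [^] i \<otimes> n \<otimes> inv (x [^] i)) \<otimes> (x [^] i \<otimes> x [^] j)"
      using x b by (simp add: m_assoc inv_mult_cancel)
    then have "a \<otimes> b = (m \<otimes> (x [^] i \<otimes> n \<otimes> inv (x [^] i))) \<otimes> x [^] (i + j)"
      using a b x by (simp add: m_assoc nat_pow_mult)
    moreover have "m \<otimes> (x [^] i \<otimes> n \<otimes> inv (x [^] i)) \<in> M" using a b conj by auto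
    ultimately show ?thesis unfolding extend_def by blast
  qed
  have powc: "a [^] (n::nat) \<in> extend M x" if "a \<in> extend M x" for a n
  proof (induction n)
    case 0
    then show ?case using MU M.one_closed by auto
  next
    case (Suc n)
    then show ?case using closed[OF Suc that] by simp
  qed
  show sub: "subgroup (extend M x) G"
  proof (rule subgroupI)
    show "extend M x \<noteq> {}" using xU by auto
    fix a assume a: "a \<in> extend M x"
    have ac: "a \<in> carrier G" using a Uc by auto
    have o0: "order G > 0" using fin order_gt_0_iff_finite by simp
    have "a \<otimes> a [^] (order G - 1) = a [^] (Suc (order G - 1))" using ac by (simp only: nat_pow_Suc2)
    also have "\<dots> = \<one>" using o0 ac pow_order_eq_1 by simp
    finally have "inv a = a [^] (order G - 1)"
      using ac by (metis inv_equality inv_comm nat_pow_closed)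
    then show "inv a \<in> extend M x" using powc[OF a] by simp
  qed (use Uc closed in auto)
  have p0: "p > 0" using p by (simp add: prime_gt_0_nat)
  have bij: "bij_betw (\<lambda>(m, i). m \<otimes> x [^] i) (M \<times> {0..<p}) (extend M x)"
  proof (rule bij_betw_imageI)
    \<comment> \<open>Since \<open>d\<close> is prime to \<open>p\<close>, having both
      \<open>x [^] d\<close> and \<open>x [^] p\<close> in \<open>M\<close> would put
      \<open>x\<close> into \<open>M\<close> by Bezout.\<close>
    have xnot: "x [^] d \<notin> M" if d: "0 < d" "d < p" for d :: nat
    proof
      assume xd: "x [^] d \<in> M"
      have "coprime d p" using d p by (metis coprime_commute dvd_imp_le linorder_not_less prime_imp_coprime)
      then obtain s t where st: "d * s = p * t + 1"
        using coprime_bezout_strong[of d p] p by (metis One_nat_def not_prime_1)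
      have "x [^] (d * s) \<in> M" using subgroup_pow_closed[OF M xd, of s] x by (simp add: nat_pow_pow)
      moreover have "x [^] (p * t) \<in> M" using subgroup_pow_closed[OF M p(2), of t] x by (simp add: nat_pow_pow)
      moreover have "x [^] (d * s) = x [^] (p * t) \<otimes> x" using x st by simp
      ultimately have "x \<in> M" using x(1)
        by (metis M.m_closed M.m_inv_closed Mc inv_solve_left)
      then show False using x by simp
    qed
    have le: "i = j \<and> m = n" if h: "m \<in> M" "n \<in> M" "i < p" "j < p" "m \<otimes> x [^] i = n \<otimes> x [^] j" "i \<le> j" for m n and i j :: nat
    proof -
      have "n \<otimes> x [^] j = n \<otimes> x [^] (j - i) \<otimes> x [^] i"
        using h x by (simp add: m_assoc nat_pow_mult)
      then have "m = n \<otimes> x [^] (j - i)" using h x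
        by (metis Mc m_closed nat_pow_closed right_cancel)
      then have "inv n \<otimes> m = x [^] (j - i)" using h x by (simp add: inv_solve_left')
      then have "x [^] (j - i) \<in> M" using h by (metis M.m_closed M.m_inv_closed)
      then have "i = j" using xnot[of "j - i"] h by (metis diff_is_0_eq' le_antisym less_imp_diff_less linorder_not_le zero_less_diff)
      then show ?thesis using h x by (auto simp: Mc)
    qed
    show "inj_on (\<lambda>(m, i). m \<otimes> x [^] i) (M \<times> {0..<p})"
    proof (rule inj_onI, clarify)
      fix m n and i j :: nat
      assume "m \<in> M" "n \<in> M" "i \<in> {0..<p}" "j \<in> {0..<p}" "m \<otimes> x [^] i = n \<otimes> x [^] j"
      then show "m = n \<and> i = j"
        using le[of m n i j] le[of n m j i] by (metis atLeastLessThan_iff nat_le_linear)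
    qed
    show "(\<lambda>(m, i). m \<otimes> x [^] i) ` (M \<times> {0..<p}) = extend M x"
    proof
      show "(\<lambda>(m, i). m \<otimes> x [^] i) ` (M \<times> {0..<p}) \<subseteq> extend M x" by (auto simp: extend_def)
      show "extend M x \<subseteq> (\<lambda>(m, i). m \<otimes> x [^] i) ` (M \<times> {0..<p})"
      proof
        fix a assume "a \<in> extend M x"
        then obtain m i where a: "a = m \<otimes> x [^] (i::nat)" "m \<in> M" by (auto simp: extend_def)
        have "x [^] i = (x [^] p) [^] (i div p) \<otimes> x [^] (i mod p)"
          using x by (simp add: nat_pow_pow nat_pow_mult)
        then have "a = (m \<otimes> (x [^] p) [^] (i div p)) \<otimes> x [^] (i mod p)"
          using a x by (simp add: m_assoc)
        moreover have "m \<otimes> (x [^] p) [^] (i div p) \<in> M" using a p subgroup_pow_closed[OF M] by auto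
        moreover have "i mod p \<in> {0..<p}" using p0 by simp
        ultimately show "a \<in> (\<lambda>(m, i). m \<otimes> x [^] i) ` (M \<times> {0..<p})" by force
      qed
    qed
  qed
  show "card (extend M x) = p * card M"
    using bij_betw_same_card[OF bij] by (simp add: card_cartesian_product ac_simps)
qed

lemma extend_two:
  assumes M: "subgroup M G" and x: "x \<in> carrier G" and x2: "x \<otimes> x \<in> M" and y: "y \<in> extend M x"
  shows "y \<in> M \<or> (\<exists>m\<in>M. y = m \<otimes> x)"
proof -
  interpret M: subgroup M G by fact
  obtain m i where a: "y = m \<otimes> x [^] (i::nat)" "m \<in> M" using y by (auto simp: extend_def)
  have e: "x [^] (2 * k) \<in> M" for k :: nat
    proof -
    have "x [^] (2::nat) = x \<otimes> x" using x by (simp add: numeral_2_eq_2)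
    then show ?thesis using subgroup_pow_closed[OF M x2, of k] x by (metis nat_pow_pow)
  qed
  show ?thesis
  proof (cases "even i")
    case True then show ?thesis using a e by (metis M.m_closed evenE)
  next
    case False
    then obtain k where "i = 2 * k + 1" by (elim oddE)
    then have "y = (m \<otimes> x [^] (2 * k)) \<otimes> x" using a x by (simp add: m_assoc)
    then show ?thesis using a e by blast
  qed
qed

end

section \<open>Actions of p-groups and Sylow conjugacy\<close>

text \<open>The moved points form a union of orbits, each of length a power of \<open>p\<close> by
  orbit-stabilizer and longer than 1.\<close>

lemma (in group_action) p_group_moved_points:
  assumes fin: "finite E" and p: "Factorial_Ring.prime (p::nat)" and ord: "order G = p ^ k"
  shows "p dvd card (E - {x \<in> E. \<forall>g\<in>carrier G. \<phi> g x = x})"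
proof -
  define E' where "E' = E - {x \<in> E. \<forall>g\<in>carrier G. \<phi> g x = x}"
  have orbE: "orbit G \<phi> x \<subseteq> E" if "x \<in> E" for x
    using that element_image by (auto simp: orbit_def)
  have orbeq: "orbit G \<phi> y = orbit G \<phi> x" if "x \<in> E" "y \<in> orbit G \<phi> x" for x y
  proof -
    have y: "y \<in> E" using that orbE by blast
    have x: "x \<in> orbit G \<phi> y" using orbit_sym[OF that(1) y that(2)] .
    show ?thesis
    proof
      show "orbit G \<phi> y \<subseteq> orbit G \<phi> x"
        using orbit_trans[OF that(1) y _ that(2)] orbE[OF y] by blast
      show "orbit G \<phi> x \<subseteq> orbit G \<phi> y"
        using orbit_trans[OF y that(1) _ x] orbE[OF that(1)] by blast
    qed
  qed
  have moved: "y \<in> E'" if "x \<in> E'" "y \<in> orbit G \<phi> x" for x y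
  proof (rule ccontr)
    assume "y \<notin> E'"
    moreover have x: "x \<in> E" using that by (auto simp: E'_def)
    then have "y \<in> E" using that orbE by blast
    ultimately have "\<forall>g\<in>carrier G. \<phi> g y = y" by (auto simp: E'_def)
    then have "orbit G \<phi> y \<subseteq> {y}" by (auto simp: orbit_def)
    then have "x = y" using orbit_sym[OF x \<open>y \<in> E\<close> that(2)] by auto
    then show False using that(1) \<open>y \<notin> E'\<close> by simp
  qed
  have "\<Union>(orbit G \<phi> ` E') = E'"
  proof
    show "\<Union>(orbit G \<phi> ` E') \<subseteq> E'" using moved by blast
    have "x \<in> orbit G \<phi> x" if "x \<in> E'" for x using that orbit_refl by (simp add: E'_def)
    then show "E' \<subseteq> \<Union>(orbit G \<phi> ` E')" by blast
  qed
  moreover have "p dvd card (\<Union>(orbit G \<phi> ` E'))"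
  proof (rule dvd_partition)
    show "finite (\<Union>(orbit G \<phi> ` E'))" using calculation fin by (simp add: E'_def)
    show "\<forall>c\<in>orbit G \<phi> ` E'. p dvd card c"
    proof clarify
      fix x assume x: "x \<in> E'"
      then have xE: "x \<in> E" by (auto simp: E'_def)
      have "card (orbit G \<phi> x) dvd p ^ k"
        using orbit_stabilizer_theorem[OF xE] ord by (metis dvd_triv_left)
      then obtain i where i: "card (orbit G \<phi> x) = p ^ i" using p divides_primepow_nat by blast
      have "i \<noteq> 0"
      proof
        assume "i = 0"
        then obtain y where "orbit G \<phi> x = {y}" using i card_1_singletonE by auto
        then have "orbit G \<phi> x = {x}" using orbit_refl[OF xE] by auto
        then show False using x unfolding E'_def orbit_def by blast
      qed
      then show "p dvd card (orbit G \<phi> x)" using i by simp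
    qed
    show "\<forall>c1\<in>orbit G \<phi> ` E'. \<forall>c2\<in>orbit G \<phi> ` E'. c1 \<noteq> c2 \<longrightarrow> c1 \<inter> c2 = {}"
    proof clarify
      fix x y assume xy: "x \<in> E'" "y \<in> E'" "orbit G \<phi> x \<noteq> orbit G \<phi> y"
      then have "x \<in> E" "y \<in> E" by (auto simp: E'_def)
      then show "orbit G \<phi> x \<inter> orbit G \<phi> y = {}" using orbeq xy(3) by blast
    qed
  qed
  ultimately show ?thesis by (simp add: E'_def)
qed

context group
begin

text \<open>The action is a bare function \<open>f\<close> whose laws hold only for elements of
  \<open>V\<close> and points of \<open>E\<close>. Restricting each \<open>f g\<close> to
  \<open>E\<close> makes it extensional, as membership in \<open>BijGroup E\<close> demands.\<close>

lemma p_subgroup_moved_points: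
  assumes V: "subgroup V G" "card V = p ^ k" and p: "Factorial_Ring.prime (p::nat)" and fin: "finite E"
    and cl: "\<And>g x. g \<in> V \<Longrightarrow> x \<in> E \<Longrightarrow> f g x \<in> E"
    and one: "\<And>x. x \<in> E \<Longrightarrow> f \<one> x = x"
    and mult: "\<And>g h x. g \<in> V \<Longrightarrow> h \<in> V \<Longrightarrow> x \<in> E \<Longrightarrow> f (g \<otimes> h) x = f g (f h x)"
  shows "p dvd card (E - {x \<in> E. \<forall>g\<in>V. f g x = x})"
proof -
  interpret V: subgroup V G by fact
  let ?V = "G\<lparr>carrier := V\<rparr>" and ?f = "\<lambda>g. restrict (f g) E"
  have grp: "group ?V" using V by (simp add: subgroup_imp_group)
  have bij: "?f g \<in> Bij E" if "g \<in> V" for g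
  proof -
    have g: "inv g \<in> V" "g \<in> carrier G" using that by auto
    have inv: "f (inv g) (f g x) = x" "f g (f (inv g) x) = x" if "x \<in> E" for x
      using mult[OF g(1) \<open>g \<in> V\<close> that] mult[OF \<open>g \<in> V\<close> g(1) that] one[OF that] g by simp_all
    have "bij_betw (f g) E E"
      by (rule bij_betw_byWitness[of _ "f (inv g)"]) (use inv cl that g in blast)+
    then have "bij_betw (?f g) E E" by (simp cong: bij_betw_cong)
    then show ?thesis by (simp add: Bij_def)
  qed
  have "group_action ?V E ?f"
  proof (intro group_action.intro group_hom.intro group_hom_axioms.intro grp group_BijGroup homI)
    fix g assume "g \<in> carrier ?V"
    then show "?f g \<in> carrier (BijGroup E)" using bij by (simp add: BijGroup_def)
  next
    fix g h assume "g \<in> carrier ?V" "h \<in> carrier ?V"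
    then have gh: "g \<in> V" "h \<in> V" by auto
    have "?f (g \<otimes> h) = compose E (?f g) (?f h)"
      by (rule ext) (use gh mult cl in \<open>auto simp: compose_def restrict_def\<close>)
    then show "?f (g \<otimes>\<^bsub>?V\<^esub> h) = ?f g \<otimes>\<^bsub>BijGroup E\<^esub> ?f h"
      using bij gh by (simp add: BijGroup_def)
  qed
  then have "p dvd card (E - {x \<in> E. \<forall>g\<in>carrier ?V. ?f g x = x})"
    by (rule group_action.p_group_moved_points) (use fin p V in \<open>auto simp: order_def\<close>)
  moreover have "{x \<in> E. \<forall>g\<in>carrier ?V. ?f g x = x} = {x \<in> E. \<forall>g\<in>V. f g x = x}" by auto
  ultimately show ?thesis by simp
qed

text \<open>\<open>V\<close> permutes the right cosets of \<open>P\<close> in \<open>N\<close> by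
  right multiplication. Their number is prime to \<open>p\<close>, so some coset
  \<open>P #> n\<close> is fixed, which says that \<open>n\<close> conjugates \<open>V\<close> into
  \<open>P\<close>. Here \<open>P\<close> may be any subgroup whose index in \<open>N\<close> is
  prime to \<open>p\<close>.\<close>

lemma p_subgroup_conjugate_into:
  assumes finG: "finite (carrier G)" and N: "subgroup N G" and V: "subgroup V G" "V \<subseteq> N" "card V = p ^ k"
    and P: "subgroup P G" "P \<subseteq> N" and p: "Factorial_Ring.prime (p::nat)" and idx: "\<not> p dvd card N div card P"
  shows "\<exists>n\<in>N. V \<subseteq> conj_set n P"
proof -
  interpret N: subgroup N G by fact
  interpret V: subgroup V G by fact
  interpret P: subgroup P G by fact
  interpret GN: group "G\<lparr>carrier := N\<rparr>" using N by (rule subgroup_imp_group)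
  have sub: "subgroup P (G\<lparr>carrier := N\<rparr>)" using subgroup_incl[OF P(1) N P(2)] .
  define E where "E = rcosets\<^bsub>G\<lparr>carrier := N\<rparr>\<^esub> P"
  have E: "E = {P #> n | n. n \<in> N}" by (auto simp: E_def RCOSETS_def)
  have finN: "finite N" using finG N.subset finite_subset by blast
  have finE: "finite E" unfolding E using finN by simp
  have P0: "card P > 0" using P.finite_imp_card_positive finG by blast
  have "card E * card P = card N" using GN.lagrange[OF sub] by (simp add: order_def E_def)
  then have cE: "card E = card N div card P" using P0 by (metis nonzero_mult_div_cancel_right less_irrefl)
  have VN: "v \<in> N" if "v \<in> V" for v using that V by auto
  \<comment> \<open>The inverse turns right multiplication into a left action.\<close>
  let ?f = "\<lambda>v C. C #> inv v"
  have act: "P #> n #> inv v = P #> (n \<otimes> inv v)" if "n \<in> N" "v \<in> V" for n v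
    using that VN by (simp add: coset_mult_assoc P.subset)
  have "p dvd card (E - {C \<in> E. \<forall>v\<in>V. ?f v C = C})"
  proof (rule p_subgroup_moved_points[OF V(1,3) p finE])
    fix v C assume "v \<in> V" "C \<in> E"
    then obtain n where n: "n \<in> N" "C = P #> n" unfolding E by blast
    then have "?f v C = P #> (n \<otimes> inv v)" using act \<open>v \<in> V\<close> by simp
    moreover have "n \<otimes> inv v \<in> N" using n \<open>v \<in> V\<close> VN by auto
    ultimately show "?f v C \<in> E" unfolding E by blast
  next
    fix C assume "C \<in> E"
    then obtain n where "n \<in> N" "C = P #> n" unfolding E by blast
    then show "?f \<one> C = C" by (simp add: r_coset_subset_G P.subset)
  next
    fix g h C assume gh: "g \<in> V" "h \<in> V" "C \<in> E"
    then obtain n where "n \<in> N" "C = P #> n" unfolding E by blast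
    then have "C \<subseteq> carrier G" by (simp add: r_coset_subset_G P.subset)
    then show "?f (g \<otimes> h) C = ?f g (?f h C)"
      using gh by (simp add: inv_mult_group coset_mult_assoc)
  qed
  moreover have "\<not> p dvd card E" using idx cE by simp
  ultimately have "E \<noteq> E - {C \<in> E. \<forall>v\<in>V. ?f v C = C}" by auto
  then obtain n where n: "n \<in> N" "\<forall>v\<in>V. P #> n #> inv v = P #> n" unfolding E by auto
  have "V \<subseteq> conj_set (inv n) P"
  proof
    fix v assume v: "v \<in> V"
    then have "P #> (n \<otimes> inv (inv v)) = P #> n" using n act V.m_inv_closed by metis
    then have "n \<otimes> v \<in> P #> n" using n v P.subset rcos_self[of "n \<otimes> v" P] P(1) by simp
    then have "n \<otimes> v \<otimes> inv n \<in> P" using n v P.rcos_module_imp by (simp add: P.rcos_module_imp is_group)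
    then show "v \<in> conj_set (inv n) P" using n v by (subst mem_conj_set) auto
  qed
  then show ?thesis using n by blast
qed

end

section \<open>Hall subgroups of solvable groups\<close>

lemma ex_max_nat:
  assumes "finite A" "A \<noteq> {}"
  shows "\<exists>x\<in>A. \<forall>y\<in>A. (f y :: nat) \<le> f x"
proof -
  have "Max (f ` A) \<in> f ` A" using assms by simp
  then obtain x where "x \<in> A" "f x = Max (f ` A)" by auto
  then show ?thesis using assms(1) by (metis Max_ge finite_imageI imageI)
qed

text \<open>\<open>a\<close> and \<open>c\<close> are both the part of one number built from the
  primes in \<open>S\<close>: each is coprime to the cofactor of the other, hence divides the
  other.\<close>

lemma coprime_parts_unique:
  fixes a b c d :: nat
  assumes "a * b = c * d" "a * b \<noteq> 0"
    and "\<And>p. Factorial_Ring.prime p \<Longrightarrow> p dvd a \<Longrightarrow> p \<in> S" "\<And>p. Factorial_Ring.prime p \<Longrightarrow> p dvd b \<Longrightarrow> p \<notin> S"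
    and "\<And>p. Factorial_Ring.prime p \<Longrightarrow> p dvd c \<Longrightarrow> p \<in> S" "\<And>p. Factorial_Ring.prime p \<Longrightarrow> p dvd d \<Longrightarrow> p \<notin> S"
  shows "a = c"
proof -
  have cop: "coprime x y" if "\<And>p. Factorial_Ring.prime p \<Longrightarrow> p dvd x \<Longrightarrow> p \<in> S" "\<And>p. Factorial_Ring.prime p \<Longrightarrow> p dvd y \<Longrightarrow> p \<notin> S"
    for x y :: nat
  proof -
    have "gcd x y = 1"
    proof (rule ccontr)
      assume "gcd x y \<noteq> 1"
      then obtain p where "Factorial_Ring.prime p" "p dvd gcd x y" using prime_factor_nat by blast
      then show False using that by auto
    qed
    then show ?thesis by (simp add: coprime_iff_gcd_eq_1)
  qed
  have "a dvd c"
  proof -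
    have "coprime a d" using cop assms(3,6) by blast
    moreover have "a dvd c * d" unfolding assms(1)[symmetric] by simp
    ultimately show ?thesis by (simp add: coprime_dvd_mult_left_iff)
  qed
  moreover have "c dvd a"
  proof -
    have "coprime c b" using cop assms(5,4) by blast
    moreover have "c dvd a * b" unfolding assms(1) by simp
    ultimately show ?thesis by (simp add: coprime_dvd_mult_left_iff)
  qed
  ultimately show ?thesis by (rule dvd_antisym)
qed

context group
begin

lemma subgroup_card_pos: "finite (carrier G) \<Longrightarrow> subgroup H G \<Longrightarrow> card H > 0"
  using subgroup.finite_imp_card_positive by blast

text \<open>Take \<open>M\<close> maximal among the proper subgroups of \<open>L\<close> that
  contain the derived subgroup. Containing all commutators makes \<open>M\<close> normal in
  \<open>L\<close>. An element of \<open>L\<close> outside \<open>M\<close> with a prime power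
  exponent step into \<open>M\<close> extends \<open>M\<close> by that prime, and maximality forces
  the extension to be \<open>L\<close>. The derived series of \<open>M\<close> lies below that of
  \<open>L\<close>, so \<open>M\<close> is solvable.\<close>

lemma solvable_prime_index_normal:
  assumes fin: "finite (carrier G)" and sol: "solvable_seq G L" and L1: "L \<noteq> {\<one>}"
  shows "\<exists>M p. subgroup M G \<and> M \<subseteq> L \<and> solvable_seq G M \<and> (\<forall>x\<in>L. conj_set x M = M) \<and>
    Factorial_Ring.prime (p::nat) \<and> card L = p * card M"
proof -
  have L: "subgroup L G" using sol by (rule solvable_imp_subgroup)
  then interpret L: subgroup L G .
  have finL: "finite L" using fin L.subset finite_subset by blast
  obtain n where n: "(derived G ^^ n) L = {\<one>}" using solvable_imp_trivial_derived_seq[OF sol] by blast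
  define D where "D = derived G L"
  have DL: "D \<subseteq> L" unfolding D_def using derived_incl[OF _ L] by blast
  have D: "subgroup D G" unfolding D_def using derived_is_subgroup[OF L.subset] .
  have "D \<noteq> L"
  proof
    assume "D = L"
    then have "(derived G ^^ n) L = L" by (induction n) (auto simp: D_def)
    then show False using n L1 by simp
  qed
  define Ms where "Ms = {M. subgroup M G \<and> D \<subseteq> M \<and> M \<subseteq> L \<and> M \<noteq> L}"
  have "D \<in> Ms" using D DL \<open>D \<noteq> L\<close> by (auto simp: Ms_def)
  moreover have "finite Ms" by (rule finite_subset[of _ "Pow L"]) (use finL in \<open>auto simp: Ms_def\<close>)
  ultimately obtain M where M: "M \<in> Ms" and max: "\<And>N. N \<in> Ms \<Longrightarrow> card N \<le> card M"
    using ex_max_nat[of Ms card] by blast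
  have Ms: "subgroup M G" "D \<subseteq> M" "M \<subseteq> L" "M \<noteq> L" using M by (auto simp: Ms_def)
  interpret M: subgroup M G by fact
  have finM: "finite M" using finL Ms(3) finite_subset by blast
  have norm: "conj_set x M = M" if x: "x \<in> L" for x
  proof (rule conj_set_fixI)
    fix m assume m: "m \<in> M"
    have "x \<otimes> m \<otimes> inv x \<otimes> inv m \<in> derived_set G L" using x m Ms(3) by blast
    then have "x \<otimes> m \<otimes> inv x \<otimes> inv m \<in> M"
      using Ms(2) unfolding D_def derived_def by (meson generate.incl subsetD)
    moreover have "x \<otimes> m \<otimes> inv x = (x \<otimes> m \<otimes> inv x \<otimes> inv m) \<otimes> m"
      using x m by (simp add: m_assoc)
    ultimately show "x \<otimes> m \<otimes> inv x \<in> M" using m by (metis M.m_closed)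
  qed (use finM x in auto)
  obtain x where x: "x \<in> L" "x \<notin> M" using Ms by blast
  have "x [^] card L \<in> M" using pow_card_subgroup[OF fin L x(1)] by simp
  then obtain k q :: nat where kq: "Factorial_Ring.prime q" "x [^] k \<notin> M" "(x [^] k) [^] q \<in> M"
    using power_step[OF Ms(1) _ x(2), of "card L"] subgroup_card_pos[OF fin L] x(1) by auto
  define y where "y = x [^] k"
  have y: "y \<in> L" "y \<notin> M" "y [^] q \<in> M" using subgroup_pow_closed[OF L x(1)] kq by (auto simp: y_def)
  note E = extend_props[OF fin Ms(1) _ y(2) norm[OF y(1)] kq(1) y(3), simplified, OF L.mem_carrier[OF y(1)]]
  have "card (extend M y) > card M" using E(4) prime_gt_1_nat[OF kq(1)] subgroup_card_pos[OF fin Ms(1)] by simp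
  then have "extend M y \<notin> Ms" using max by (meson leD)
  then have "extend M y = L" using E(1,2) extend_subset[OF L Ms(3) y(1)] Ms(2) by (auto simp: Ms_def)
  then have "card L = q * card M" using E(4) by simp
  moreover have "(derived G ^^ n) M = {\<one>}"
  proof
    show "(derived G ^^ n) M \<subseteq> {\<one>}" using mono_exp_of_derived[OF Ms(3), of n] n by simp
    show "{\<one>} \<subseteq> (derived G ^^ n) M"
      using subgroup.one_closed[OF exp_of_derived_is_subgroup[OF Ms(1), of n]] by simp
  qed
  then have "solvable_seq G M" by (rule trivial_derived_seq_imp_solvable[OF Ms(1)])
  ultimately show ?thesis using Ms norm kq(1) by blast
qed

text \<open>Phrased through prime divisors of order and index, relative to a subgroup
  \<open>L\<close>, so that \<open>S\<close> may contain primes not dividing \<open>card L\<close>.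
  This lets the induction keep \<open>S\<close> fixed while \<open>L\<close> shrinks.\<close>

definition hall_subgroup :: "nat set \<Rightarrow> 'a set \<Rightarrow> 'a set \<Rightarrow> bool" where
  "hall_subgroup S L H \<longleftrightarrow> subgroup H G \<and> H \<subseteq> L \<and>
     (\<forall>p. Factorial_Ring.prime p \<longrightarrow> p dvd card H \<longrightarrow> p \<in> S) \<and>
     (\<forall>p. Factorial_Ring.prime p \<longrightarrow> p dvd card L div card H \<longrightarrow> p \<notin> S)"

lemma hall_card_unique:
  assumes fin: "finite (carrier G)" and L: "subgroup L G"
    and H: "hall_subgroup S L H" and K: "hall_subgroup S L K"
  shows "card H = card K"
proof (rule coprime_parts_unique[where S = S])
  have "card H dvd card L" "card K dvd card L"
    using H K L by (auto simp: hall_subgroup_def intro: card_subgroup_dvd)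
  then have e: "card H * (card L div card H) = card L" "card K * (card L div card K) = card L" by auto
  show "card H * (card L div card H) = card K * (card L div card K)" using e by simp
  show "card H * (card L div card H) \<noteq> 0" using e subgroup_card_pos[OF fin L] by simp
qed (use H K in \<open>auto simp: hall_subgroup_def\<close>)

lemma hall_subgroup_conj:
  assumes L: "subgroup L G" and g: "g \<in> L" and H: "hall_subgroup S L H"
  shows "hall_subgroup S L (conj_set g H)"
proof -
  have gc: "g \<in> carrier G" using L g subgroup.mem_carrier by fast
  have Hc: "H \<subseteq> carrier G" "H \<subseteq> L" using H subgroup.subset by (auto simp: hall_subgroup_def)
  have "conj_set g H \<subseteq> L" using conj_set_mono[OF Hc(2)] conj_set_subgroup_self[OF L g] by blast
  moreover have "subgroup (conj_set g H) G"
    using H gc by (simp add: hall_subgroup_def subgroup_conj_set)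
  ultimately show ?thesis using H card_conj_set[OF gc Hc(1)] by (simp add: hall_subgroup_def)
qed

end

section \<open>Induction step of Hall's theorem: a normal subgroup of prime index\<close>

locale prime_index_normal = group +
  fixes L M :: "'a set" and p :: nat
  assumes fin: "finite (carrier G)" and L: "subgroup L G" and M: "subgroup M G" and M_sub: "M \<subseteq> L"
    and norm: "\<And>x. x \<in> L \<Longrightarrow> conj_set x M = M"
    and p: "Factorial_Ring.prime p" and card_L: "card L = p * card M"
begin

sublocale L: subgroup L G by (rule L)
sublocale M: subgroup M G by (rule M)

lemma finL: "finite L" using fin L.subset finite_subset by blast

lemma cardM_pos: "card M > 0" using subgroup_card_pos[OF fin M] .

text \<open>This replaces computing in the quotient of \<open>L\<close> by \<open>M\<close>. The
  prime \<open>q\<close> supplied by \<open>power_step\<close> yields an extension of order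
  \<open>q * card M\<close> inside \<open>L\<close>, which forces \<open>q = p\<close> and makes the
  extension all of \<open>L\<close>.\<close>

lemma outside_power:
  assumes y: "y \<in> L" "y \<notin> M" and N: "y [^] (N::nat) \<in> M" "N > 0"
  shows "p dvd N" "\<exists>k::nat. y [^] k \<notin> M \<and> (y [^] k) [^] p \<in> M \<and> extend M (y [^] k) = L"
proof -
  obtain k q :: nat where kq: "Factorial_Ring.prime q" "q dvd N" "y [^] k \<notin> M" "(y [^] k) [^] q \<in> M"
    using power_step[OF M _ y(2) N] y(1) by auto
  define z where "z = y [^] k"
  have z: "z \<in> L" "z \<notin> M" "z [^] q \<in> M" using subgroup_pow_closed[OF L y(1)] kq by (auto simp: z_def)
  note E = extend_props[OF fin M L.mem_carrier[OF z(1)] z(2) norm[OF z(1)] kq(1) z(3)]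
  have sub: "extend M z \<subseteq> L" by (rule extend_subset[OF L M_sub z(1)])
  have "q * card M dvd p * card M" using card_subgroup_dvd[OF E(1) L sub] E(4) card_L by simp
  then have "q dvd p" using cardM_pos by simp
  then have qp: "q = p" using p kq(1) by (simp add: primes_dvd_imp_eq)
  then show "p dvd N" using kq by simp
  have "extend M z = L" by (rule card_subset_eq[OF finL sub]) (use E(4) qp card_L in simp)
  then show "\<exists>k::nat. y [^] k \<notin> M \<and> (y [^] k) [^] p \<in> M \<and> extend M (y [^] k) = L"
    using kq qp unfolding z_def by blast
qed

text \<open>The second isomorphism theorem in this setting: \<open>H\<close> contains some
  \<open>z\<close> outside \<open>M\<close> with \<open>z [^] p\<close> in \<open>M\<close>, and
  since \<open>L\<close> is M<z>, the group \<open>H\<close> is the extension of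
  \<open>H \<inter> M\<close> by \<open>z\<close>.\<close>

lemma card_Int_normal:
  assumes H: "subgroup H G" "H \<subseteq> L" "\<not> H \<subseteq> M"
  shows "p dvd card H" "card H = p * card (H \<inter> M)"
proof -
  interpret H: subgroup H G by fact
  obtain y where y: "y \<in> H" "y \<notin> M" using H by blast
  have N: "y [^] card H \<in> M" using pow_card_subgroup[OF fin H(1) y(1)] by simp
  note o = outside_power[OF _ y(2) N subgroup_card_pos[OF fin H(1)]]
  show "p dvd card H" using o(1) y H by blast
  obtain k :: nat where k: "y [^] k \<notin> M" "(y [^] k) [^] p \<in> M" "extend M (y [^] k) = L"
    using o(2) y H by blast
  define z where "z = y [^] k"
  have z: "z \<in> H" "z \<notin> M" "z [^] p \<in> M" using subgroup_pow_closed[OF H(1) y(1)] k by (auto simp: z_def)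
  have zp: "z [^] p \<in> H \<inter> M" using z subgroup_pow_closed[OF H(1)] by blast
  have HM: "subgroup (H \<inter> M) G" using subgroups_Inter_pair[OF H(1) M] .
  have "conj_set z (H \<inter> M) = H \<inter> M"
    using conj_set_Int[of z H M] conj_set_subgroup_self[OF H(1) z(1)] norm[of z] z(1) H(2) H.subset M.subset by auto
  note E = extend_props[OF fin HM H.mem_carrier[OF z(1)] _ this p zp]
  have "H \<subseteq> extend (H \<inter> M) z"
  proof
    fix h assume h: "h \<in> H"
    then have "h \<in> extend M z" using H k(3) z_def by blast
    then obtain m i where m: "h = m \<otimes> z [^] (i::nat)" "m \<in> M" unfolding extend_def by blast
    have zi: "z [^] i \<in> H" using subgroup_pow_closed[OF H(1) z(1)] .
    have "m = h \<otimes> inv (z [^] i)" using m zi by (simp add: m_assoc)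
    then have "m \<in> H" using h zi by simp
    then show "h \<in> extend (H \<inter> M) z" using m unfolding extend_def by blast
  qed
  moreover have "extend (H \<inter> M) z \<subseteq> H" by (rule extend_subset[OF H(1) _ z(1)]) simp
  ultimately have "extend (H \<inter> M) z = H" by blast
  then show "card H = p * card (H \<inter> M)" using E(4) z by auto
qed

text \<open>A subgroup of \<open>L\<close> not contained in \<open>M\<close> has order divisible by
  \<open>p\<close>, so for \<open>p\<close> outside \<open>S\<close> every Hall subgroup of
  \<open>L\<close> already lies in \<open>M\<close>; the extra factor \<open>p\<close> only enters
  the index.\<close>

lemma hall_not_in:
  assumes pS: "p \<notin> S"
  shows "hall_subgroup S L H \<longleftrightarrow> hall_subgroup S M H"
proof
  assume H: "hall_subgroup S M H"
  then have d: "card H dvd card M" by (auto simp: hall_subgroup_def intro: card_subgroup_dvd M)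
  have "q \<notin> S" if "Factorial_Ring.prime q" "q dvd card L div card H" for q
  proof -
    have "card L div card H = p * (card M div card H)" using d card_L by (simp add: div_mult_swap)
    then have "q dvd p \<or> q dvd card M div card H" using that by (simp add: prime_dvd_mult_iff)
    then show ?thesis using that(1) p pS H primes_dvd_imp_eq unfolding hall_subgroup_def by blast
  qed
  then show "hall_subgroup S L H" using H M_sub unfolding hall_subgroup_def by blast
next
  assume H: "hall_subgroup S L H"
  then have HL: "subgroup H G" "H \<subseteq> L" by (auto simp: hall_subgroup_def)
  have HM: "H \<subseteq> M"
  proof (rule ccontr)
    assume "\<not> H \<subseteq> M"
    then have "p dvd card H" using card_Int_normal HL by blast
    then show False using H p pS unfolding hall_subgroup_def by blast
  qed
  have d: "card H dvd card M" using card_subgroup_dvd[OF HL(1) M HM] .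
  then have "card L div card H = p * (card M div card H)" using card_L by (simp add: div_mult_swap)
  then have "card M div card H dvd card L div card H" by simp
  then show "hall_subgroup S M H" using H HM unfolding hall_subgroup_def by (meson dvd_trans)
qed

text \<open>Inside \<open>M\<close>, the index of \<open>H\<close> in \<open>L\<close> would keep
  the factor \<open>p\<close>, which belongs to \<open>S\<close>. So \<open>H\<close> leaves
  \<open>M\<close>, and \<open>H\<close> and \<open>L\<close> both lose exactly one factor
  \<open>p\<close> on intersecting with \<open>M\<close>; the index is unchanged.\<close>

lemma hall_in:
  assumes pS: "p \<in> S" and H: "hall_subgroup S L H"
  shows "hall_subgroup S M (H \<inter> M)" "card H = p * card (H \<inter> M)" "\<not> H \<subseteq> M"
proof -
  have HL: "subgroup H G" "H \<subseteq> L" using H by (auto simp: hall_subgroup_def)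
  show nM: "\<not> H \<subseteq> M"
  proof
    assume HM: "H \<subseteq> M"
    have d: "card H dvd card M" using card_subgroup_dvd[OF HL(1) M HM] .
    then have "card L div card H = p * (card M div card H)" using card_L by (simp add: div_mult_swap)
    then show False using H pS p unfolding hall_subgroup_def by (metis dvd_triv_left)
  qed
  show c: "card H = p * card (H \<inter> M)" using card_Int_normal[OF HL nM] by simp
  have s: "subgroup (H \<inter> M) G" using subgroups_Inter_pair[OF HL(1) M] .
  have "card L div card H = card M div card (H \<inter> M)"
    using c card_L p prime_gt_0_nat by (simp add: div_mult_mult1)
  moreover have "card (H \<inter> M) dvd card H" using c by simp
  ultimately show "hall_subgroup S M (H \<inter> M)" using H s unfolding hall_subgroup_def
    by (metis Int_lower2 dvd_trans)
qed

definition normalizer_in where "normalizer_in K = {x \<in> L. conj_set x K = K}"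

lemma normalizer_in_subgroup:
  assumes "K \<subseteq> carrier G"
  shows "subgroup (normalizer_in K) G"
proof (rule subgroupI)
  show "normalizer_in K \<subseteq> carrier G" by (auto simp: normalizer_in_def)
  have "\<one> \<in> normalizer_in K" using assms by (simp add: normalizer_in_def conj_set_one)
  then show "normalizer_in K \<noteq> {}" by blast
  fix a assume a: "a \<in> normalizer_in K"
  have ac: "a \<in> carrier G" "conj_set a K = K" using a by (auto simp: normalizer_in_def)
  have "conj_set (inv a) K = K" using conj_set_inv(1)[OF ac(1) assms] ac(2) by simp
  then show "inv a \<in> normalizer_in K" using a by (simp add: normalizer_in_def)
  fix b assume b: "b \<in> normalizer_in K"
  have bc: "b \<in> carrier G" "conj_set b K = K" using b by (auto simp: normalizer_in_def)
  have "conj_set (a \<otimes> b) K = conj_set a (conj_set b K)" using conj_set_mult[OF ac(1) bc(1) assms] by simp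
  then show "a \<otimes> b \<in> normalizer_in K" using a b by (simp add: normalizer_in_def)
qed

text \<open>Every conjugate of \<open>H\<close> by an element of \<open>L\<close> is again a Hall
  subgroup of \<open>M\<close>, hence conjugate to \<open>H\<close> within \<open>M\<close>, so the
  normalizer of \<open>H\<close> meets every coset of \<open>M\<close> in \<open>L\<close>
  (Frattini). The normalizer therefore leaves \<open>M\<close> and supplies an element
  \<open>z\<close> outside \<open>H\<close> with \<open>z [^] p\<close> in \<open>H\<close>.
  Adjoining \<open>z\<close> multiplies the order of \<open>H\<close> by \<open>p\<close>, so the
  index in \<open>L\<close> equals that of \<open>H\<close> in \<open>M\<close>.\<close>

lemma hall_exists_in:
  assumes pS: "p \<in> S" and H: "hall_subgroup S M H"
    and conj: "\<And>H'. hall_subgroup S M H' \<Longrightarrow> \<exists>m\<in>M. H' = conj_set m H"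
  shows "\<exists>K. hall_subgroup S L K"
proof -
  have HM: "subgroup H G" "H \<subseteq> M" using H by (auto simp: hall_subgroup_def)
  then interpret H: subgroup H G by simp
  have H0: "card H > 0" using subgroup_card_pos[OF fin HM(1)] .
  have frattini: "\<exists>m\<in>M. inv m \<otimes> x \<in> normalizer_in H" if x: "x \<in> L" for x
  proof -
    have "conj_set x H \<subseteq> M" using conj_set_mono[OF HM(2), of x] norm[OF x] by simp
    then have "hall_subgroup S M (conj_set x H)"
      using H x card_conj_set[OF _ H.subset] subgroup_conj_set[OF _ HM(1)] by (simp add: hall_subgroup_def)
    then obtain m where m: "m \<in> M" "conj_set x H = conj_set m H" using conj by blast
    have "conj_set (inv m \<otimes> x) H = conj_set (inv m) (conj_set x H)"
      using m(1) x by (simp add: conj_set_mult H.subset)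
    also have "\<dots> = H" using m by (simp only: conj_set_inv H.subset M.mem_carrier)
    finally have "conj_set (inv m \<otimes> x) H = H" .
    moreover have "inv m \<otimes> x \<in> L" using m(1) x M_sub by blast
    ultimately show ?thesis using m(1) unfolding normalizer_in_def by blast
  qed
  have N: "subgroup (normalizer_in H) G" by (rule normalizer_in_subgroup[OF H.subset])
  have "M \<noteq> L" using card_L cardM_pos prime_gt_1_nat[OF p] by auto
  then obtain x0 where x0: "x0 \<in> L" "x0 \<notin> M" using M_sub by blast
  obtain m where m: "m \<in> M" "inv m \<otimes> x0 \<in> normalizer_in H" using frattini[OF x0(1)] by blast
  define x where "x = inv m \<otimes> x0"
  have x: "x \<in> normalizer_in H" "x \<in> L" using m(2) by (auto simp: x_def normalizer_in_def)
  have "x \<notin> M"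
  proof
    assume "x \<in> M"
    then have "m \<otimes> x \<in> M" using m by simp
    moreover have "m \<otimes> x = x0" using m x0 by (simp add: x_def inv_mult_cancel)
    ultimately show False using x0 by simp
  qed
  define a where "a = multiplicity p (card L)"
  have cL: "card L \<noteq> 0" using subgroup_card_pos[OF fin L] by simp
  then obtain r where r: "card L = p ^ a * r" "\<not> p dvd r"
    unfolding a_def using multiplicity_decompose'[of "card L" p] p by (metis not_prime_unit)
  \<comment> \<open>Removes the part of the order of \<open>x\<close> prime to \<open>p\<close>. The
    power stays outside \<open>M\<close>, since an exponent taking \<open>x\<close> into
    \<open>M\<close> is divisible by \<open>p\<close> and \<open>r\<close> is not.\<close>
  define y where "y = x [^] r"
  have y: "y \<in> normalizer_in H" "y \<in> L" using subgroup_pow_closed[OF N x(1)] by (auto simp: y_def normalizer_in_def)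
  have yM: "y \<notin> M"
  proof
    assume "y \<in> M"
    moreover have "r > 0" using r cL by (cases r) auto
    ultimately show False using outside_power(1)[OF x(2) \<open>x \<notin> M\<close>, of r] r by (simp add: y_def)
  qed
  have "y [^] (p ^ a) = \<one>" using pow_card_subgroup[OF fin L x(2)] x(2) r(1) by (simp add: y_def nat_pow_pow mult_ac)
  \<comment> \<open>The iterated \<open>p\<close>-th powers of \<open>y\<close> start outside
    \<open>H\<close> and reach \<one>. The last one before they enter \<open>H\<close> is the
    element to adjoin.\<close>
  define j where "j = (LEAST j. y [^] (p ^ j) \<in> H)"
  have "y [^] (p ^ a) \<in> H" using \<open>y [^] (p ^ a) = \<one>\<close> by simp
  then have j: "y [^] (p ^ j) \<in> H" and jl: "\<And>i. i < j \<Longrightarrow> y [^] (p ^ i) \<notin> H"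
    unfolding j_def by (rule LeastI[of "\<lambda>j. y [^] (p ^ j) \<in> H"], blast dest: not_less_Least)
  have "j \<noteq> 0" using j yM HM y by (auto intro: ccontr)
  then obtain i where i: "j = Suc i" by (cases j) auto
  define z where "z = y [^] (p ^ i)"
  have z: "z \<in> normalizer_in H" "z \<in> L" using subgroup_pow_closed[OF N y(1)] by (auto simp: z_def normalizer_in_def)
  have zH: "z \<notin> H" "z [^] p \<in> H" using jl[of i] i j y by (auto simp: z_def nat_pow_pow mult.commute)
  have zn: "conj_set z H = H" using z by (simp add: normalizer_in_def)
  note E = extend_props[OF fin HM(1) L.mem_carrier[OF z(2)] zH(1) zn p zH(2)]
  have Ez: "extend H z \<subseteq> L" using extend_subset[OF L _ z(2)] HM(2) M_sub by blast
  have "\<not> extend H z \<subseteq> M"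
  proof
    assume "extend H z \<subseteq> M"
    then have "p * card H dvd card M" using card_subgroup_dvd[OF E(1) M] E(4) by simp
    then have "p dvd card M div card H" using H0 by (metis dvd_div_iff_mult dvd_mult_right not_gr_zero mult.commute)
    then show False using H p pS unfolding hall_subgroup_def by blast
  qed
  moreover have dH: "card H dvd card M" using card_subgroup_dvd[OF HM(1) M HM(2)] .
  have "card L div card (extend H z) = card M div card H"
    using E(4) card_L prime_gt_0_nat[OF p] by simp
  then have "hall_subgroup S L (extend H z)"
    using E(1,4) Ez H pS unfolding hall_subgroup_def
    by (metis p prime_dvd_mult_iff primes_dvd_imp_eq)
  then show ?thesis by blast
qed

text \<open>Conjugacy in \<open>M\<close> lets \<open>H1\<close> be replaced by a conjugate
  \<open>K\<close> with the same intersection \<open>D\<close> with \<open>M\<close> as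
  \<open>H2\<close>. Both \<open>K\<close> and \<open>H2\<close> normalize \<open>D\<close>, so
  Sylow conjugacy in the normalizer moves \<open>K\<close> to a group \<open>C\<close> that contains
  \<open>D\<close> and a Sylow \<open>p\<close>-subgroup of \<open>H2\<close>. Adjoining to
  \<open>D\<close> one element of that Sylow subgroup already gives order \<open>p * card D\<close>,
  so \<open>H2\<close> and \<open>C\<close> are both equal to this extension.\<close>

lemma hall_conjugate_in:
  assumes pS: "p \<in> S" and H: "hall_subgroup S L H1" "hall_subgroup S L H2"
    and conj: "\<And>H H'. hall_subgroup S M H \<Longrightarrow> hall_subgroup S M H' \<Longrightarrow> \<exists>m\<in>M. H' = conj_set m H"
  shows "\<exists>g\<in>L. H2 = conj_set g H1"
proof -
  have H1: "subgroup H1 G" "H1 \<subseteq> L" and H2: "subgroup H2 G" "H2 \<subseteq> L" using H by (auto simp: hall_subgroup_def)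
  obtain m where m: "m \<in> M" "H2 \<inter> M = conj_set m (H1 \<inter> M)"
    using conj[OF hall_in(1)[OF pS H(1)] hall_in(1)[OF pS H(2)]] by blast
  have mL: "m \<in> L" using m M_sub by auto
  define K where "K = conj_set m H1"
  have HK: "hall_subgroup S L K" unfolding K_def by (rule hall_subgroup_conj[OF L mL H(1)])
  then have K: "subgroup K G" "K \<subseteq> L" by (auto simp: hall_subgroup_def)
  interpret K: subgroup K G by (rule K)
  interpret H2: subgroup H2 G by (rule H2)
  define D where "D = H2 \<inter> M"
  have KM: "K \<inter> M = D"
    unfolding D_def m(2) K_def
    using conj_set_Int[OF L.mem_carrier[OF mL] subgroup.subset[OF H1(1)] M.subset] norm[OF mL] by simp
  have D: "subgroup D G" unfolding D_def using subgroups_Inter_pair[OF H2(1) M] .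
  interpret D: subgroup D G by (rule D)
  define N where "N = normalizer_in D"
  have N: "subgroup N G" unfolding N_def by (rule normalizer_in_subgroup[OF D.subset])
  have sub_N: "C \<subseteq> N" if C: "subgroup C G" "C \<subseteq> L" "C \<inter> M = D" for C
  proof
    fix x assume x: "x \<in> C"
    then have "conj_set x (C \<inter> M) = C \<inter> M"
      using conj_set_Int[of x C M] conj_set_subgroup_self[OF C(1) x] norm[of x] C(2) M.subset
        subgroup.subset[OF C(1)] by auto
    then show "x \<in> N" using x C unfolding N_def normalizer_in_def by auto
  qed
  have KN: "K \<subseteq> N" and HN: "H2 \<subseteq> N" using sub_N K H2 KM D_def by auto
  have cK: "card K = card H2" by (rule hall_card_unique[OF fin L HK H(2)])
  have cH: "card H2 = p * card D" using hall_in(2)[OF pS H(2)] by (simp add: D_def)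
  define a where "a = multiplicity p (card K)"
  have cK0: "card K \<noteq> 0" using subgroup_card_pos[OF fin K(1)] by simp
  then obtain r where r: "card K = p ^ a * r" "\<not> p dvd r"
    unfolding a_def using multiplicity_decompose'[of "card K" p] p by (metis not_prime_unit)
  have sylow: "\<exists>P. subgroup P G \<and> P \<subseteq> C \<and> card P = p ^ a" if C: "subgroup C G" "card C = card K" for C
  proof -
    have "\<exists>P. subgroup P (G\<lparr>carrier := C\<rparr>) \<and> card P = p ^ a"
      by (rule sylow_thm[OF p subgroup_imp_group[OF C(1)], of a r])
        (use C r fin subgroup.subset[OF C(1)] finite_subset in \<open>auto simp: order_def\<close>)
    then obtain P where P: "subgroup P (G\<lparr>carrier := C\<rparr>)" "card P = p ^ a" by blast
    then show ?thesis using incl_subgroup[OF C(1) P(1)] subgroup.subset[OF P(1)] by auto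
  qed
  obtain P1 where P1: "subgroup P1 G" "P1 \<subseteq> K" "card P1 = p ^ a" using sylow[OF K(1)] by blast
  obtain P2 where P2: "subgroup P2 G" "P2 \<subseteq> H2" "card P2 = p ^ a" using sylow[OF H2(1)] cK by auto
  \<comment> \<open>The index of \<open>P1\<close> in \<open>N\<close> is the product of
    \<open>r\<close>, prime to \<open>p\<close>, and the index of \<open>K\<close> in
    \<open>N\<close>. The latter divides the index of \<open>K\<close> in \<open>L\<close>, which is
    prime to \<open>p\<close> by the Hall property.\<close>
  have "\<not> p dvd card N div card P1"
  proof
    assume a: "p dvd card N div card P1"
    have pa: "p ^ a > 0" using p prime_gt_0_nat by simp
    have d1: "card K dvd card N" using card_subgroup_dvd[OF K(1) N KN] .
    have d2: "card N dvd card L" using card_subgroup_dvd[OF N L] by (auto simp: N_def normalizer_in_def)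
    have "card N div card P1 = r * (card N div card K)"
    proof -
      obtain t where t: "card N = card K * t" using d1 by (elim dvdE)
      then have "card N = p ^ a * (r * t)" using r(1) by simp
      then have "card N div p ^ a = r * t" using pa by simp
      moreover have "card N div card K = t" using t cK0 by simp
      ultimately show ?thesis using P1(3) by simp
    qed
    then have "p dvd card N div card K" using a r(2) p by (simp add: prime_dvd_mult_iff)
    moreover have "card N div card K dvd card L div card K"
    proof -
      obtain t where t: "card N = card K * t" using d1 by (elim dvdE)
      obtain u where "card L = card N * u" using d2 by (elim dvdE)
      then have "card L div card K = t * u" using t cK0 by (simp add: mult.assoc)
      moreover have "card N div card K = t" using t cK0 by simp
      ultimately show ?thesis by simp
    qed
    ultimately show False using HK p pS unfolding hall_subgroup_def by (meson dvd_trans)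
  qed
  then obtain n where n: "n \<in> N" "P2 \<subseteq> conj_set n P1"
    using p_subgroup_conjugate_into[OF fin N P2(1) _ P2(3) P1(1) _ p] P2(2) HN P1(2) KN by blast
  have nL: "n \<in> L" and nD: "conj_set n D = D" using n by (auto simp: N_def normalizer_in_def)
  define C where "C = conj_set n K"
  have HC: "hall_subgroup S L C" unfolding C_def by (rule hall_subgroup_conj[OF L nL HK])
  then have C: "subgroup C G" "C \<subseteq> L" by (auto simp: hall_subgroup_def)
  have DC: "D \<subseteq> C" using conj_set_mono[of D K n] KM nD unfolding C_def by blast
  have DH: "D \<subseteq> H2" by (auto simp: D_def)
  have PC: "P2 \<subseteq> C" using n(2) conj_set_mono[OF P1(2), of n] unfolding C_def by blast
  \<comment> \<open>\<open>p ^ a\<close> is the exact power of \<open>p\<close> in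
    \<open>card H2 = p * card D\<close>, so it cannot divide \<open>card D\<close>.\<close>
  have "\<not> P2 \<subseteq> D"
  proof
    assume "P2 \<subseteq> D"
    then have "p ^ a dvd card D" using card_subgroup_dvd[OF P2(1) D] P2(3) by simp
    then have "p ^ Suc a dvd card K" using cK cH by simp
    then have "p dvd r" using r(1) p prime_gt_0_nat by simp
    then show False using r by simp
  qed
  then obtain y where y: "y \<in> P2" "y \<notin> D" by blast
  have yc: "y \<in> carrier G" "y \<in> H2" using y P2 subgroup.subset by blast+
  have "y [^] (p ^ a) \<in> D" using pow_card_subgroup[OF fin P2(1) y(1)] P2(3) by simp
  then obtain k q :: nat where kq: "Factorial_Ring.prime q" "q dvd p ^ a" "y [^] k \<notin> D" "(y [^] k) [^] q \<in> D"
    using power_step[OF D yc(1) y(2)] p prime_gt_0_nat by (metis zero_less_power)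
  have qp: "q = p" using kq p prime_dvd_power primes_dvd_imp_eq by blast
  define z where "z = y [^] k"
  have z: "z \<in> P2" "z \<notin> D" "z [^] p \<in> D" using kq qp subgroup_pow_closed[OF P2(1) y(1)] by (auto simp: z_def)
  have zH: "z \<in> H2" "z \<in> C" using z P2 PC by blast+
  have zn: "conj_set z D = D" using zH HN by (auto simp: N_def normalizer_in_def)
  note E = extend_props[OF fin D H2.mem_carrier[OF zH(1)] z(2) zn p z(3)]
  have finH: "finite H2" "finite C" using fin H2.subset C finL finite_subset by blast+
  have cC: "card C = card H2" by (rule hall_card_unique[OF fin L HC H(2)])
  have "extend D z = H2"
    by (rule card_subset_eq[OF finH(1) extend_subset[OF H2(1) DH zH(1)]]) (use E(4) cH in simp)
  moreover have "extend D z = C"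
    by (rule card_subset_eq[OF finH(2) extend_subset[OF C(1) DC zH(2)]]) (use E(4) cH cC in simp)
  moreover have "C = conj_set (n \<otimes> m) H1"
    unfolding C_def K_def using nL mL H1 by (simp add: conj_set_mult subgroup.subset)
  ultimately show ?thesis using nL mL by auto
qed

end

context group
begin

text \<open>Existence and conjugacy form one induction because the Frattini step for existence in
  \<open>L\<close> uses conjugacy in \<open>M\<close>.\<close>

theorem hall_theorem:
  assumes fin: "finite (carrier G)" and "solvable_seq G L"
  shows "(\<exists>H. hall_subgroup S L H) \<and>
    (\<forall>H K. hall_subgroup S L H \<longrightarrow> hall_subgroup S L K \<longrightarrow> (\<exists>g\<in>L. K = conj_set g H))"
  using assms(2)
proof (induction "card L" arbitrary: L rule: less_induct)
  case less
  have L: "subgroup L G" using less.prems by (rule solvable_imp_subgroup)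
  show ?case
  proof (cases "L = {\<one>}")
    case True
    have "H = {\<one>}" if "hall_subgroup S L H" for H
      using that True subgroup.one_closed unfolding hall_subgroup_def by blast
    moreover have "hall_subgroup S L {\<one>}"
      using True by (auto simp: hall_subgroup_def triv_subgroup)
    moreover have "conj_set \<one> {\<one>} = {\<one>}" by (simp add: conj_set_def)
    ultimately show ?thesis using True by blast
  next
    case False
    obtain M p where Mp: "subgroup M G" "M \<subseteq> L" "solvable_seq G M" "\<forall>x\<in>L. conj_set x M = M"
      "Factorial_Ring.prime (p::nat)" "card L = p * card M"
      using solvable_prime_index_normal[OF fin less.prems False] by blast
    interpret prime_index_normal G L M p
      by (intro prime_index_normal.intro prime_index_normal_axioms.intro is_group) (use fin L Mp in blast)+
    have "card M < card L" using Mp(6) cardM_pos prime_gt_1_nat[OF p] by simp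
    note IH = less.hyps[OF this Mp(3)]
    show ?thesis
    proof (cases "p \<in> S")
      case False
      then show ?thesis using IH M_sub unfolding hall_not_in[OF False] by blast
    next
      case True
      obtain H where H: "hall_subgroup S M H" using IH by blast
      have conj: "\<exists>m\<in>M. H' = conj_set m H" if "hall_subgroup S M H" "hall_subgroup S M H'" for H H'
        using IH that by blast
      show ?thesis using hall_exists_in[OF True H conj[OF H]] hall_conjugate_in[OF True _ _ conj] by blast
    qed
  qed
qed

end

section \<open>Inverse-closed transversals and double cosets\<close>

context group
begin

text \<open>The representative of the coset \<open>H\<close> need not be \<one>; it can be any
  element of \<open>H\<close> equal to its own inverse.\<close>

definition inv_closed_transversal :: "'a set \<Rightarrow> 'a set \<Rightarrow> bool" where
  "inv_closed_transversal H T \<longleftrightarrow> T \<subseteq> carrier G \<and> (\<forall>t\<in>T. inv t \<in> T) \<and>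
     (\<forall>x\<in>carrier G. \<exists>!t. t \<in> T \<and> t \<in> H #> x)"

text \<open>The transversal is \<open>insert \<one> S\<close>. For \<open>x\<close> outside
  \<open>H\<close>, an arc from \<open>inv x\<close> to \<open>c\<close> in \<open>H\<close> means
  that \<open>c \<otimes> x\<close> lies in \<open>S\<close>, so a unique neighbour of
  \<open>inv x\<close> in \<open>H\<close> is a unique element of \<open>S\<close> in
  \<open>H #> x\<close>. Independence keeps \<open>S\<close> out of \<open>H\<close>, leaving \<one>
  as the representative of that coset.\<close>

lemma perfect_code_imp_transversal:
  assumes "subgroup_perfect_code G H"
  shows "\<exists>T. inv_closed_transversal H T"
proof -
  have H: "subgroup H G" using assms by (simp add: subgroup_perfect_code_def)
  interpret H: subgroup H G by (rule H)
  obtain S where S: "connection_set G S" "perfect_code (cayley_graph G S) H"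
    using assms by (auto simp: subgroup_perfect_code_def)
  have Sc: "S \<subseteq> carrier G" "\<one> \<notin> S" "\<And>s. s \<in> S \<Longrightarrow> inv s \<in> S" using S(1) by (auto simp: connection_set_def)
  have ind: "(x, y) \<notin> parcs (cayley_graph G S)" if "x \<in> H" "y \<in> H" for x y
    using S(2) that by (auto simp: perfect_code_def independent_set_def)
  have uniq: "\<exists>!c. c \<in> H \<and> (v, c) \<in> parcs (cayley_graph G S)" if "v \<in> carrier G" "v \<notin> H" for v
    using S(2) that by (auto simp: perfect_code_def cayley_graph_def)
  have SH: "s \<notin> H" if "s \<in> S" for s
    using ind[of \<one> s] that Sc by (auto simp: cayley_graph_def)
  have "\<exists>!t. t \<in> insert \<one> S \<and> t \<in> H #> x" if x: "x \<in> carrier G" for x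
  proof (cases "x \<in> H")
    case True
    then have "H #> x = H" by (simp add: H.rcos_const is_group)
    then show ?thesis using SH by (auto intro!: ex1I[of _ \<one>])
  next
    case False
    then have v: "inv x \<in> carrier G" "inv x \<notin> H" using x H.m_inv_closed inv_inv by fastforce+
    obtain c where c0: "c \<in> H" "(inv x, c) \<in> parcs (cayley_graph G S)"
      and cu: "\<And>d. d \<in> H \<Longrightarrow> (inv x, d) \<in> parcs (cayley_graph G S) \<Longrightarrow> d = c"
      using uniq[OF v] by blast
    from c0 have c: "c \<in> H" "c \<otimes> x \<in> S" using x by (simp_all add: cayley_graph_def)
    show ?thesis
    proof (rule ex1I[of _ "c \<otimes> x"])
      show "c \<otimes> x \<in> insert \<one> S \<and> c \<otimes> x \<in> H #> x" using c by (auto simp: r_coset_def)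
      fix t assume t: "t \<in> insert \<one> S \<and> t \<in> H #> x"
      then obtain h where h: "h \<in> H" "t = h \<otimes> x" by (auto simp: r_coset_def)
      have "t \<noteq> \<one>"
      proof
        assume "t = \<one>"
        then have "x = inv h" using h x by (metis H.mem_carrier inv_equality inv_inv)
        then show False using h False by simp
      qed
      then have "t \<in> S" using t by simp
      then have "(inv x, h) \<in> parcs (cayley_graph G S)"
        using h x v by (auto simp: cayley_graph_def)
      then show "t = c \<otimes> x" using cu h by simp
    qed
  qed
  then have "inv_closed_transversal H (insert \<one> S)"
    using Sc by (auto simp: inv_closed_transversal_def)
  then show ?thesis by blast
qed

text \<open>\<open>T - H\<close> drops the one representative of the coset \<open>H\<close>,
  whatever it is. For \<open>v\<close> outside \<open>H\<close>, the neighbours of \<open>v\<close>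
  in \<open>H\<close> correspond to the elements of \<open>T\<close> in
  \<open>H #> inv v\<close>.\<close>

lemma transversal_imp_perfect_code:
  assumes H: "subgroup H G" and T: "inv_closed_transversal H T"
  shows "subgroup_perfect_code G H"
proof -
  interpret H: subgroup H G by (rule H)
  define S where "S = T - H"
  have Tc: "T \<subseteq> carrier G" "\<And>t. t \<in> T \<Longrightarrow> inv t \<in> T"
    and Tu: "\<And>x. x \<in> carrier G \<Longrightarrow> \<exists>!t. t \<in> T \<and> t \<in> H #> x"
    using T by (auto simp: inv_closed_transversal_def)
  have "connection_set G S"
    unfolding connection_set_def
  proof (intro conjI ballI)
    show "S \<subseteq> carrier G - {\<one>}" using Tc(1) by (auto simp: S_def)
    fix s assume "s \<in> S"
    then have s: "s \<in> T" "s \<notin> H" "s \<in> carrier G" using Tc(1) by (auto simp: S_def)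
    then have "inv s \<notin> H" using H.m_inv_closed[of "inv s"] by auto
    then show "inv s \<in> S" using s(1) Tc(2) by (simp add: S_def)
  qed
  moreover have "perfect_code (cayley_graph G S) H"
    unfolding perfect_code_def
  proof (intro conjI ballI)
    show "independent_set (cayley_graph G S) H"
      by (auto simp: independent_set_def cayley_graph_def S_def)
    fix v assume "v \<in> pverts (cayley_graph G S) - H"
    then have v: "v \<in> carrier G" "v \<notin> H" by (auto simp: cayley_graph_def)
    obtain t where t: "t \<in> T" "t \<in> H #> inv v" and tu: "\<And>s. s \<in> T \<Longrightarrow> s \<in> H #> inv v \<Longrightarrow> s = t"
      using Tu[of "inv v"] v by blast
    obtain c where c: "c \<in> H" "t = c \<otimes> inv v" using t(2) by (auto simp: r_coset_def)
    have notH: "h \<otimes> inv v \<notin> H" if "h \<in> H" for h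
    proof
      assume "h \<otimes> inv v \<in> H"
      then have "inv h \<otimes> (h \<otimes> inv v) \<in> H" using that by simp
      then have "inv v \<in> H" using that v by (simp add: inv_mult_cancel)
      then show False using v H.m_inv_closed by fastforce
    qed
    show "\<exists>!c. c \<in> H \<and> (v, c) \<in> parcs (cayley_graph G S)"
    proof (rule ex1I[of _ c])
      show "c \<in> H \<and> (v, c) \<in> parcs (cayley_graph G S)"
        using c t v notH by (auto simp: cayley_graph_def S_def)
      fix d assume d: "d \<in> H \<and> (v, d) \<in> parcs (cayley_graph G S)"
      then have "d \<otimes> inv v \<in> T" by (auto simp: cayley_graph_def S_def)
      moreover have "d \<otimes> inv v \<in> H #> inv v" using d by (auto simp: r_coset_def)
      ultimately have "d \<otimes> inv v = c \<otimes> inv v" using tu c by blast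
      then show "d = c" using d c v by simp
    qed
  qed
  ultimately show ?thesis using H by (auto simp: subgroup_perfect_code_def)
qed

section \<open>Double cosets: inversion and cardinality\<close>

definition double_coset :: "'a set \<Rightarrow> 'a \<Rightarrow> 'a set" where
  "double_coset H g = {a \<otimes> g \<otimes> b | a b. a \<in> H \<and> b \<in> H}"

end

locale finite_subgroup = group + H: subgroup H G for H +
  assumes fin: "finite (carrier G)"
begin

lemma H: "subgroup H G" by (rule H.subgroup_axioms)

lemma finH: "finite H" using fin H.subset finite_subset by blast

lemma cardH_pos: "card H > 0" using H.finite_imp_card_positive[OF fin] .

abbreviation D where "D \<equiv> double_coset H"

lemma D_I: "a \<in> H \<Longrightarrow> b \<in> H \<Longrightarrow> a \<otimes> g \<otimes> b \<in> D g"
  by (auto simp: double_coset_def)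

lemma D_E: "y \<in> D g \<Longrightarrow> (\<And>a b. a \<in> H \<Longrightarrow> b \<in> H \<Longrightarrow> y = a \<otimes> g \<otimes> b \<Longrightarrow> thesis) \<Longrightarrow> thesis"
  by (auto simp: double_coset_def)

lemma D_carrier: "g \<in> carrier G \<Longrightarrow> D g \<subseteq> carrier G"
  by (auto simp: double_coset_def)

lemma finite_D: "g \<in> carrier G \<Longrightarrow> finite (D g)"
  using D_carrier fin finite_subset by blast

lemma D_self: "g \<in> carrier G \<Longrightarrow> g \<in> D g"
  using D_I[OF H.one_closed H.one_closed, of g] by simp

lemma D_subset:
  assumes "x \<in> carrier G" "y \<in> D x"
  shows "D y \<subseteq> D x"
proof
  fix z assume "z \<in> D y"
  then obtain a b where z: "a \<in> H" "b \<in> H" "z = a \<otimes> y \<otimes> b" by (rule D_E)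
  obtain c d where y: "c \<in> H" "d \<in> H" "y = c \<otimes> x \<otimes> d" using assms(2) by (rule D_E)
  have "z = (a \<otimes> c) \<otimes> x \<otimes> (d \<otimes> b)" using z y assms(1) by (simp add: m_assoc)
  then show "z \<in> D x" using z y D_I by simp
qed

lemma D_sym:
  assumes "x \<in> carrier G" "y \<in> D x"
  shows "x \<in> D y"
proof -
  obtain c d where y: "c \<in> H" "d \<in> H" "y = c \<otimes> x \<otimes> d" using assms(2) by (rule D_E)
  have "x = inv c \<otimes> y \<otimes> inv d" using y assms(1) by (simp add: m_assoc inv_mult_cancel)
  then show ?thesis using y(1,2) by (metis D_I H.m_inv_closed)
qed

lemma D_eq:
  assumes "x \<in> carrier G" "y \<in> D x"
  shows "D y = D x"
proof -
  have "y \<in> carrier G" using assms D_carrier by blast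
  then show ?thesis using D_subset D_sym assms by blast
qed

lemma D_inv:
  assumes "x \<in> carrier G" "y \<in> D x"
  shows "inv y \<in> D (inv x)"
proof -
  obtain c d where y: "c \<in> H" "d \<in> H" "y = c \<otimes> x \<otimes> d" using assms(2) by (rule D_E)
  have "inv y = inv d \<otimes> inv x \<otimes> inv c" using y assms(1) by (simp add: m_assoc inv_mult_group)
  then show ?thesis using y D_I by simp
qed

lemma r_coset_D:
  assumes "x \<in> carrier G" "y \<in> D x"
  shows "H #> y \<subseteq> D x"
proof
  fix z assume "z \<in> H #> y"
  then obtain h where h: "h \<in> H" "z = h \<otimes> y" by (auto simp: r_coset_def)
  have "y \<in> carrier G" using assms D_carrier by blast
  then have "z = h \<otimes> y \<otimes> \<one>" using h by simp
  then have "z \<in> D y" using D_I[OF h(1) H.one_closed, of y] by simp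
  then show "z \<in> D x" using D_subset[OF assms] by blast
qed

lemma card_D_inv:
  assumes "x \<in> carrier G"
  shows "card (D (inv x)) = card (D x)"
proof -
  have le: "card (D (inv y)) \<le> card (D y)" if y: "y \<in> carrier G" for y
  proof (rule surj_card_le[OF finite_D[OF y]])
    show "D (inv y) \<subseteq> (\<lambda>z. inv z) ` D y"
    proof
      fix z assume z: "z \<in> D (inv y)"
      then have "inv z \<in> D y" "z \<in> carrier G"
        using D_inv[of "inv y" z] D_carrier[of "inv y"] y by auto
      then show "z \<in> (\<lambda>z. inv z) ` D y" by (metis image_eqI inv_inv)
    qed
  qed
  show ?thesis using le[OF assms] le[of "inv x"] assms by simp
qed

text \<open>The double coset is the image of \<open>H \<times> H\<close>. The fibre over
  \<open>a \<otimes> g \<otimes> b\<close> is parametrized by the intersection: \<open>k\<close>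
  moves from the left factor through \<open>g\<close> into the right one, replacing \<open>a\<close>
  by \<open>a \<otimes> k\<close> and \<open>b\<close> by
  \<open>inv g \<otimes> inv k \<otimes> g \<otimes> b\<close>.\<close>

lemma card_D:
  assumes g: "g \<in> carrier G"
  shows "card (D g) * card (H \<inter> conj_set g H) = card H * card H"
proof -
  let ?f = "\<lambda>(a, b). a \<otimes> g \<otimes> b"
  let ?K = "H \<inter> conj_set g H"
  have fib: "card {q \<in> H \<times> H. ?f q = d} = card ?K" if d: "d \<in> D g" for d
  proof -
    obtain a b where ab: "a \<in> H" "b \<in> H" "d = a \<otimes> g \<otimes> b" using d by (rule D_E)
    have kK: "inv g \<otimes> k \<otimes> g \<in> H" if "k \<in> ?K" for k
    proof -
      have "k \<in> carrier G" "k \<in> conj_set g H" using that by auto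
      then show ?thesis using mem_conj_set[OF g _ H.subset] by blast
    qed
    have "bij_betw (\<lambda>k. (a \<otimes> k, (inv g \<otimes> inv k \<otimes> g) \<otimes> b)) ?K {q \<in> H \<times> H. ?f q = d}"
    proof (rule bij_betw_byWitness[of _ "\<lambda>(c, e). inv a \<otimes> c"])
      show "\<forall>k\<in>?K. (\<lambda>(c, e). inv a \<otimes> c) (a \<otimes> k, (inv g \<otimes> inv k \<otimes> g) \<otimes> b) = k"
      proof
        fix k assume "k \<in> ?K"
        then have "k \<in> H" by blast
        then show "(\<lambda>(c, e). inv a \<otimes> c) (a \<otimes> k, (inv g \<otimes> inv k \<otimes> g) \<otimes> b) = k"
          using ab(1) by (simp add: inv_mult_cancel)
      qed
      show "\<forall>q\<in>{q \<in> H \<times> H. ?f q = d}. (a \<otimes> (case q of (c, e) \<Rightarrow> inv a \<otimes> c),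
              (inv g \<otimes> inv (case q of (c, e) \<Rightarrow> inv a \<otimes> c) \<otimes> g) \<otimes> b) = q"
      proof
        fix q assume "q \<in> {q \<in> H \<times> H. ?f q = d}"
        then obtain c e where q: "q = (c, e)" and ce: "c \<in> H" "e \<in> H" "c \<otimes> g \<otimes> e = d" by auto
        have "inv g \<otimes> inv (inv a \<otimes> c) \<otimes> g \<otimes> b = inv g \<otimes> inv c \<otimes> (a \<otimes> g \<otimes> b)"
          using ce(1) ab(1,2) g by (simp add: inv_mult_group m_assoc)
        also have "\<dots> = inv g \<otimes> inv c \<otimes> (c \<otimes> g \<otimes> e)" unfolding ce(3) ab(3) ..
        also have "\<dots> = e" using ce(1,2) g by (simp add: m_assoc inv_mult_cancel)
        finally show "(a \<otimes> (case q of (c, e) \<Rightarrow> inv a \<otimes> c),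
              (inv g \<otimes> inv (case q of (c, e) \<Rightarrow> inv a \<otimes> c) \<otimes> g) \<otimes> b) = q"
          using ce(1) ab(1) q by (simp add: inv_mult_cancel)
      qed
      show "(\<lambda>k. (a \<otimes> k, (inv g \<otimes> inv k \<otimes> g) \<otimes> b)) ` ?K \<subseteq> {q \<in> H \<times> H. ?f q = d}"
      proof (rule image_subsetI)
        fix k assume "k \<in> ?K"
        then have k: "k \<in> H" "k \<in> conj_set g H" by auto
        have "inv (inv g \<otimes> k \<otimes> g) = inv g \<otimes> inv k \<otimes> g" using k g by (simp add: inv_mult_group m_assoc)
        then have "inv g \<otimes> inv k \<otimes> g \<in> H" using kK k by (metis H.m_inv_closed IntI)
        moreover have "a \<otimes> k \<otimes> g \<otimes> (inv g \<otimes> inv k \<otimes> g \<otimes> b) = d"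
          unfolding ab(3) using k(1) ab(1,2) g by (simp add: m_assoc inv_mult_cancel)
        ultimately show "(a \<otimes> k, (inv g \<otimes> inv k \<otimes> g) \<otimes> b) \<in> {q \<in> H \<times> H. ?f q = d}"
          using k(1) ab(1,2) by simp
      qed
      show "(\<lambda>(c, e). inv a \<otimes> c) ` {q \<in> H \<times> H. ?f q = d} \<subseteq> ?K"
      proof (rule image_subsetI)
        fix q assume "q \<in> {q \<in> H \<times> H. ?f q = d}"
        then obtain c e where q: "q = (c, e)" and ce: "c \<in> H" "e \<in> H" "c \<otimes> g \<otimes> e = d" by auto
        have "inv g \<otimes> (inv a \<otimes> c) \<otimes> g = inv g \<otimes> (inv a \<otimes> (c \<otimes> g \<otimes> e) \<otimes> inv e)"
          using ce(1,2) ab(1,2) g by (simp add: m_assoc)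
        also have "\<dots> = b \<otimes> inv e" unfolding ce(3) ab(3) using ab(1,2) ce(1,2) g by (simp add: m_assoc inv_mult_cancel)
        finally have "inv g \<otimes> (inv a \<otimes> c) \<otimes> g \<in> H" using ab(2) ce(2) by simp
        then have "inv a \<otimes> c \<in> conj_set g H"
          using ce(1) ab(1) g by (simp add: mem_conj_set H.subset)
        then show "(\<lambda>(c, e). inv a \<otimes> c) q \<in> ?K" using ce(1) ab(1) q by simp
      qed
    qed
    then show ?thesis by (simp add: bij_betw_same_card)
  qed
  have img: "?f ` (H \<times> H) = D g" by (auto simp: double_coset_def)
  have "card (H \<times> H) = (\<Sum>d\<in>?f ` (H \<times> H). card {q \<in> H \<times> H. ?f q = d})"
    using sum.image_gen[of "H \<times> H" "\<lambda>_. 1 :: nat" ?f] finH by simp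
  also have "\<dots> = (\<Sum>d\<in>D g. card ?K)" unfolding img using fib by (intro sum.cong) auto
  finally show ?thesis by (simp add: card_cartesian_product)
qed

end

section \<open>Inverse-closed representatives for a family of disjoint sets\<close>

context group
begin

text \<open>A partial inverse-closed transversal for the family \<open>X\<close>, stated for
  arbitrary sets so that the pairing arguments are independent of cosets.\<close>

definition meets_once :: "'a set set \<Rightarrow> 'a set \<Rightarrow> bool" where
  "meets_once X S \<longleftrightarrow> S \<subseteq> \<Union>X \<and> (\<forall>s\<in>S. inv s \<in> S) \<and> (\<forall>A\<in>X. \<exists>!s. s \<in> S \<and> s \<in> A)"

lemma meets_once_insert_one:
  assumes S: "meets_once X S" and a: "a \<in> A" "inv a = a" and dis: "\<And>B. B \<in> X \<Longrightarrow> A \<inter> B = {}"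
  shows "meets_once (insert A X) (insert a S)"
  unfolding meets_once_def
proof (intro conjI ballI)
  have SX: "S \<subseteq> \<Union>X" "\<And>s. s \<in> S \<Longrightarrow> inv s \<in> S" "\<And>B. B \<in> X \<Longrightarrow> \<exists>!s. s \<in> S \<and> s \<in> B"
    using S by (auto simp: meets_once_def)
  have SA: "s \<notin> A" if "s \<in> S" for s using that SX(1) dis by blast
  show "insert a S \<subseteq> \<Union>(insert A X)" using SX(1) a by blast
  show "inv s \<in> insert a S" if "s \<in> insert a S" for s using that SX(2) a by auto
  fix B assume B: "B \<in> insert A X"
  show "\<exists>!s. s \<in> insert a S \<and> s \<in> B"
  proof (cases "B = A")
    case True
    then show ?thesis using SA a by blast
  next
    case False
    then have "B \<in> X" "a \<notin> B" using B a dis by blast+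
    then show ?thesis using SX(3)[of B] by blast
  qed
qed

lemma meets_once_insert_two:
  assumes S: "meets_once X S" and a: "a \<in> A" "inv a \<in> B" "a \<in> carrier G" and AB: "A \<inter> B = {}"
    and dA: "\<And>C. C \<in> X \<Longrightarrow> A \<inter> C = {}" and dB: "\<And>C. C \<in> X \<Longrightarrow> B \<inter> C = {}"
  shows "meets_once (insert A (insert B X)) (insert a (insert (inv a) S))"
  unfolding meets_once_def
proof (intro conjI ballI)
  have SX: "S \<subseteq> \<Union>X" "\<And>s. s \<in> S \<Longrightarrow> inv s \<in> S" "\<And>B. B \<in> X \<Longrightarrow> \<exists>!s. s \<in> S \<and> s \<in> B"
    using S by (auto simp: meets_once_def)
  have SA: "s \<notin> A" "s \<notin> B" if "s \<in> S" for s using that SX(1) dA dB by blast+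
  have aB: "a \<notin> B" "inv a \<notin> A" using a AB by blast+
  let ?S = "insert a (insert (inv a) S)"
  show "?S \<subseteq> \<Union>(insert A (insert B X))" using SX(1) a by blast
  show "inv s \<in> ?S" if "s \<in> ?S" for s using that SX(2) a by auto
  fix C assume C: "C \<in> insert A (insert B X)"
  then consider "C = A" | "C = B" | "C \<in> X" by blast
  then show "\<exists>!s. s \<in> ?S \<and> s \<in> C"
  proof cases
    case 1
    then show ?thesis using SA aB a by blast
  next
    case 2
    then show ?thesis using SA aB a by blast
  next
    case 3
    then have "a \<notin> C" "inv a \<notin> C" using a dA dB by blast+
    then show ?thesis using SX(3)[OF 3] by blast
  qed
qed

text \<open>For the cosets in a self-inverse double coset: any two members can be represented by an
  element and its inverse, so an even family is split into pairs arbitrarily.\<close>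

lemma meets_once_pairing:
  assumes "finite X" and "X \<subseteq> Pow (carrier G)" and "pairwise disjnt X"
    and "\<And>A B. A \<in> X \<Longrightarrow> B \<in> X \<Longrightarrow> \<exists>a\<in>A. inv a \<in> B" and "even (card X)"
  shows "\<exists>S. meets_once X S"
  using assms
proof (induction "card X" arbitrary: X rule: less_induct)
  case less
  show ?case
  proof (cases "X = {}")
    case True
    then have "meets_once X {}" by (simp add: meets_once_def)
    then show ?thesis by blast
  next
    case False
    then obtain A where A: "A \<in> X" by blast
    have "card X \<noteq> 1" using less.prems(5) by auto
    then have "X \<noteq> {A}" by auto
    then obtain B where B: "B \<in> X" "B \<noteq> A" using A by blast
    define Y where "Y = X - {A, B}"
    have X: "X = insert A (insert B Y)" using A B by (auto simp: Y_def)
    have fY: "finite Y" using less.prems(1) by (simp add: Y_def)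
    have cX: "card X = card Y + 2" unfolding X using fY B(2) by (simp add: Y_def)
    have "\<exists>S. meets_once Y S"
    proof (rule less.hyps)
      show "card Y < card X" "even (card Y)" using cX less.prems(5) by auto
      show "pairwise disjnt Y" using less.prems(3) by (rule pairwise_subset) (auto simp: Y_def)
      show "Y \<subseteq> Pow (carrier G)" using less.prems(2) by (auto simp: Y_def)
      show "\<And>A B. A \<in> Y \<Longrightarrow> B \<in> Y \<Longrightarrow> \<exists>a\<in>A. inv a \<in> B" using less.prems(4) by (simp add: Y_def)
    qed (rule fY)
    then obtain S where S: "meets_once Y S" by blast
    obtain a where a: "a \<in> A" "inv a \<in> B" using less.prems(4)[OF A B(1)] by blast
    have dis: "C \<inter> E = {}" if "C \<in> X" "E \<in> X" "C \<noteq> E" for C E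
      using less.prems(3) that by (simp add: pairwise_def disjnt_def)
    have "meets_once (insert A (insert B Y)) (insert a (insert (inv a) S))"
    proof (rule meets_once_insert_two[OF S a])
      show "a \<in> carrier G" using a(1) A less.prems(2) by blast
      show "A \<inter> B = {}" using dis[OF A B(1)] B(2) by simp
      fix C assume "C \<in> Y"
      then have "C \<in> X" "A \<noteq> C" "B \<noteq> C" by (auto simp: Y_def)
      then show "A \<inter> C = {}" "B \<inter> C = {}" using dis[OF A] dis[OF B(1)] by blast+
    qed
    then show ?thesis using X by blast
  qed
qed

text \<open>For a double coset different from its inverse: the cosets of one are matched with those
  of the other by any bijection, with no parity condition.\<close>

lemma meets_once_matching:
  assumes "finite X" "finite Y" "card X = card Y" "X \<inter> Y = {}" "X \<subseteq> Pow (carrier G)" "pairwise disjnt (X \<union> Y)"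
    and "\<And>A B. A \<in> X \<Longrightarrow> B \<in> Y \<Longrightarrow> \<exists>a\<in>A. inv a \<in> B"
  shows "\<exists>S. meets_once (X \<union> Y) S"
  using assms
proof (induction X arbitrary: Y rule: finite_induct)
  case empty
  then have "meets_once ({} \<union> Y) {}" by (simp add: meets_once_def)
  then show ?case by blast
next
  case (insert A X)
  have "Y \<noteq> {}" using insert.prems insert.hyps by auto
  then obtain B where B: "B \<in> Y" by blast
  define Z where "Z = Y - {B}"
  have Y: "Y = insert B Z" "B \<notin> Z" using B by (auto simp: Z_def)
  have "\<exists>S. meets_once (X \<union> Z) S"
  proof (rule insert.IH)
    show "finite Z" using insert.prems(1) by (simp add: Z_def)
    show "card X = card Z" using insert.prems(1,2) insert.hyps B by (simp add: Z_def)
    show "X \<inter> Z = {}" using insert.prems(3) by (auto simp: Z_def)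
    show "X \<subseteq> Pow (carrier G)" using insert.prems(4) by simp
    show "pairwise disjnt (X \<union> Z)" using insert.prems(5) by (rule pairwise_subset) (auto simp: Z_def)
    show "\<And>A B. A \<in> X \<Longrightarrow> B \<in> Z \<Longrightarrow> \<exists>a\<in>A. inv a \<in> B" using insert.prems(6) by (simp add: Z_def)
  qed
  then obtain S where S: "meets_once (X \<union> Z) S" by blast
  obtain a where a: "a \<in> A" "inv a \<in> B" using insert.prems(6)[of A B] B by blast
  have dis: "C \<inter> E = {}" if "C \<in> insert A X \<union> Y" "E \<in> insert A X \<union> Y" "C \<noteq> E" for C E
    using insert.prems(5) that unfolding pairwise_def disjnt_def by blast
  have AY: "A \<notin> Y" "B \<notin> X" "B \<noteq> A" using insert.prems(3) B by auto
  have "meets_once (insert A (insert B (X \<union> Z))) (insert a (insert (inv a) S))"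
  proof (rule meets_once_insert_two[OF S a])
    show "a \<in> carrier G" using a(1) insert.prems(4) by auto
    show "A \<inter> B = {}" using dis[of A B] AY B by simp
    fix C assume C: "C \<in> X \<union> Z"
    have "A \<noteq> C" "B \<noteq> C" "C \<in> insert A X \<union> Y" using C AY insert.hyps by (auto simp: Z_def)
    then show "A \<inter> C = {}" "B \<inter> C = {}" using dis[of A C] dis[of B C] B by auto
  qed
  moreover have "insert A (insert B (X \<union> Z)) = insert A X \<union> Y" using Y by blast
  ultimately show ?case by metis
qed

end

section \<open>Assembling a transversal from the double cosets\<close>

context finite_subgroup
begin

definition cosets_in :: "'a set \<Rightarrow> 'a set set" where
  "cosets_in E = (\<lambda>y. H #> y) ` E"

lemma Union_cosets_in:
  assumes "x \<in> carrier G"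
  shows "\<Union>(cosets_in (D x)) = D x"
proof
  show "\<Union>(cosets_in (D x)) \<subseteq> D x" using r_coset_D[OF assms] by (auto simp: cosets_in_def)
  have "y \<in> H #> y" if "y \<in> D x" for y
    using that D_carrier[OF assms] rcos_self[OF _ H] by blast
  then show "D x \<subseteq> \<Union>(cosets_in (D x))" by (auto simp: cosets_in_def)
qed

lemma cosets_in_rcosets: "E \<subseteq> carrier G \<Longrightarrow> cosets_in E \<subseteq> rcosets H"
  by (auto simp: cosets_in_def RCOSETS_def)

lemma disjoint_cosets: "E \<subseteq> carrier G \<Longrightarrow> pairwise disjnt (cosets_in E)"
  by (rule pairwise_subset[OF rcos_disjoint[OF H] cosets_in_rcosets])

lemma card_cosets_in:
  assumes x: "x \<in> carrier G"
  shows "card (cosets_in (D x)) * card (H \<inter> conj_set x H) = card H"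
proof -
  have "card H * card (cosets_in (D x)) = card (\<Union>(cosets_in (D x)))"
  proof (rule card_partition)
    show "finite (cosets_in (D x))" using finite_D[OF x] by (simp add: cosets_in_def)
    show "finite (\<Union>(cosets_in (D x)))" using finite_D[OF x] by (simp add: Union_cosets_in x)
    show "card c = card H" if "c \<in> cosets_in (D x)" for c
      using card_rcosets_equal[of c H] that cosets_in_rcosets[OF D_carrier[OF x]] H.subset by auto
    show "c1 \<inter> c2 = {}" if "c1 \<in> cosets_in (D x)" "c2 \<in> cosets_in (D x)" "c1 \<noteq> c2" for c1 c2
      using disjoint_cosets[OF D_carrier[OF x]] that by (simp add: pairwise_def disjnt_def)
  qed
  then have "card H * card (cosets_in (D x)) * card (H \<inter> conj_set x H) = card H * card H"
    using card_D[OF x] by (simp add: Union_cosets_in x)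
  then show ?thesis using cardH_pos by (simp add: mult.assoc)
qed

lemma card_cosets_in_eq_div:
  assumes x: "x \<in> carrier G"
  shows "card (cosets_in (D x)) = card H div card (H \<inter> conj_set x H)"
  using card_cosets_in[OF x] cardH_pos by (metis mult_is_0 nonzero_mult_div_cancel_right not_gr_zero)

lemma coset_link:
  assumes x: "x \<in> carrier G" and y: "y \<in> D x" and z: "z \<in> D (inv x)"
  shows "\<exists>a\<in>H #> y. inv a \<in> H #> z"
proof -
  obtain a b where ab: "a \<in> H" "b \<in> H" "y = a \<otimes> x \<otimes> b" using y by (rule D_E)
  obtain c d where cd: "c \<in> H" "d \<in> H" "z = c \<otimes> inv x \<otimes> d" using z by (rule D_E)
  \<comment> \<open>Left factors do not change a right coset, so only the right factors
    \<open>b\<close> of \<open>y\<close> and \<open>d\<close> of \<open>z\<close> matter: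
    \<open>w\<close> ends in \<open>x \<otimes> b\<close> and \<open>inv w\<close> ends in
    \<open>inv x \<otimes> d\<close>.\<close>
  define w where "w = inv d \<otimes> x \<otimes> b"
  have "w = (inv d \<otimes> inv a) \<otimes> y" unfolding w_def ab(3) using ab(1,2) cd(2) x by (simp add: m_assoc inv_mult_cancel)
  moreover have "inv d \<otimes> inv a \<in> H" using ab(1) cd(2) by simp
  ultimately have "w \<in> H #> y" unfolding r_coset_def by blast
  have "inv w = (inv b \<otimes> inv c) \<otimes> z" unfolding w_def cd(3)
    using ab(1,2) cd(1,2) x by (simp add: m_assoc inv_mult_cancel inv_mult_group)
  moreover have "inv b \<otimes> inv c \<in> H" using ab(2) cd(1) by simp
  ultimately have "inv w \<in> H #> z" unfolding r_coset_def by blast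
  then show ?thesis using \<open>w \<in> H #> y\<close> by blast
qed

lemma D_disjoint:
  assumes "x \<in> carrier G" "y \<in> carrier G" "D x \<inter> D y \<noteq> {}"
  shows "D x = D y"
proof -
  obtain z where "z \<in> D x" "z \<in> D y" using assms(3) by blast
  then show ?thesis using D_eq[OF assms(1)] D_eq[OF assms(2)] by metis
qed

lemma transversal_in_symmetric_part:
  assumes x: "x \<in> carrier G"
    and crit: "\<And>g. g \<in> carrier G \<Longrightarrow> g \<notin> H \<Longrightarrow> g \<otimes> g \<in> H \<Longrightarrow>
      odd (card H div card (H \<inter> conj_set g H)) \<Longrightarrow> \<exists>t\<in>D g. t \<otimes> t = \<one>"
  shows "\<exists>S. meets_once (cosets_in (D x \<union> D (inv x))) S"
proof (cases "inv x \<in> D x")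
  case True
  have De: "D (inv x) = D x" using D_eq[OF x True] .
  let ?X = "cosets_in (D x)"
  have Dc: "D x \<subseteq> carrier G" by (rule D_carrier[OF x])
  have finX: "finite ?X" using finite_D[OF x] by (simp add: cosets_in_def)
  have Xc: "?X \<subseteq> Pow (carrier G)" using Union_cosets_in[OF x] Dc by blast
  have link: "\<exists>a\<in>A. inv a \<in> B" if "A \<in> ?X" "B \<in> ?X" for A B
    using that coset_link[OF x] De by (auto simp: cosets_in_def)
  have "\<exists>S. meets_once ?X S"
  proof (cases "even (card ?X)")
    case True
    then show ?thesis using meets_once_pairing[OF finX Xc disjoint_cosets[OF Dc] link] by blast
  next
    case False
    obtain a b where ab: "a \<in> H" "b \<in> H" "inv x = a \<otimes> x \<otimes> b" using True by (rule D_E)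
    \<comment> \<open>From \<open>inv x = a \<otimes> x \<otimes> b\<close> this representative has
      square \<open>inv a \<otimes> b\<close>, an element of \<open>H\<close>. That is why the
      criterion need only be tested on \<open>g\<close> with \<open>g \<otimes> g\<close> in
      \<open>H\<close>.\<close>
    define g where "g = x \<otimes> b"
    have g: "g \<in> carrier G" using x ab by (simp add: g_def)
    have "g = \<one> \<otimes> x \<otimes> b" using x by (simp add: g_def)
    then have gD: "g \<in> D x" using D_I[OF H.one_closed ab(2)] by simp
    then have Dg: "D g = D x" using D_eq[OF x] by blast
    have "a \<otimes> g = inv x" using ab x by (simp add: g_def m_assoc)
    then have "g = inv a \<otimes> inv x" using ab(1) g x by (metis H.mem_carrier inv_closed inv_mult_cancel(1))
    then have "g \<otimes> g = inv a \<otimes> (inv x \<otimes> (x \<otimes> b))" using ab(1,2) x by (simp add: g_def m_assoc)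
    then have gg: "g \<otimes> g \<in> H" using ab(1,2) x by (simp add: inv_mult_cancel)
    have "\<exists>t\<in>D g. t \<otimes> t = \<one>"
    proof (cases "g \<in> H")
      case True
      have "\<one> = inv g \<otimes> g \<otimes> \<one>" using g by simp
      then have "\<one> \<in> D g" using D_I[of "inv g" \<one> g] True by simp
      then show ?thesis by (intro bexI[of _ \<one>]) simp_all
    next
      case nH: False
      show ?thesis using crit[OF g nH gg] False Dg card_cosets_in_eq_div[OF g] by simp
    qed
    then obtain t where t: "t \<in> D x" "t \<otimes> t = \<one>" using Dg by blast
    have tc: "t \<in> carrier G" using t Dc by blast
    have it: "inv t = t" using inv_equality[OF t(2) tc tc] .
    let ?A = "H #> t"
    have tA: "t \<in> ?A" by (rule rcos_self[OF tc H])
    have A: "?A \<in> ?X" using t by (simp add: cosets_in_def)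
    \<comment> \<open>The coset of \<open>t\<close> is represented by \<open>t\<close>, its own
      inverse; an even number of cosets remains to be paired.\<close>
    define Y where "Y = ?X - {?A}"
    have "\<exists>S. meets_once Y S"
    proof (rule meets_once_pairing)
      show "finite Y" using finX by (simp add: Y_def)
      show "Y \<subseteq> Pow (carrier G)" using Xc by (auto simp: Y_def)
      show "pairwise disjnt Y" using disjoint_cosets[OF Dc] by (rule pairwise_subset) (auto simp: Y_def)
      show "\<exists>a\<in>A. inv a \<in> B" if "A \<in> Y" "B \<in> Y" for A B using link that by (simp add: Y_def)
      have "card ?X = Suc (card Y)" unfolding Y_def using A finX by (metis card_Suc_Diff1)
      then show "even (card Y)" using False by simp
    qed
    then obtain S where S: "meets_once Y S" by blast
    have "meets_once (insert ?A Y) (insert t S)"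
    proof (rule meets_once_insert_one[OF S tA it])
      fix B assume "B \<in> Y"
      then show "?A \<inter> B = {}" using disjoint_cosets[OF Dc] A unfolding Y_def pairwise_def disjnt_def by blast
    qed
    moreover have "insert ?A Y = ?X" using A by (auto simp: Y_def)
    ultimately show ?thesis by metis
  qed
  then show ?thesis using De by simp
next
  case False
  have ix: "inv x \<in> carrier G" using x by simp
  let ?X = "cosets_in (D x)" and ?Y = "cosets_in (D (inv x))"
  have dis: "D x \<inter> D (inv x) = {}"
  proof (rule ccontr)
    assume "D x \<inter> D (inv x) \<noteq> {}"
    then have "D x = D (inv x)" by (rule D_disjoint[OF x ix])
    then show False using D_self[OF ix] False by simp
  qed
  have XY: "?X \<union> ?Y = cosets_in (D x \<union> D (inv x))" by (simp add: cosets_in_def image_Un)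
  have "\<exists>S. meets_once (?X \<union> ?Y) S"
  proof (rule meets_once_matching)
    show "finite ?X" "finite ?Y" using finite_D x by (simp_all add: cosets_in_def)
    have "card (D (inv x)) = card (D x)" by (rule card_D_inv[OF x])
    moreover have "card (D y) = card (cosets_in (D y)) * card H" if y: "y \<in> carrier G" for y
    proof -
      have "card (D y) * card (H \<inter> conj_set y H) = card (cosets_in (D y)) * card H * card (H \<inter> conj_set y H)"
        using card_D[OF y] card_cosets_in[OF y] by (simp add: mult.commute mult.left_commute)
      moreover have "card (H \<inter> conj_set y H) \<noteq> 0" using card_cosets_in[OF y] cardH_pos by (metis mult_0_right not_gr_zero)
      ultimately show ?thesis by simp
    qed
    ultimately show "card ?X = card ?Y" using x ix cardH_pos by simp
    show "?X \<inter> ?Y = {}"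
    proof (rule ccontr)
      assume "?X \<inter> ?Y \<noteq> {}"
      then obtain y where y: "y \<in> D x" "H #> y \<in> ?Y" by (auto simp: cosets_in_def)
      have "y \<in> H #> y" using y(1) D_carrier[OF x] rcos_self[OF _ H] by blast
      then have "y \<in> D (inv x)" using y(2) Union_cosets_in[OF ix] by blast
      then show False using dis y(1) by blast
    qed
    show "?X \<subseteq> Pow (carrier G)" using Union_cosets_in[OF x] D_carrier[OF x] by blast
    show "pairwise disjnt (?X \<union> ?Y)"
      unfolding XY by (rule disjoint_cosets) (use D_carrier[OF x] D_carrier[OF ix] in blast)
    show "\<exists>a\<in>A. inv a \<in> B" if "A \<in> ?X" "B \<in> ?Y" for A B
      using that coset_link[OF x] by (auto simp: cosets_in_def)
  qed
  then show ?thesis using XY by simp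
qed

text \<open>The sets \<open>D x \<union> D (inv x)\<close> partition the group, are closed under
  inversion and consist of whole right cosets, so partial transversals of the pieces unite to a
  transversal.\<close>

theorem perfect_codeI:
  assumes crit: "\<And>g. g \<in> carrier G \<Longrightarrow> g \<notin> H \<Longrightarrow> g \<otimes> g \<in> H \<Longrightarrow>
      odd (card H div card (H \<inter> conj_set g H)) \<Longrightarrow> \<exists>t\<in>D g. t \<otimes> t = \<one>"
  shows "subgroup_perfect_code G H"
proof -
  define E where "E x = D x \<union> D (inv x)" for x
  have Ec: "E x \<subseteq> carrier G" if "x \<in> carrier G" for x
    using that D_carrier by (simp add: E_def)
  have Eeq: "E y = E x" if x: "x \<in> carrier G" and y: "y \<in> E x" for x y
  proof -
    have "D y = D x \<and> D (inv y) = D (inv x) \<or> D y = D (inv x) \<and> D (inv y) = D x"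
    proof (cases "y \<in> D x")
      case True
      then show ?thesis using D_eq[OF x True] D_eq[of "inv x", OF _ D_inv[OF x True]] x by simp
    next
      case False
      then have y': "y \<in> D (inv x)" using y by (simp add: E_def)
      then show ?thesis using D_eq[of "inv x" y] D_eq[of x "inv y"] D_inv[of "inv x" y] x by simp
    qed
    then show ?thesis by (auto simp: E_def)
  qed
  have UE: "\<Union>(cosets_in (E x)) = E x" if x: "x \<in> carrier G" for x
    using Union_cosets_in[OF x] Union_cosets_in[of "inv x"] x by (simp add: E_def cosets_in_def image_Un)
  have "\<exists>S. meets_once (cosets_in (E x)) S" if x: "x \<in> carrier G" for x
    using transversal_in_symmetric_part[OF x crit] by (simp add: E_def)
  \<comment> \<open>The choice is indexed by the piece \<open>e\<close> and not by an element
    \<open>x\<close> of it, so all elements of one piece share the same representatives.\<close>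
  then have "\<exists>F. \<forall>e \<in> E ` carrier G. meets_once (cosets_in e) (F e)"
    by (intro bchoice) blast
  then obtain F where F: "\<And>x. x \<in> carrier G \<Longrightarrow> meets_once (cosets_in (E x)) (F (E x))" by blast
  define T where "T = (\<Union>x\<in>carrier G. F (E x))"
  have FE: "F (E x) \<subseteq> E x" if "x \<in> carrier G" for x
    using F[OF that] UE[OF that] by (simp add: meets_once_def)
  have "inv_closed_transversal H T"
    unfolding inv_closed_transversal_def
  proof (intro conjI ballI)
    show "T \<subseteq> carrier G" unfolding T_def using FE Ec by blast
    show "inv t \<in> T" if t: "t \<in> T" for t
    proof -
      obtain x where x: "x \<in> carrier G" "t \<in> F (E x)" using t unfolding T_def by blast
      then have "inv t \<in> F (E x)" using F[OF x(1)] by (simp add: meets_once_def)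
      then show ?thesis using x(1) unfolding T_def by blast
    qed
    fix y assume y: "y \<in> carrier G"
    have yE: "y \<in> E y" using D_self[OF y] by (simp add: E_def)
    then have "H #> y \<in> cosets_in (E y)" by (simp add: cosets_in_def)
    then obtain s where s: "s \<in> F (E y)" "s \<in> H #> y"
      and su: "\<And>r. r \<in> F (E y) \<Longrightarrow> r \<in> H #> y \<Longrightarrow> r = s"
    proof -
      have "\<exists>!s. s \<in> F (E y) \<and> s \<in> H #> y"
        using F[OF y] \<open>H #> y \<in> cosets_in (E y)\<close> by (simp add: meets_once_def)
      then show ?thesis using that by blast
    qed
    show "\<exists>!t. t \<in> T \<and> t \<in> H #> y"
    proof (rule ex1I[of _ s])
      show "s \<in> T \<and> s \<in> H #> y" using s y unfolding T_def by blast
      fix t assume t: "t \<in> T \<and> t \<in> H #> y"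
      then obtain x where x: "x \<in> carrier G" "t \<in> F (E x)" unfolding T_def by blast
      then have "t \<in> E x" using FE by blast
      then have 1: "E t = E x" by (rule Eeq[OF x(1)])
      have "H #> y \<subseteq> E y" using UE[OF y] \<open>H #> y \<in> cosets_in (E y)\<close> by blast
      then have "E t = E y" using t Eeq[OF y, of t] by blast
      then show "t = s" using su x t 1 by simp
    qed
  qed
  then show ?thesis by (rule transversal_imp_perfect_code[OF H])
qed

end

section \<open>Perfect codes and involutions\<close>

lemma (in group) inv_fixed_parity:
  assumes "finite X" "X \<subseteq> carrier G" "\<And>x. x \<in> X \<Longrightarrow> inv x \<in> X"
  shows "even (card X) \<longleftrightarrow> even (card {x \<in> X. inv x = x})"
  by (rule involution_parity) (use assms in auto)

context finite_subgroup
begin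

lemma sq_pow: "g \<in> carrier G \<Longrightarrow> g [^] (2::nat) = g \<otimes> g"
  by (simp add: numeral_2_eq_2)

text \<open>As \<open>g \<otimes> g\<close> lies in \<open>H\<close>, the double coset of
  \<open>g\<close> is closed under inversion. By \<open>card_D\<close> its cardinality divides an
  odd number, so inversion fixes one of its elements.\<close>

lemma odd_order_perfect_code:
  assumes odd: "odd (card H)"
  shows "subgroup_perfect_code G H"
proof (rule perfect_codeI)
  fix g assume g: "g \<in> carrier G" and gg: "g \<otimes> g \<in> H"
  have "inv g = \<one> \<otimes> g \<otimes> inv (g \<otimes> g)" using g by (simp add: inv_mult_group inv_mult_cancel)
  then have "inv g \<in> D g" using D_I[of \<one> "inv (g \<otimes> g)" g] gg by simp
  then have Dg: "D (inv g) = D g" using D_eq[OF g] by blast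
  have "odd (card (D g) * card (H \<inter> conj_set g H))" using card_D[OF g] odd by simp
  then have oD: "odd (card (D g))" by simp
  have "odd (card {t \<in> D g. inv t = t})"
    using inv_fixed_parity[OF finite_D[OF g] D_carrier[OF g]] D_inv[OF g] Dg oD by simp
  then have "{t \<in> D g. inv t = t} \<noteq> {}" by (metis card.empty even_zero)
  then obtain t where t: "t \<in> D g" "inv t = t" by blast
  moreover have "t \<in> carrier G" using t D_carrier[OF g] by blast
  ultimately have "t \<otimes> t = \<one>" using r_inv[of t] by simp
  then show "\<exists>t\<in>D g. t \<otimes> t = \<one>" using t(1) by blast
qed

text \<open>Conjugation by \<open>g\<close> interchanges \<open>H\<close> and its conjugate, since
  conjugating twice is conjugation by an element of \<open>H\<close>.\<close>

lemma conj_Int_facts: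
  assumes g: "g \<in> carrier G" and gg: "g \<otimes> g \<in> H"
  shows "subgroup (H \<inter> conj_set g H) G" "conj_set g (H \<inter> conj_set g H) = H \<inter> conj_set g H"
    "g \<otimes> g \<in> H \<inter> conj_set g H"
proof -
  show "subgroup (H \<inter> conj_set g H) G" using subgroups_Inter_pair[OF H subgroup_conj_set[OF g H]] .
  have "conj_set g (conj_set g H) = H"
    using conj_set_mult[OF g g H.subset] conj_set_subgroup_self[OF H gg] by simp
  then show "conj_set g (H \<inter> conj_set g H) = H \<inter> conj_set g H"
    using conj_set_Int[OF g H.subset conj_set_carrier[OF g H.subset]] by auto
  have "inv g \<otimes> (g \<otimes> g) \<otimes> g = g \<otimes> g" using g by (simp add: inv_mult_cancel)
  then have "g \<otimes> g \<in> conj_set g H" using mem_conj_set[OF g _ H.subset, of "g \<otimes> g"] g gg by simp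
  then show "g \<otimes> g \<in> H \<inter> conj_set g H" using gg by blast
qed

text \<open>The critical case never occurs. Adjoining \<open>g\<close> to the intersection gives a
  subgroup of twice its order, yet the index of the intersection in the whole group is a product of
  two odd indices.\<close>

lemma odd_index_perfect_code:
  assumes odd: "odd (order G div card H)"
  shows "subgroup_perfect_code G H"
proof (rule perfect_codeI)
  fix g assume g: "g \<in> carrier G" "g \<notin> H" and gg: "g \<otimes> g \<in> H"
    and od: "odd (card H div card (H \<inter> conj_set g H))"
  let ?K = "H \<inter> conj_set g H"
  note K = conj_Int_facts[OF g(1) gg]
  have sq: "g [^] (2::nat) \<in> ?K" using K(3) sq_pow[OF g(1)] by simp
  have "g \<notin> ?K" using g by blast
  note U = extend_props[OF fin K(1) g(1) this K(2) two_is_prime_nat sq]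
  have "card (extend ?K g) dvd order G"
    using card_subgroup_dvd[OF U(1) subgroup_self] subgroup.subset[OF U(1)] by (simp add: order_def)
  then have "2 * card ?K dvd order G" using U(4) by simp
  moreover have "card ?K dvd card H" using card_subgroup_dvd[OF K(1) H] by simp
  then obtain j where j: "card H = card ?K * j" by (elim dvdE)
  have "card H dvd order G" using card_subgroup_dvd[OF H subgroup_self H.subset] by (simp add: order_def)
  then obtain i where i: "order G = card H * i" by (elim dvdE)
  have K0: "card ?K > 0" using subgroup_card_pos[OF fin K(1)] .
  have "odd i" "odd j" using odd od i j cardH_pos K0 by simp_all
  moreover have "2 dvd i * j"
    using \<open>2 * card ?K dvd order G\<close> K0 i j by (auto simp: mult.assoc mult.left_commute mult.commute[of 2])
  ultimately show "\<exists>t\<in>D g. t \<otimes> t = \<one>" by simp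
qed

text \<open>In a 2-group an odd index is 1, so a critical \<open>g\<close> normalizes
  \<open>H\<close> and \<open>extend H g\<close> has order \<open>2 ^ Suc k\<close>. By maximality
  it has an involution besides that of \<open>H\<close>. This lies outside \<open>H\<close>, hence
  in the coset of \<open>g\<close>, and is the required element of the double coset.\<close>

lemma maximal_unique_involution_perfect_code:
  assumes card: "card H = 2 ^ k" and u: "\<exists>!u. u \<in> H \<and> u \<noteq> \<one> \<and> u \<otimes> u = \<one>"
    and max: "\<And>Q. subgroup Q G \<Longrightarrow> H \<subseteq> Q \<Longrightarrow> card Q = 2 ^ Suc k \<Longrightarrow> \<not> (\<exists>!u. u \<in> Q \<and> u \<noteq> \<one> \<and> u \<otimes> u = \<one>)"
  shows "subgroup_perfect_code G H"
proof (rule perfect_codeI)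
  fix g assume g: "g \<in> carrier G" "g \<notin> H" and gg: "g \<otimes> g \<in> H"
    and od: "odd (card H div card (H \<inter> conj_set g H))"
  let ?K = "H \<inter> conj_set g H"
  note K = conj_Int_facts[OF g(1) gg]
  have "card ?K dvd 2 ^ k" using card_subgroup_dvd[OF K(1) H] card by simp
  then obtain i where i: "card ?K = 2 ^ i" "i \<le> k" using divides_primepow_nat[OF two_is_prime_nat] by blast
  have "card H div card ?K = 2 ^ (k - i)" using i card by (simp add: power_diff)
  then have "k = i" using od i by (cases "k - i") auto
  then have "?K = H" using card i(1) by (intro card_subset_eq finH) auto
  then have cH: "conj_set g H = H" using K(2) by simp
  have sq: "g [^] (2::nat) \<in> H" using gg sq_pow[OF g(1)] by simp
  note U = extend_props[OF fin H g(1,2) cH two_is_prime_nat sq]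
  obtain v where v: "v \<in> H" "v \<noteq> \<one>" "v \<otimes> v = \<one>" and vu: "\<And>w. w \<in> H \<Longrightarrow> w \<noteq> \<one> \<Longrightarrow> w \<otimes> w = \<one> \<Longrightarrow> w = v"
    using u by blast
  have "\<not> (\<exists>!u. u \<in> extend H g \<and> u \<noteq> \<one> \<and> u \<otimes> u = \<one>)"
    by (rule max[OF U(1,2)]) (use U(4) card in simp)
  moreover have "v \<in> extend H g" using U(2) v by blast
  ultimately obtain t where t: "t \<in> extend H g" "t \<noteq> \<one>" "t \<otimes> t = \<one>" "t \<noteq> v" using v by blast
  have "t \<notin> H" using vu t by blast
  then obtain m where m: "m \<in> H" "t = m \<otimes> g" using extend_two[OF H g(1) gg t(1)] by blast
  then have "t = m \<otimes> g \<otimes> \<one>" using g by simp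
  then have "t \<in> D g" using D_I[OF m(1) H.one_closed] by simp
  then show "\<exists>t\<in>D g. t \<otimes> t = \<one>" using t(3) by blast
qed

lemma card_transversal:
  assumes T: "inv_closed_transversal H T" and E: "E \<subseteq> carrier G" "\<And>y. y \<in> E \<Longrightarrow> H #> y \<subseteq> E"
  shows "card (T \<inter> E) = card (cosets_in E)"
proof (rule bij_betw_same_card[of "\<lambda>t. H #> t"], rule bij_betw_imageI)
  have Tu: "\<exists>!t. t \<in> T \<and> t \<in> H #> x" if "x \<in> carrier G" for x
    using T that by (simp add: inv_closed_transversal_def)
  show "inj_on (\<lambda>t. H #> t) (T \<inter> E)"
  proof (rule inj_onI)
    fix s t assume s: "s \<in> T \<inter> E" and t: "t \<in> T \<inter> E" and e: "H #> s = H #> t"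
    have sc: "s \<in> carrier G" "t \<in> carrier G" using s t E(1) by blast+
    have "s \<in> H #> s" "t \<in> H #> s" using rcos_self[OF sc(1) H] rcos_self[OF sc(2) H] e by simp_all
    then show "s = t" using Tu[OF sc(1)] s t by blast
  qed
  show "(\<lambda>t. H #> t) ` (T \<inter> E) = cosets_in E"
  proof
    show "(\<lambda>t. H #> t) ` (T \<inter> E) \<subseteq> cosets_in E" by (auto simp: cosets_in_def)
    show "cosets_in E \<subseteq> (\<lambda>t. H #> t) ` (T \<inter> E)"
    proof
      fix C assume "C \<in> cosets_in E"
      then obtain y where y: "y \<in> E" "C = H #> y" by (auto simp: cosets_in_def)
      then obtain t where t: "t \<in> T" "t \<in> H #> y" using Tu[of y] E(1) by blast
      have "H #> y = H #> t" using repr_independence[OF t(2) _ H] y E(1) by blast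
      then show "C \<in> (\<lambda>t. H #> t) ` (T \<inter> E)" using t y E(2)[OF y(1)] by blast
    qed
  qed
qed

text \<open>Two parity counts. Inversion on part of a transversal has an even number of fixed
  points, one of which represents \<open>H\<close>, so another is an involution \<open>t\<close>
  outside \<open>H\<close>. Conjugation by \<open>t\<close> on the involutions of an even-order
  subgroup of \<open>H\<close>, odd in number, then fixes some \<open>u\<close>.\<close>

lemma perfect_code_commuting_involutions:
  assumes pc: "subgroup_perfect_code G H" and ev: "even (card H)" and ei: "even (order G div card H)"
  shows "\<exists>t u. t \<in> carrier G \<and> u \<in> carrier G \<and> t \<otimes> t = \<one> \<and> u \<otimes> u = \<one> \<and> t \<noteq> \<one> \<and> u \<noteq> \<one> \<and> t \<noteq> u \<and> t \<otimes> u = u \<otimes> t"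
proof -
  obtain T where T: "inv_closed_transversal H T" using perfect_code_imp_transversal[OF pc] by blast
  have Tc: "T \<subseteq> carrier G" and Ti: "\<And>t. t \<in> T \<Longrightarrow> inv t \<in> T"
    and Tu: "\<And>x. x \<in> carrier G \<Longrightarrow> \<exists>!t. t \<in> T \<and> t \<in> H #> x"
    using T by (auto simp: inv_closed_transversal_def)
  have finT: "finite T" using Tc fin finite_subset by blast
  have cTD: "card (T \<inter> D x) = card (cosets_in (D x))" if x: "x \<in> carrier G" for x
    by (rule card_transversal[OF T D_carrier[OF x] r_coset_D[OF x]])
  have "card (T \<inter> carrier G) = card (cosets_in (carrier G))"
    by (rule card_transversal[OF T]) (auto simp: r_coset_def)
  moreover have "cosets_in (carrier G) = rcosets H" by (auto simp: cosets_in_def RCOSETS_def)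
  moreover have "card (rcosets H) * card H = order G" by (rule lagrange[OF H])
  ultimately have "card T = order G div card H"
    using Tc cardH_pos by (metis inf.absorb1 nonzero_mult_div_cancel_right not_gr_zero)
  then have eT: "even (card T)" using ei by simp
  \<comment> \<open>The representatives in double cosets with an odd number of cosets. The others
    fall into classes of even size, so \<open>R\<close> inherits the even parity of
    \<open>T\<close>.\<close>
  define R where "R = {t \<in> T. odd (card (T \<inter> D t))}"
  have "2 dvd card (\<Union>((\<lambda>t. T \<inter> D t) ` (T - R)))"
  proof (rule dvd_partition)
    show "finite (\<Union>((\<lambda>t. T \<inter> D t) ` (T - R)))" using finT by simp
    show "\<forall>c\<in>(\<lambda>t. T \<inter> D t) ` (T - R). 2 dvd card c" by (auto simp: R_def)
    show "\<forall>c1\<in>(\<lambda>t. T \<inter> D t) ` (T - R). \<forall>c2\<in>(\<lambda>t. T \<inter> D t) ` (T - R). c1 \<noteq> c2 \<longrightarrow> c1 \<inter> c2 = {}"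
    proof clarify
      fix s t assume st: "s \<in> T" "t \<in> T" "T \<inter> D s \<noteq> T \<inter> D t"
      then have "D s \<noteq> D t" by metis
      then have "D s \<inter> D t = {}" using D_disjoint[of s t] st Tc by blast
      then show "T \<inter> D s \<inter> (T \<inter> D t) = {}" by blast
    qed
  qed
  moreover have "\<Union>((\<lambda>t. T \<inter> D t) ` (T - R)) = T - R"
  proof
    show "\<Union>((\<lambda>t. T \<inter> D t) ` (T - R)) \<subseteq> T - R"
    proof
      fix s assume "s \<in> \<Union>((\<lambda>t. T \<inter> D t) ` (T - R))"
      then obtain t where t: "t \<in> T" "t \<notin> R" "s \<in> T" "s \<in> D t" by blast
      have "D s = D t" using D_eq[of t s] t Tc by blast
      then show "s \<in> T - R" using t by (simp add: R_def)
    qed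
    show "T - R \<subseteq> \<Union>((\<lambda>t. T \<inter> D t) ` (T - R))" using D_self Tc by blast
  qed
  moreover have "card T = card R + card (T - R)"
    using finT by (subst card_Un_disjoint[symmetric]) (auto simp: R_def intro: arg_cong[of _ _ card])
  ultimately have eR: "even (card R)" using eT by simp
  have Ri: "inv t \<in> R" if t: "t \<in> R" for t
  proof -
    have tT: "t \<in> T" "t \<in> carrier G" "odd (card (T \<inter> D t))" using t Tc by (auto simp: R_def)
    have "card (T \<inter> D (inv t)) = card (T \<inter> D t)"
    proof -
      have "(\<lambda>s. inv s) ` (T \<inter> D t) = T \<inter> D (inv t)"
      proof
        show "(\<lambda>s. inv s) ` (T \<inter> D t) \<subseteq> T \<inter> D (inv t)"
          using Ti D_inv[OF tT(2)] by (intro image_subsetI) simp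
        show "T \<inter> D (inv t) \<subseteq> (\<lambda>s. inv s) ` (T \<inter> D t)"
        proof
          fix s assume s: "s \<in> T \<inter> D (inv t)"
          then have "inv s \<in> T \<inter> D t" "inv (inv s) = s"
            using Ti D_inv[of "inv t" s] tT(2) Tc by auto
          then show "s \<in> (\<lambda>s. inv s) ` (T \<inter> D t)" by (metis image_eqI)
        qed
      qed
      moreover have "inj_on (\<lambda>s. inv s) (T \<inter> D t)"
        by (rule inj_on_subset[OF inv_inj]) (use Tc in blast)
      ultimately show ?thesis by (metis card_image)
    qed
    then show ?thesis using tT Ti by (simp add: R_def)
  qed
  have finR: "finite R" using finT by (simp add: R_def)
  have Rc: "R \<subseteq> carrier G" using Tc by (auto simp: R_def)
  have eF: "even (card {t \<in> R. inv t = t})"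
    using inv_fixed_parity[OF finR Rc Ri] eR by simp
  \<comment> \<open>The representative of \<open>H\<close> is its own inverse by uniqueness, and it
    lies in \<open>R\<close> because \<open>H\<close> is a double coset with a single coset.\<close>
  obtain s where s: "s \<in> T" "s \<in> H #> \<one>" and su: "\<And>r. r \<in> T \<Longrightarrow> r \<in> H #> \<one> \<Longrightarrow> r = s" using Tu[OF one_closed] by blast
  have H1: "H #> \<one> = H" using H.subset by simp
  then have sH: "s \<in> H" using s by simp
  have si: "inv s = s" using su[of "inv s"] Ti[OF s(1)] sH H1 by simp
  have "D s = H"
  proof
    show "D s \<subseteq> H" using sH by (auto simp: double_coset_def)
    show "H \<subseteq> D s"
    proof
      fix h assume h: "h \<in> H"
      have "h = (h \<otimes> inv s) \<otimes> s \<otimes> \<one>" using h sH by (simp add: m_assoc)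
      then show "h \<in> D s" using D_I[of "h \<otimes> inv s" \<one> s] h sH by simp
    qed
  qed
  moreover have su': "r = s" if "r \<in> T" "r \<in> H" for r using su that H1 by simp
  have "T \<inter> H = {s}" using s(1) su' sH by blast
  ultimately have "s \<in> {t \<in> R. inv t = t}" using s si by (simp add: R_def)
  moreover have "{t \<in> R. inv t = t} \<noteq> {s}" using eF by (metis card_1_singleton_iff odd_one One_nat_def)
  ultimately obtain t where t: "t \<in> R" "inv t = t" "t \<noteq> s" by blast
  have tT: "t \<in> T" "t \<in> carrier G" using t Rc by (auto simp: R_def)
  have tH: "t \<notin> H" using su'[OF tT(1)] t(3) by blast
  have tt: "t \<otimes> t = \<one>" using r_inv[OF tT(2)] t(2) by simp
  let ?K = "H \<inter> conj_set t H"
  have K: "subgroup ?K G" "conj_set t ?K = ?K"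
    using conj_Int_facts(1,2)[OF tT(2)] tt by simp_all
  interpret K: subgroup ?K G by (rule K)
  \<comment> \<open>This is where restricting to \<open>R\<close> pays off: the odd index makes
    \<open>?K\<close>, which \<open>t\<close> normalizes, of even order.\<close>
  have "odd (card H div card ?K)" using t(1) cTD[OF tT(2)] card_cosets_in_eq_div[OF tT(2)] by (simp add: R_def)
  moreover have "card ?K dvd card H" using card_subgroup_dvd[OF K(1) H] by simp
  ultimately have eK: "even (card ?K)" using ev by (metis dvd_mult_div_cancel even_mult_iff)
  define I where "I = {u \<in> ?K. inv u = u}"
  have finK: "finite ?K" using finH by simp
  have "even (card I)" unfolding I_def
    using inv_fixed_parity[OF finK K.subset K.m_inv_closed] eK by simp
  moreover have oI: "\<one> \<in> I" using K.one_closed by (simp add: I_def)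
  moreover have finI: "finite I" unfolding I_def using finH by simp
  ultimately have odI: "odd (card (I - {\<one>}))" by (metis card_Suc_Diff1 even_Suc)
  let ?f = "\<lambda>u. t \<otimes> u \<otimes> inv t"
  have Kc: "u \<in> carrier G" if "u \<in> ?K" for u using that by (rule K.mem_carrier)
  have "odd (card {u \<in> I - {\<one>}. ?f u = u})"
  proof (subst involution_parity[symmetric])
    show "finite (I - {\<one>})" using finI by simp
    show "odd (card (I - {\<one>}))" by (rule odI)
    fix u assume u: "u \<in> I - {\<one>}"
    then have uK: "u \<in> ?K" "inv u = u" "u \<noteq> \<one>" by (auto simp: I_def)
    have uc: "u \<in> carrier G" using Kc[OF uK(1)] .
    have "?f u \<in> ?K" using K(2) uK(1) unfolding conj_set_def by blast
    moreover have "inv (?f u) = ?f u" using uK(2) uc tT(2) by (simp add: inv_mult_group m_assoc)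
    moreover have "?f u \<noteq> \<one>" using uK(3) uc tT(2) by (metis inv_closed inv_inv inv_mult_cancel(1) inv_solve_right' l_one r_inv m_closed)
    ultimately show "?f u \<in> I - {\<one>}" by (simp add: I_def)
    show "?f (?f u) = u"
      using conj_conj[OF tT(2) tT(2) uc] tt uc by simp
  qed
  then have "{u \<in> I - {\<one>}. ?f u = u} \<noteq> {}" by (metis card.empty even_zero)
  then obtain u where u: "u \<in> I" "u \<noteq> \<one>" "t \<otimes> u \<otimes> inv t = u" by blast
  have uK: "u \<in> H" "u \<in> carrier G" "inv u = u" using u(1) Kc by (auto simp: I_def)
  have "u \<otimes> u = \<one>" using r_inv[OF uK(2)] uK(3) by simp
  moreover have "t \<otimes> u = u \<otimes> t" using u(3) uK(2) tT(2) by (metis inv_solve_right m_closed)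
  moreover have "t \<noteq> \<one>" "t \<noteq> u" using tH uK(1) H.one_closed by blast+
  ultimately show ?thesis using tT(2) uK(2) tt u(2) by blast
qed

end

context group
begin

text \<open>Two commuting involutions generate a 2-subgroup, which Sylow's theorem conjugates into \<open>P\<close>.\<close>

lemma commuting_involutions_in_odd_index_subgroup:
  assumes fin: "finite (carrier G)" and P: "subgroup P G" "odd (order G div card P)"
    and t: "t \<in> carrier G" "t \<otimes> t = \<one>" "t \<noteq> \<one>" and u: "u \<in> carrier G" "u \<otimes> u = \<one>" "u \<noteq> \<one>"
    and tu: "t \<noteq> u" "t \<otimes> u = u \<otimes> t"
  shows "\<exists>a\<in>P. \<exists>b\<in>P. a \<noteq> b \<and> a \<noteq> \<one> \<and> b \<noteq> \<one> \<and> a \<otimes> a = \<one> \<and> b \<otimes> b = \<one>"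
proof -
  interpret P: subgroup P G by (rule P)
  let ?U = "{\<one>, u}"
  have iu: "inv u = u" using inv_equality[OF u(2) u(1) u(1)] .
  have U: "subgroup ?U G" by (rule subgroupI) (use u iu in auto)
  have cU: "conj_set t ?U = ?U"
  proof (rule conj_set_fixI)
    fix h assume "h \<in> ?U"
    then show "t \<otimes> h \<otimes> inv t \<in> ?U" using tu(2) t(1) u(1) by (auto simp: m_assoc)
  qed (use t u in auto)
  have "t [^] (2::nat) \<in> ?U" using t by (simp add: numeral_2_eq_2)
  note V = extend_props[OF fin U t(1) _ cU two_is_prime_nat this]
  have tnU: "t \<notin> ?U" using t tu by blast
  let ?V = "extend ?U t"
  have cV: "card ?V = 2 ^ 2" using V(4)[OF tnU] u(3) by simp
  obtain n where n: "n \<in> carrier G" "?V \<subseteq> conj_set n P"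
    using p_subgroup_conjugate_into[OF fin subgroup_self V(1)[OF tnU] subgroup.subset[OF V(1)[OF tnU]]
        cV P(1) P.subset two_is_prime_nat] P(2) unfolding order_def by blast
  let ?f = "\<lambda>x. inv n \<otimes> x \<otimes> n"
  have inP: "?f x \<in> P" if "x \<in> ?V" "x \<in> carrier G" for x
    using n that mem_conj_set[OF n(1) that(2) P.subset] by blast
  have sq: "?f x \<otimes> ?f x = \<one>" if "x \<in> carrier G" "x \<otimes> x = \<one>" for x
  proof -
    have "?f x \<otimes> ?f x = ?f (x \<otimes> x)" using that(1) n(1) by (simp add: m_assoc inv_mult_cancel)
    then show ?thesis using that n(1) by simp
  qed
  have inj: "x = y" if "x \<in> carrier G" "y \<in> carrier G" "?f x = ?f y" for x y
    using that n(1) by simp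
  have f1: "?f \<one> = \<one>" using n(1) by simp
  have "?f t \<noteq> ?f u" "?f t \<noteq> \<one>" "?f u \<noteq> \<one>"
    using inj[OF t(1) u(1)] inj[OF t(1) one_closed] inj[OF u(1) one_closed] tu(1) t(3) u(3) f1 by metis+
  then show ?thesis using inP[OF V(3)[OF tnU] t(1)] inP[OF _ u(1)] V(2)[OF tnU] sq[OF t(1,2)] sq[OF u(1,2)] by blast
qed

end

section \<open>2-groups with at most one involution\<close>

text \<open>Here \<open>k\<close> and \<open>j\<close> stand for an element x acting on a cyclic
  group <a> of order 2^m by a -> a^k, with x^2 = a^j. \<open>kk\<close> says that x^2 centralizes a,
  \<open>jk\<close> that x commutes with x^2, and \<open>no\<close> that no a^i x has square 1. One
  of k - 1 and k + 1 is twice an odd number, which leaves k = 1 or k = -1 modulo 2^(m-1).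
  \<open>no\<close> then excludes -1 + 2^(m-1) and 1 + 2^(m-1), the exponents of the semidihedral
  and modular groups.\<close>

lemma square_root_exponent_mod_power_two:
  fixes k j :: int
  assumes kk: "2 ^ m dvd k * k - 1" and jk: "2 ^ m dvd j * (k - 1)"
    and no: "\<And>i. \<not> 2 ^ m dvd i * (k + 1) + j"
  shows "2 ^ m dvd k - 1 \<or> 2 ^ m dvd k + 1"
proof (rule ccontr)
  assume "\<not> (2 ^ m dvd k - 1 \<or> 2 ^ m dvd k + 1)"
  then have nm: "\<not> 2 ^ m dvd k - 1" and np: "\<not> 2 ^ m dvd k + 1" by auto
  have "m \<noteq> 0" using nm by (metis one_dvd power_0)
  then obtain r where m: "m = Suc r" by (cases m) auto
  have "2 dvd k * k - 1" using kk m by (metis dvd_mult_left power_Suc)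
  then have odd: "odd k" by auto
  have fac: "k * k - 1 = (k - 1) * (k + 1)" by (simp add: algebra_simps)
  have cop: "coprime (2 ^ r) c" if "odd c" for c :: int
    using that by (simp add: coprime_power_left_iff coprime_left_2_iff_odd)
  consider c where "k - 1 = 2 * c" "odd c" | c where "k + 1 = 2 * c" "odd c"
  proof -
    obtain d where d: "k = 2 * d + 1" using odd by (elim oddE)
    show thesis
    proof (cases "odd d")
      case True
      then show thesis using that(1)[of d] d by simp
    next
      case False
      then show thesis using that(2)[of "d + 1"] d by simp
    qed
  qed
  then show False
  proof cases
    case 1
    have "2 * 2 ^ r dvd 2 * (c * (k + 1))" using kk unfolding fac 1(1) m by (simp add: mult.assoc)
    then have "2 ^ r dvd c * (k + 1)" by simp
    then have "2 ^ r dvd k + 1" using cop[OF 1(2)] by (simp add: coprime_dvd_mult_right_iff)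
    then obtain e where e: "k + 1 = 2 ^ r * e" by (elim dvdE)
    have oe: "odd e"
    proof
      assume "even e"
      then have "2 ^ r * 2 dvd 2 ^ r * e" by (intro mult_dvd_mono) auto
      then show False using np e m by (simp add: mult.commute)
    qed
    have "2 * 2 ^ r dvd 2 * (j * c)" using jk unfolding 1(1) m by (simp add: mult.left_commute)
    then have "2 ^ r dvd j * c" by simp
    then have "2 ^ r dvd j" using cop[OF 1(2)] by (simp add: coprime_dvd_mult_left_iff)
    then obtain f where f: "j = 2 ^ r * f" by (elim dvdE)
    \<comment> \<open>The witness \<open>i = f\<close> works because \<open>e + 1\<close> is
      even.\<close>
    have "f * (k + 1) + j = 2 ^ r * (f * (e + 1))" unfolding e f by (simp add: algebra_simps)
    moreover have "2 ^ r * 2 dvd 2 ^ r * (f * (e + 1))" using oe by (intro mult_dvd_mono) auto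
    ultimately show False using no[of f] m by (simp add: mult.commute)
  next
    case 2
    have "2 * 2 ^ r dvd 2 * (c * (k - 1))" using kk unfolding fac 2(1) m by (simp add: mult.left_commute mult.commute)
    then have "2 ^ r dvd c * (k - 1)" by simp
    then have "2 ^ r dvd k - 1" using cop[OF 2(2)] by (simp add: coprime_dvd_mult_right_iff)
    then obtain e where e: "k - 1 = 2 ^ r * e" by (elim dvdE)
    have oe: "odd e"
    proof
      assume "even e"
      then have "2 ^ r * 2 dvd 2 ^ r * e" by (intro mult_dvd_mono) auto
      then show False using nm e m by (simp add: mult.commute)
    qed
    have "2 ^ r * 2 dvd 2 ^ r * (j * e)" using jk unfolding e m by (simp add: mult.left_commute mult.commute)
    then have "2 dvd j * e" by simp
    then have "even j" using oe by simp
    then obtain f where f: "j = 2 * f" by (elim evenE)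
    have "\<exists>u v. u * c + v * 2 ^ r = 1" using cop[OF 2(2)] bezout_int[of c "2 ^ r"] by (simp add: coprime_iff_gcd_eq_1 gcd.commute)
    then obtain u v where uv: "u * c + v * 2 ^ r = 1" by blast
    \<comment> \<open>\<open>u\<close> inverts \<open>c\<close> modulo \<open>2 ^ r\<close>, so this
      \<open>i\<close> solves \<open>i * (k + 1) + j = 0\<close> modulo
      \<open>2 ^ m\<close>.\<close>
    have "(- f * u) * (k + 1) + j = 2 * (f * (1 - u * c))" unfolding 2(1) f by (simp add: algebra_simps)
    also have "\<dots> = 2 * 2 ^ r * (f * v)" using uv by (simp add: algebra_simps flip: uv)
    finally show False using no[of "- f * u"] m by simp
  qed
qed

lemma not_four_dvd_square_plus_one: "\<not> (4::int) dvd l * l + 1"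
proof
  assume a: "4 dvd l * l + 1"
  show False
  proof (cases "even l")
    case True
    then have "even (l * l)" by simp
    then have "odd (l * l + 1)" by simp
    moreover have "even (l * l + 1)" using a by (meson dvd_trans even_numeral)
    ultimately show False by simp
  next
    case False
    then obtain d where "l = 2 * d + 1" by (elim oddE)
    then have "l * l + 1 = 4 * (d * d + d) + 2" by (simp add: algebra_simps)
    then have "4 dvd (2::int)" using a by (metis dvd_add_right_iff dvd_triv_left)
    then show False by simp
  qed
qed

section \<open>Powers and involutions in a cyclic subgroup\<close>

context group
begin

abbreviation cyc :: "'a \<Rightarrow> 'a set" where "cyc a \<equiv> generate G {a}"

lemma cyc_eq: "a \<in> carrier G \<Longrightarrow> cyc a = {a [^] (k::int) | k. k \<in> UNIV}"
  by (rule generate_pow)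

lemma cycE: "a \<in> carrier G \<Longrightarrow> x \<in> cyc a \<Longrightarrow> (\<And>k::int. x = a [^] k \<Longrightarrow> thesis) \<Longrightarrow> thesis"
  by (auto simp: cyc_eq)

lemma cycI: "a \<in> carrier G \<Longrightarrow> a [^] (k::int) \<in> cyc a"
  by (auto simp: cyc_eq)

lemma cyc_subgroup: "a \<in> carrier G \<Longrightarrow> subgroup (cyc a) G"
  by (simp add: generate_is_subgroup)

lemma cyc_self: "a \<in> cyc a"
  by (simp add: generate.incl)

lemma cyc_mono: "a \<in> carrier G \<Longrightarrow> b \<in> cyc a \<Longrightarrow> cyc b \<subseteq> cyc a"
  using generate_subgroup_incl[of "{b}" "cyc a"] cyc_subgroup by simp

lemma conj_int_pow:
  assumes "x \<in> carrier G" "a \<in> carrier G"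
  shows "x \<otimes> a [^] (i::int) \<otimes> inv x = (x \<otimes> a \<otimes> inv x) [^] i"
proof (cases i rule: int_cases2)
  case (nonneg n)
  then show ?thesis using assms by (simp add: int_pow_int conj_pow)
next
  case (nonpos n)
  have "x \<otimes> inv (a [^] n) \<otimes> inv x = inv (x \<otimes> a [^] n \<otimes> inv x)"
    using assms by (simp add: inv_mult_group m_assoc)
  then show ?thesis using assms nonpos by (simp add: int_pow_neg_int conj_pow)
qed

lemma conj_cyc_closed:
  assumes "a \<in> carrier G" "x \<in> carrier G" "x \<otimes> a \<otimes> inv x \<in> cyc a" "b \<in> cyc a"
  shows "x \<otimes> b \<otimes> inv x \<in> cyc a"
proof -
  obtain i :: int where i: "b = a [^] i" using cycE[OF assms(1,4)] .
  obtain k :: int where k: "x \<otimes> a \<otimes> inv x = a [^] k" using cycE[OF assms(1,3)] .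
  have "x \<otimes> b \<otimes> inv x = a [^] (k * i)" using assms i k by (simp add: conj_int_pow int_pow_pow)
  then show ?thesis using cycI[OF assms(1)] by simp
qed

text \<open>The exponent of an involution is an odd multiple of 2^(m-1), and two such multiples
  agree modulo 2^m.\<close>

lemma involution_in_cyc_unique:
  assumes a: "a \<in> carrier G" and ord: "ord a = 2 ^ m"
    and x: "x \<in> cyc a" "x \<noteq> \<one>" "x \<otimes> x = \<one>" and y: "y \<in> cyc a" "y \<noteq> \<one>" "y \<otimes> y = \<one>"
  shows "x = y"
proof -
  obtain i :: int where i: "x = a [^] i" using cycE[OF a x(1)] .
  obtain j :: int where j: "y = a [^] j" using cycE[OF a y(1)] .
  have ni: "\<not> 2 ^ m dvd i" "\<not> 2 ^ m dvd j" using x(2) y(2) i j int_pow_eq_id[OF a] ord by simp_all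
  have "a [^] (i + i) = \<one>" "a [^] (j + j) = \<one>"
    unfolding int_pow_mult[OF a] using x(3) y(3) i j by simp_all
  then have d: "2 ^ m dvd i + i" "2 ^ m dvd j + j" unfolding int_pow_eq_id[OF a] ord by simp_all
  have "m \<noteq> 0" using ni by (metis one_dvd power_0)
  then obtain r where m: "m = Suc r" by (cases m) auto
  have "2 * 2 ^ r dvd 2 * i" "2 * 2 ^ r dvd 2 * j" using d m by simp_all
  then have "2 ^ r dvd i" "2 ^ r dvd j" by simp_all
  then obtain e f where ef: "i = 2 ^ r * e" "j = 2 ^ r * f" by (elim dvdE)
  have "odd e" "odd f" using ni ef m by (auto elim!: evenE)
  then have "2 dvd f - e" by simp
  then have "2 ^ r * 2 dvd 2 ^ r * (f - e)" by (intro mult_dvd_mono) auto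
  moreover have "2 ^ r * (f - e) = j - i" "2 ^ r * 2 = (2::int) ^ m" unfolding ef m by (simp_all add: right_diff_distrib)
  ultimately have "2 ^ m dvd j - i" by metis
  then show ?thesis using int_pow_eq[OF a] ord i j by simp
qed

lemma involution_in_cyc:
  assumes a: "a \<in> carrier G" "a \<noteq> \<one>" and ord: "ord a = 2 ^ m"
  shows "\<exists>z\<in>cyc a. z \<noteq> \<one> \<and> z \<otimes> z = \<one>"
proof -
  have "m \<noteq> 0" using a ord ord_eq_1[OF a(1)] by (metis power_0)
  then obtain r where m: "m = Suc r" by (cases m) auto
  let ?z = "a [^] (2 ^ r :: int)"
  have "\<not> (2::int) ^ m dvd 2 ^ r" using m zdvd_imp_le[of "2 ^ m" "2 ^ r :: int"] by auto
  then have "?z \<noteq> \<one>" using int_pow_eq_id[OF a(1)] ord by simp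
  moreover have "?z \<otimes> ?z = a [^] (2 ^ r + 2 ^ r :: int)" unfolding int_pow_mult[OF a(1)] ..
  moreover have "a [^] (2 ^ r + 2 ^ r :: int) = \<one>" unfolding int_pow_eq_id[OF a(1)] ord m by simp
  ultimately have "?z \<noteq> \<one>" "?z \<otimes> ?z = \<one>" by simp_all
  then show ?thesis using cycI[OF a(1)] by blast
qed

lemma square_of_translate:
  assumes a: "a \<in> carrier G" and x: "x \<in> carrier G" and k: "x \<otimes> a \<otimes> inv x = a [^] (k::int)"
    and j: "x \<otimes> x = a [^] (j::int)"
  shows "(a [^] (i::int) \<otimes> x) \<otimes> (a [^] i \<otimes> x) = a [^] (i * (k + 1) + j)"
proof -
  have "(a [^] i \<otimes> x) \<otimes> (a [^] i \<otimes> x) = a [^] i \<otimes> (x \<otimes> a [^] i \<otimes> inv x) \<otimes> (x \<otimes> x)"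
    using a x by (simp add: m_assoc inv_mult_cancel)
  also have "\<dots> = a [^] i \<otimes> a [^] (k * i) \<otimes> a [^] j"
    using a x k j by (simp add: conj_int_pow int_pow_pow)
  also have "\<dots> = a [^] (i + k * i + j)" using a by (simp add: int_pow_mult)
  finally show ?thesis by (simp add: algebra_simps)
qed

end

text \<open>\<open>uniq\<close> allows no involution at all, so the trivial group is included and
  comes out as cyclic.\<close>

locale unique_involution_2_group = group +
  fixes n :: nat
  assumes fin: "finite (carrier G)" and order: "order G = 2 ^ n"
    and uniq: "\<And>x y. x \<in> carrier G \<Longrightarrow> y \<in> carrier G \<Longrightarrow> x \<noteq> \<one> \<Longrightarrow> y \<noteq> \<one> \<Longrightarrow>
      x \<otimes> x = \<one> \<Longrightarrow> y \<otimes> y = \<one> \<Longrightarrow> x = y"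
begin

lemma ord_power_two: "a \<in> carrier G \<Longrightarrow> \<exists>m. ord a = 2 ^ m"
  using ord_dvd_group_order[of a] order divides_primepow_nat[OF two_is_prime_nat] by metis

lemma square_root_of_one_in_cyc:
  assumes a: "a \<in> carrier G" "a \<noteq> \<one>" and w: "w \<in> carrier G" "w \<otimes> w = \<one>"
  shows "w \<in> cyc a"
proof (cases "w = \<one>")
  case True
  then show ?thesis by (simp add: generate.one)
next
  case False
  obtain m where "ord a = 2 ^ m" using ord_power_two[OF a(1)] by blast
  then obtain z where z: "z \<in> cyc a" "z \<noteq> \<one>" "z \<otimes> z = \<one>" using involution_in_cyc[OF a] by blast
  have "z \<in> carrier G" using z(1) subgroup.subset[OF cyc_subgroup[OF a(1)]] by blast
  then show ?thesis using uniq[OF w(1)] False w(2) z by metis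
qed

text \<open>\<open>a [^] i \<otimes> x\<close> lies outside \<open>cyc a\<close>, whereas every
  element with square \<one> lies inside. The exponent is that of the square of this
  translate.\<close>

lemma translate_not_one:
  assumes a: "a \<in> carrier G" "a \<noteq> \<one>" and ord: "ord a = 2 ^ m" and x: "x \<in> carrier G" "x \<notin> cyc a"
    and k: "x \<otimes> a \<otimes> inv x = a [^] (k::int)" and j: "x \<otimes> x = a [^] (j::int)"
  shows "\<not> 2 ^ m dvd i * (k + 1) + j"
proof
  interpret A: subgroup "cyc a" G by (rule cyc_subgroup[OF a(1)])
  assume "2 ^ m dvd i * (k + 1) + j"
  then have "(a [^] i \<otimes> x) \<otimes> (a [^] i \<otimes> x) = \<one>"
    using square_of_translate[OF a(1) x(1) k j] int_pow_eq_id[OF a(1)] ord by simp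
  then have "a [^] i \<otimes> x \<in> cyc a" using square_root_of_one_in_cyc[OF a] a x by simp
  then have "inv (a [^] i) \<otimes> (a [^] i \<otimes> x) \<in> cyc a" using cycI[OF a(1), of i] by blast
  then show False using a x by (simp add: inv_mult_cancel)
qed

lemma centralizes_or_inverts:
  assumes a: "a \<in> carrier G" "a \<noteq> \<one>" and x: "x \<in> carrier G" "x \<notin> cyc a"
    and nx: "x \<otimes> a \<otimes> inv x \<in> cyc a" and xx: "x \<otimes> x \<in> cyc a"
  shows "x \<otimes> a \<otimes> inv x = a \<or> x \<otimes> a \<otimes> inv x = inv a"
proof -
  obtain m where ord: "ord a = 2 ^ m" using ord_power_two[OF a(1)] by blast
  obtain k :: int where k: "x \<otimes> a \<otimes> inv x = a [^] k" using cycE[OF a(1) nx] .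
  obtain j :: int where j: "x \<otimes> x = a [^] j" using cycE[OF a(1) xx] .
  have "x \<otimes> (x \<otimes> a \<otimes> inv x) \<otimes> inv x = a [^] (k * k)"
    using a x k by (simp add: conj_int_pow int_pow_pow)
  moreover have "x \<otimes> (x \<otimes> a \<otimes> inv x) \<otimes> inv x = (x \<otimes> x) \<otimes> a \<otimes> inv (x \<otimes> x)"
    using conj_conj[OF x(1) x(1) a(1)] .
  moreover have "(x \<otimes> x) \<otimes> a \<otimes> inv (x \<otimes> x) = a [^] (j + 1 - j)"
    unfolding j using a by (simp only: int_pow_diff int_pow_mult int_pow_1)
  ultimately have "a [^] (1::int) = a [^] (k * k)" using a by simp
  then have kk: "2 ^ m dvd k * k - 1" using int_pow_eq[OF a(1)] ord by simp
  have "x \<otimes> (x \<otimes> x) \<otimes> inv x = a [^] (k * j)" unfolding j using a x k by (simp add: conj_int_pow int_pow_pow)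
  moreover have "x \<otimes> (x \<otimes> x) \<otimes> inv x = a [^] j" unfolding j[symmetric] using x by (simp add: m_assoc)
  ultimately have "a [^] j = a [^] (k * j)" by simp
  then have "2 ^ m dvd k * j - j" using int_pow_eq[OF a(1)] ord by simp
  then have jk: "2 ^ m dvd j * (k - 1)" by (simp add: algebra_simps)
  have "2 ^ m dvd k - 1 \<or> 2 ^ m dvd k + 1"
    by (rule square_root_exponent_mod_power_two[OF kk jk translate_not_one[OF a ord x k j]])
  then show ?thesis
  proof
    assume "2 ^ m dvd k - 1"
    then have "a [^] (1::int) = a [^] k" using int_pow_eq[OF a(1)] ord by simp
    then show ?thesis using k a by simp
  next
    assume "2 ^ m dvd k + 1"
    then have "2 ^ m dvd k - (- 1)" by simp
    then have "a [^] (- 1 :: int) = a [^] k" using int_pow_eq[OF a(1), of "-1" k] ord by simp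
    then show ?thesis using k a by (simp add: int_pow_neg)
  qed
qed

text \<open>When \<open>x\<close> centralizes \<open>a\<close>, the translates of \<open>x\<close>
  have squares with exponents \<open>2 * i + j\<close>. None is \<one>, so \<open>j\<close> is odd;
  then \<open>x \<otimes> x\<close> generates \<open>cyc a\<close>, and \<open>a\<close> is a power
  of \<open>x\<close>.\<close>

lemma centralizing_root_generates:
  assumes a: "a \<in> carrier G" and x: "x \<in> carrier G" "x \<notin> cyc a"
    and cx: "x \<otimes> a \<otimes> inv x = a" and xx: "x \<otimes> x \<in> cyc a"
  shows "a \<in> cyc x"
proof (cases "a = \<one>")
  case True
  then show ?thesis by (simp add: generate.one)
next
  case False
  obtain m where ord: "ord a = 2 ^ m" using ord_power_two[OF a] by blast
  obtain j :: int where j: "x \<otimes> x = a [^] j" using cycE[OF a xx] .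
  have k: "x \<otimes> a \<otimes> inv x = a [^] (1::int)" using cx a by simp
  have "odd j"
  proof
    assume "even j"
    then obtain f where "j = 2 * f" by (elim evenE)
    then have "(- f) * (1 + 1) + j = 0" by simp
    then show False using translate_not_one[OF a False ord x k j, of "- f"] by simp
  qed
  then have "coprime j (2 ^ m)" by (simp add: coprime_power_right_iff coprime_right_2_iff_odd)
  then have "\<exists>u v. u * j + v * 2 ^ m = 1" using bezout_int[of j "2 ^ m"] by (simp add: coprime_iff_gcd_eq_1)
  then obtain u v where uv: "u * j + v * 2 ^ m = 1" by blast
  then have "j * u = 1 - v * 2 ^ m" by (simp add: mult.commute)
  then have "2 ^ m dvd j * u - 1" by simp
  then have "a [^] (1::int) = a [^] (j * u)" using int_pow_eq[OF a] ord by simp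
  then have "a = (x \<otimes> x) [^] u" using a j by (simp add: int_pow_pow)
  moreover have "x \<otimes> x = x [^] (2::int)" using int_pow_mult[OF x(1), of 1 1] x(1) by (simp add: int_pow_1)
  ultimately have "a = x [^] (2 * u)" using x by (simp add: int_pow_pow)
  then show ?thesis using cycI[OF x(1)] by simp
qed

definition normal_gen :: "'a \<Rightarrow> bool" where
  "normal_gen a \<longleftrightarrow> a \<in> carrier G \<and> (\<forall>x\<in>carrier G. x \<otimes> a \<otimes> inv x \<in> cyc a)"

lemma ex_maximal_normal_gen:
  "\<exists>a. normal_gen a \<and> (\<forall>b. normal_gen b \<longrightarrow> a \<in> cyc b \<longrightarrow> b \<in> cyc a)"
proof -
  let ?N = "{a \<in> carrier G. normal_gen a}"
  have "\<one> \<in> ?N" by (auto simp: normal_gen_def generate.one)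
  then obtain a where a: "a \<in> ?N" and max: "\<And>b. b \<in> ?N \<Longrightarrow> card (cyc b) \<le> card (cyc a)"
    using ex_max_nat[of ?N "\<lambda>a. card (cyc a)"] fin by auto
  have "b \<in> cyc a" if b: "normal_gen b" and ab: "a \<in> cyc b" for b
  proof -
    have bN: "b \<in> ?N" using b by (simp add: normal_gen_def)
    then have bc: "b \<in> carrier G" by simp
    have "finite (cyc b)" using subgroup.subset[OF cyc_subgroup[OF bc]] fin finite_subset by blast
    then have "cyc a = cyc b" using cyc_mono[OF bc ab] max[OF bN] by (rule card_seteq)
    then show ?thesis using cyc_self by simp
  qed
  then show ?thesis using a by blast
qed

text \<open>A maximal cyclic normal subgroup is its own centralizer: otherwise the 2-group \<open>G\<close>, acting by
  conjugation on the cosets of the subgroup in its centralizer, fixes a second coset, and that coset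
  leads to a larger cyclic normal subgroup.\<close>

lemma self_centralizing:
  assumes a: "normal_gen a" and max: "\<And>b. normal_gen b \<Longrightarrow> a \<in> cyc b \<Longrightarrow> b \<in> cyc a"
    and c: "c \<in> carrier G" "c \<otimes> a \<otimes> inv c = a"
  shows "c \<in> cyc a"
proof (rule ccontr)
  assume cA: "c \<notin> cyc a"
  have ac: "a \<in> carrier G" using a by (simp add: normal_gen_def)
  have aN: "x \<otimes> b \<otimes> inv x \<in> cyc a" if "x \<in> carrier G" "b \<in> cyc a" for x b
    using conj_cyc_closed[OF ac that(1) _ that(2)] a that(1) by (simp add: normal_gen_def)
  have A: "subgroup (cyc a) G" by (rule cyc_subgroup[OF ac])
  interpret A: subgroup "cyc a" G by (rule A)
  define Z where "Z = {z \<in> carrier G. z \<otimes> a \<otimes> inv z = a}"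
  have Zcomm: "z \<otimes> b = b \<otimes> z" if zb: "z \<in> Z" "b \<in> cyc a" for z b
  proof -
    obtain i :: int where i: "b = a [^] i" using cycE[OF ac zb(2)] .
    have z: "z \<in> carrier G" "z \<otimes> a \<otimes> inv z = a" using zb(1) by (auto simp: Z_def)
    have "z \<otimes> b \<otimes> inv z = b" using conj_int_pow[OF z(1) ac] z i by simp
    then show ?thesis using z(1) zb(2) by (metis A.mem_carrier inv_solve_right m_closed)
  qed
  have AZ: "cyc a \<subseteq> Z"
  proof
    fix b assume b: "b \<in> cyc a"
    obtain i :: int where i: "b = a [^] i" using cycE[OF ac b] .
    have "b \<otimes> a = a [^] (i + 1)" unfolding i int_pow_mult[OF ac] using ac by simp
    also have "\<dots> = a [^] (1 + i)" by (simp add: add.commute)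
    also have "\<dots> = a \<otimes> b" unfolding i int_pow_mult[OF ac] using ac by simp
    finally show "b \<in> Z" using b ac by (simp add: Z_def m_assoc)
  qed
  have Z: "subgroup Z G"
  proof (rule subgroupI)
    show "Z \<subseteq> carrier G" by (auto simp: Z_def)
    show "Z \<noteq> {}" using AZ cyc_self by blast
    fix z assume z: "z \<in> Z"
    then have zc: "z \<in> carrier G" "z \<otimes> a \<otimes> inv z = a" by (auto simp: Z_def)
    have "inv z \<otimes> a \<otimes> inv (inv z) = inv z \<otimes> (z \<otimes> a \<otimes> inv z) \<otimes> inv (inv z)" using zc by simp
    also have "\<dots> = a" using zc(1) ac by (simp add: m_assoc inv_mult_cancel)
    finally show "inv z \<in> Z" using zc by (simp add: Z_def)
    fix y assume y: "y \<in> Z"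
    then have yc: "y \<in> carrier G" "y \<otimes> a \<otimes> inv y = a" by (auto simp: Z_def)
    show "z \<otimes> y \<in> Z" using conj_conj[OF zc(1) yc(1) ac] zc yc by (simp add: Z_def)
  qed
  have Z_iff: "z \<in> Z \<longleftrightarrow> z \<in> carrier G \<and> z \<otimes> a \<otimes> inv z = a" for z by (simp add: Z_def)
  interpret Z: subgroup Z G by (rule Z)
  have ZN: "x \<otimes> z \<otimes> inv x \<in> Z" if x: "x \<in> carrier G" and z: "z \<in> Z" for x z
  proof -
    have zc: "z \<in> carrier G" using z by (rule Z.mem_carrier)
    have b: "inv x \<otimes> a \<otimes> x \<in> cyc a" using aN[of "inv x" a] x cyc_self by simp
    have bc: "inv x \<otimes> a \<otimes> x \<in> carrier G" using b by simp
    have "(x \<otimes> z \<otimes> inv x) \<otimes> a \<otimes> inv (x \<otimes> z \<otimes> inv x) = x \<otimes> (z \<otimes> (inv x \<otimes> a \<otimes> x) \<otimes> inv z) \<otimes> inv x"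
      using x zc ac by (simp add: m_assoc inv_mult_group)
    also have "z \<otimes> (inv x \<otimes> a \<otimes> x) \<otimes> inv z = inv x \<otimes> a \<otimes> x"
      unfolding Zcomm[OF z b] using bc zc by (simp add: m_assoc)
    also have "x \<otimes> (inv x \<otimes> a \<otimes> x) \<otimes> inv x = a" using x ac by (simp add: m_assoc inv_mult_cancel)
    finally have e: "(x \<otimes> z \<otimes> inv x) \<otimes> a \<otimes> inv (x \<otimes> z \<otimes> inv x) = a" .
    have "x \<otimes> z \<otimes> inv x \<in> carrier G" using x zc by blast
    then show ?thesis using e unfolding Z_iff by blast
  qed
  have cZ: "c \<in> Z" using c unfolding Z_iff by blast
  let ?A = "cyc a"
  define E where "E = {?A #> z | z. z \<in> Z}"
  interpret GZ: group "G\<lparr>carrier := Z\<rparr>" using Z by (rule subgroup_imp_group)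
  have E: "E = rcosets\<^bsub>G\<lparr>carrier := Z\<rparr>\<^esub> ?A" by (auto simp: E_def RCOSETS_def)
  have "card E * card ?A = card Z"
    using GZ.lagrange[OF subgroup_incl[OF A Z AZ]] unfolding E by (simp add: order_def)
  moreover have "card Z dvd 2 ^ n" using card_subgroup_dvd[OF Z subgroup_self Z.subset] order by (simp add: order_def)
  ultimately have "card E dvd 2 ^ n" by (metis dvd_mult_left)
  then obtain e where e: "card E = 2 ^ e" using divides_primepow_nat[OF two_is_prime_nat] by blast
  have finE: "finite E" unfolding E_def using fin Z.subset finite_subset[of Z] by simp
  have A1: "?A = ?A #> \<one>" using A.subset by simp
  have AE: "?A \<in> E" using A1 Z.one_closed unfolding E_def by blast
  have cE: "?A #> c \<in> E" using cZ by (auto simp: E_def)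
  have "?A #> c \<noteq> ?A" using cA rcos_self[OF c(1) A] by metis
  then have "card E \<noteq> 1" using AE cE by (metis card_1_singletonE singletonD)
  then have "e \<noteq> 0" using e by (metis power_0)
  then have evE: "even (card E)" using e by simp
  have conjA: "conj_set x (?A #> z) = ?A #> (x \<otimes> z \<otimes> inv x)" if x: "x \<in> carrier G" and z: "z \<in> Z" for x z
  proof
    have zc: "z \<in> carrier G" using z by (rule Z.mem_carrier)
    have e: "x \<otimes> (b \<otimes> z) \<otimes> inv x = (x \<otimes> b \<otimes> inv x) \<otimes> (x \<otimes> z \<otimes> inv x)" if "b \<in> carrier G" for b
      using that x zc by (simp add: m_assoc inv_mult_cancel)
    show "conj_set x (?A #> z) \<subseteq> ?A #> (x \<otimes> z \<otimes> inv x)"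
    proof
      fix y assume "y \<in> conj_set x (?A #> z)"
      then obtain b where b: "b \<in> ?A" "y = x \<otimes> (b \<otimes> z) \<otimes> inv x" by (auto simp: conj_set_def r_coset_def)
      then have "y = (x \<otimes> b \<otimes> inv x) \<otimes> (x \<otimes> z \<otimes> inv x)" using e by simp
      then show "y \<in> ?A #> (x \<otimes> z \<otimes> inv x)" using aN[OF x b(1)] unfolding r_coset_def by blast
    qed
    show "?A #> (x \<otimes> z \<otimes> inv x) \<subseteq> conj_set x (?A #> z)"
    proof
      fix y assume "y \<in> ?A #> (x \<otimes> z \<otimes> inv x)"
      then obtain b where b: "b \<in> ?A" "y = b \<otimes> (x \<otimes> z \<otimes> inv x)" by (auto simp: r_coset_def)
      have b': "inv x \<otimes> b \<otimes> x \<in> ?A" using aN[of "inv x" b] x b(1) by simp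
      have "y = x \<otimes> ((inv x \<otimes> b \<otimes> x) \<otimes> z) \<otimes> inv x" using b x zc by (simp add: m_assoc inv_mult_cancel)
      moreover have "(inv x \<otimes> b \<otimes> x) \<otimes> z \<in> ?A #> z" using b' unfolding r_coset_def by blast
      ultimately show "y \<in> conj_set x (?A #> z)" unfolding conj_set_def by blast
    qed
  qed
  let ?Fix = "{S \<in> E. \<forall>g\<in>carrier G. conj_set g S = S}"
  have EG: "S \<subseteq> carrier G" if S: "S \<in> E" for S
  proof -
    obtain z where "z \<in> Z" "S = ?A #> z" using S by (auto simp: E_def)
    then show ?thesis using r_coset_subset_G[OF A.subset] by simp
  qed
  have d2: "2 dvd card (E - ?Fix)"
  proof (rule p_subgroup_moved_points[OF subgroup_self _ two_is_prime_nat finE])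
    show "card (carrier G) = 2 ^ n" using order by (simp add: order_def)
    show "conj_set g S \<in> E" if g: "g \<in> carrier G" and S: "S \<in> E" for g S
    proof -
      obtain z where z: "z \<in> Z" "S = ?A #> z" using S by (auto simp: E_def)
      then show ?thesis using conjA[OF g z(1)] ZN[OF g z(1)] by (auto simp: E_def)
    qed
    show "conj_set \<one> S = S" if "S \<in> E" for S using conj_set_one[OF EG[OF that]] .
    show "conj_set (g \<otimes> h) S = conj_set g (conj_set h S)" if "g \<in> carrier G" "h \<in> carrier G" "S \<in> E" for g h S
      using conj_set_mult[OF that(1,2) EG[OF that(3)]] by simp
  qed
  have "card (E - ?Fix) = card E - card ?Fix" by (rule card_Diff_subset) (use finE in auto)
  moreover have "card ?Fix \<le> card E" by (rule card_mono) (use finE in auto)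
  ultimately have "card E = card ?Fix + card (E - ?Fix)" by linarith
  then have "even (card ?Fix + card (E - ?Fix))" using evE by simp
  then have evF: "even (card ?Fix)" using d2 by (simp only: even_add)
  have "conj_set g ?A = ?A" if g: "g \<in> carrier G" for g
    using conjA[OF g Z.one_closed] g A.subset by simp
  then have AF: "?A \<in> ?Fix" using AE by simp
  have "?Fix \<noteq> {?A}" using evF by (metis One_nat_def card_1_singleton_iff odd_one)
  then obtain S where S: "S \<in> ?Fix" "S \<noteq> ?A" using AF by blast
  then obtain d where d: "d \<in> Z" "S = ?A #> d" by (auto simp: E_def)
  have dc: "d \<in> carrier G" using d(1) by simp
  have dA: "d \<notin> ?A" using S(2) d(2) by (metis A.rcos_const is_group)
  have dx: "\<exists>b\<in>?A. x \<otimes> d \<otimes> inv x = b \<otimes> d" if x: "x \<in> carrier G" for x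
  proof -
    have "?A #> (x \<otimes> d \<otimes> inv x) = ?A #> d" using S(1) d conjA[OF x d(1)] x by simp
    then have "x \<otimes> d \<otimes> inv x \<in> ?A #> d" using rcos_self[of "x \<otimes> d \<otimes> inv x", OF _ A] x dc by simp
    then show ?thesis by (auto simp: r_coset_def)
  qed
  have "d [^] order G \<in> ?A" using pow_order_eq_1[OF dc] A.one_closed by simp
  then obtain k q :: nat where kq: "Factorial_Ring.prime q" "q dvd order G" "d [^] k \<notin> ?A" "(d [^] k) [^] q \<in> ?A"
    using power_step[OF A dc dA, of "order G"] order by auto
  have "q = 2" using kq(1,2) order by (metis prime_dvd_power primes_dvd_imp_eq two_is_prime_nat)
  \<comment> \<open>A power of \<open>d\<close> outside \<open>?A\<close> whose square lies in it.
    It still centralizes \<open>a\<close>, so \<open>a\<close> is a power of \<open>y\<close>, and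
    \<open>cyc y\<close> is the larger cyclic group.\<close>
  define y where "y = d [^] k"
  have yc: "y \<in> carrier G" using dc by (simp add: y_def)
  have yA: "y \<notin> ?A" "y \<otimes> y \<in> ?A" using kq \<open>q = 2\<close> yc by (auto simp: y_def numeral_2_eq_2)
  have "y \<in> Z" unfolding y_def using subgroup_pow_closed[OF Z d(1)] .
  then have "y \<otimes> a \<otimes> inv y = a" unfolding Z_iff by blast
  then have ay: "a \<in> cyc y" using centralizing_root_generates[OF ac yc yA(1) _ yA(2)] by blast
  have Ay: "?A \<subseteq> cyc y" by (rule cyc_mono[OF yc ay])
  have "normal_gen y"
    unfolding normal_gen_def
  proof (intro conjI ballI)
    fix x assume x: "x \<in> carrier G"
    obtain b where b: "b \<in> ?A" "x \<otimes> d \<otimes> inv x = b \<otimes> d" using dx[OF x] by blast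
    \<comment> \<open>As the coset of \<open>d\<close> is fixed, conjugation by \<open>x\<close>
      only multiplies \<open>d\<close> by some \<open>b\<close> in \<open>?A\<close>. This
      \<open>b\<close> commutes with \<open>d\<close>, so \<open>y\<close> is multiplied by
      \<open>b [^] k\<close>, an element of \<open>cyc y\<close>.\<close>
    have "x \<otimes> y \<otimes> inv x = (b \<otimes> d) [^] k" unfolding y_def conj_pow[OF x dc] b(2) ..
    also have "\<dots> = b [^] k \<otimes> y" unfolding y_def
      by (rule pow_mult_distrib) (use Zcomm[OF d(1) b(1)] b(1) dc in auto)
    finally have "x \<otimes> y \<otimes> inv x = b [^] k \<otimes> y" .
    moreover have "b [^] k \<in> cyc y" using subgroup_pow_closed[OF A b(1)] Ay by blast
    ultimately show "x \<otimes> y \<otimes> inv x \<in> cyc y"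
      using subgroup.m_closed[OF cyc_subgroup[OF yc]] cyc_self by metis
  qed (rule yc)
  then show False using max ay yA(1) by blast
qed

text \<open>A maximal cyclic normal subgroup is its own centralizer, so it is enough that every
  element outside it inverts \<open>a\<close>: a quotient of two such elements centralizes
  \<open>a\<close>, which bounds the index by 2.\<close>

theorem cyclic_or_generalized_quaternion:
  "cyclic_2_group G \<or> generalized_quaternion_group G"
proof -
  obtain a where a: "normal_gen a" and max: "\<And>b. normal_gen b \<Longrightarrow> a \<in> cyc b \<Longrightarrow> b \<in> cyc a"
    using ex_maximal_normal_gen by blast
  have cent: "c \<in> cyc a" if "c \<in> carrier G" "c \<otimes> a \<otimes> inv c = a" for c
    by (rule self_centralizing[OF a max that])
  have ac: "a \<in> carrier G" and aN: "\<And>x. x \<in> carrier G \<Longrightarrow> x \<otimes> a \<otimes> inv x \<in> cyc a"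
    using a by (auto simp: normal_gen_def)
  have A: "subgroup (cyc a) G" by (rule cyc_subgroup[OF ac])
  interpret A: subgroup "cyc a" G by (rule A)
  show ?thesis
  proof (cases "carrier G \<subseteq> cyc a")
    case True
    then have "carrier G = cyc a" using A.subset by blast
    also have "cyc a = range (\<lambda>k::int. a [^] k)" unfolding cyc_eq[OF ac] by blast
    finally have "carrier G = range (\<lambda>k::int. a [^] k)" .
    then have "cyclic_group G" using cyclic_group ac by blast
    then show ?thesis using order is_group by (auto simp: cyclic_2_group_def)
  next
    case False
    then obtain x where x: "x \<in> carrier G" "x \<notin> cyc a" by blast
    have a1: "a \<noteq> \<one>"
    proof
      assume "a = \<one>"
      then show False using cent[OF x(1)] x by simp
    qed
    obtain m where ord: "ord a = 2 ^ m" using ord_power_two[OF ac] by blast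
    have inverts': "y \<otimes> a \<otimes> inv y = inv a" if "y \<in> carrier G" "y \<notin> cyc a" "y \<otimes> y \<in> cyc a" for y
      using centralizes_or_inverts[OF ac a1 that(1,2) aN[OF that(1)] that(3)] cent[OF that(1)] that(2) by blast
    \<comment> \<open>For \<open>ord a\<close> at most 2, inverting \<open>a\<close> would be the
      same as centralizing it.\<close>
    have no_order_two: "2 \<le> m" if y: "y \<in> carrier G" "y \<notin> cyc a" "y \<otimes> y \<in> cyc a" for y
    proof (rule ccontr)
      assume "\<not> 2 \<le> m"
      then have "2 ^ m dvd (2::int)" by (cases m) auto
      then have "a [^] (- 1 :: int) = a [^] (1 :: int)" using int_pow_eq[OF ac, of "-1" 1] ord by simp
      then have "inv a = a" using ac by (simp add: int_pow_neg)
      then show False using inverts'[OF y] cent[OF y(1)] y(2) by simp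
    qed
    \<comment> \<open>Otherwise some \<open>v\<close> has its square \<open>w\<close> outside
      \<open>cyc a\<close> and its fourth power inside. Then \<open>w\<close> inverts
      \<open>a\<close>, so the exponent \<open>l\<close> by which \<open>v\<close> acts satisfies
      \<open>l * l = -1\<close> modulo \<open>2 ^ m\<close>, impossible already modulo 4.\<close>
    have squares: "y \<otimes> y \<in> cyc a" if y: "y \<in> carrier G" for y
    proof (rule ccontr)
      assume yy: "y \<otimes> y \<notin> cyc a"
      have yyc: "y \<otimes> y \<in> carrier G" using y by simp
      have "(y \<otimes> y) [^] order G \<in> cyc a" using pow_order_eq_1[OF yyc] A.one_closed by simp
      then obtain k q :: nat where kq: "Factorial_Ring.prime q" "q dvd order G" "(y \<otimes> y) [^] k \<notin> cyc a" "((y \<otimes> y) [^] k) [^] q \<in> cyc a"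
        using power_step[OF A yyc yy, of "order G"] order by auto
      have "q = 2" using kq(1,2) order by (metis prime_dvd_power primes_dvd_imp_eq two_is_prime_nat)
      define v where "v = y [^] k"
      define w where "w = (y \<otimes> y) [^] k"
      have v: "v \<in> carrier G" using y by (simp add: v_def)
      have wv: "w = v \<otimes> v" unfolding w_def v_def using pow_mult_distrib[of y y k] y by simp
      have w: "w \<in> carrier G" "w \<notin> cyc a" "w \<otimes> w \<in> cyc a"
        using kq(3,4) \<open>q = 2\<close> yyc by (auto simp: w_def numeral_2_eq_2)
      obtain l :: int where l: "v \<otimes> a \<otimes> inv v = a [^] l" using cycE[OF ac aN[OF v]] .
      have "v \<otimes> (v \<otimes> a \<otimes> inv v) \<otimes> inv v = a [^] (l * l)"
        using ac v l by (simp add: conj_int_pow int_pow_pow)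
      then have "a [^] (l * l) = inv a" using conj_conj[OF v v ac] inverts'[OF w] wv by simp
      then have "a [^] (- 1 :: int) = a [^] (l * l)" using ac by (simp add: int_pow_neg)
      then have "2 ^ m dvd l * l + 1" using int_pow_eq[OF ac] ord by simp
      moreover have "(2::int) ^ 2 dvd 2 ^ m" using no_order_two[OF w] by (rule le_imp_power_dvd)
      ultimately have "2 ^ 2 dvd l * l + 1" by (metis dvd_trans)
      then have "4 dvd l * l + 1" by simp
      then show False using not_four_dvd_square_plus_one by blast
    qed
    note inverts = inverts'[OF _ _ squares]
    have m2: "2 \<le> m" by (rule no_order_two[OF x squares[OF x(1)]])
    have xx: "x \<otimes> x \<in> cyc a" by (rule squares[OF x(1)])
    have cA: "conj_set x (cyc a) = cyc a"
      by (rule conj_set_fixI) (use fin finite_subset[OF A.subset fin] A.subset x(1) conj_cyc_closed[OF ac x(1) aN[OF x(1)]] in auto)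
    have x2: "x [^] (2::nat) \<in> cyc a" using xx x(1) by (simp add: numeral_2_eq_2)
    note X = extend_props[OF fin A x cA two_is_prime_nat x2]
    have coset: "\<exists>b\<in>cyc a. y = b \<otimes> x" if y: "y \<in> carrier G" "y \<notin> cyc a" for y
    proof -
      have "(y \<otimes> inv x) \<otimes> a \<otimes> inv (y \<otimes> inv x) = y \<otimes> (inv x \<otimes> a \<otimes> inv (inv x)) \<otimes> inv y"
        using conj_conj[OF y(1) inv_closed[OF x(1)] ac] by simp
      also have "inv x \<otimes> a \<otimes> inv (inv x) = inv a"
      proof (rule inverts)
        show "inv x \<notin> cyc a" using x A.m_inv_closed by fastforce
      qed (use x in auto)
      also have "y \<otimes> inv a \<otimes> inv y = inv (y \<otimes> a \<otimes> inv y)" using y ac by (simp add: inv_mult_group m_assoc)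
      also have "\<dots> = a" using inverts[OF y] ac y by simp
      finally have "y \<otimes> inv x \<in> cyc a" using cent[of "y \<otimes> inv x"] x y by simp
      moreover have "y = (y \<otimes> inv x) \<otimes> x" using x y by (simp add: m_assoc)
      ultimately show ?thesis by blast
    qed
    have "carrier G \<subseteq> extend (cyc a) x"
    proof
      fix y assume y: "y \<in> carrier G"
      show "y \<in> extend (cyc a) x"
      proof (cases "y \<in> cyc a")
        case True then show ?thesis using X(2) by blast
      next
        case False
        then obtain b where "b \<in> cyc a" "y = b \<otimes> x" using coset[OF y] by blast
        then show ?thesis using X(2,3) subgroup.m_closed[OF X(1)] by blast
      qed
    qed
    then have "carrier G = extend (cyc a) x" using subgroup.subset[OF X(1)] by blast
    then have oG: "order G = 2 ^ Suc m" using X(4) generate_pow_card[OF ac] ord by (simp add: order_def)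
    have gen: "generate G {a, x} = carrier G"
    proof
      show "generate G {a, x} \<subseteq> carrier G" using generate_incl[of "{a, x}"] ac x by simp
      have sub: "subgroup (generate G {a, x}) G" using generate_is_subgroup[of "{a, x}"] ac x by simp
      have "cyc a \<subseteq> generate G {a, x}" by (rule mono_generate) simp
      moreover have "x \<in> generate G {a, x}" by (simp add: generate.incl)
      ultimately show "carrier G \<subseteq> generate G {a, x}" using coset subgroup.m_closed[OF sub] by blast
    qed
    obtain j :: int where j: "x \<otimes> x = a [^] j" using cycE[OF ac xx] .
    have k: "x \<otimes> a \<otimes> inv x = a [^] (- 1 :: int)" using inverts[OF x(1,2)] x ac by (simp add: int_pow_neg)
    have "\<not> 2 ^ m dvd 0 * (- 1 + 1) + j" by (rule translate_not_one[OF ac a1 ord x k j])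
    then have nj: "\<not> 2 ^ m dvd j" by simp
    \<comment> \<open>\<open>x\<close> both fixes and inverts its own square, so
      \<open>2 * j\<close> vanishes modulo \<open>2 ^ m\<close>. As \<open>j\<close> itself does
      not, it equals 2^(m-1) there, which is the quaternion relation with n = m + 1.\<close>
    have "x \<otimes> (x \<otimes> x) \<otimes> inv x = a [^] (- j)" unfolding j using ac x k by (simp add: conj_int_pow int_pow_pow)
    moreover have "x \<otimes> (x \<otimes> x) \<otimes> inv x = a [^] j" unfolding j[symmetric] using x by (simp add: m_assoc)
    ultimately have "a [^] (- j) = a [^] j" by simp
    then have dj: "2 ^ m dvd j + j" using int_pow_eq[OF ac, of "- j" j] ord by simp
    obtain r where m: "m = Suc r" using m2 by (cases m) auto
    have "2 * 2 ^ r dvd 2 * j" using dj m by simp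
    then have "2 ^ r dvd j" by simp
    then obtain f where f: "j = 2 ^ r * f" by (elim dvdE)
    have "odd f" using nj f m by (auto elim!: evenE)
    then have "2 dvd f - 1" by simp
    then have "2 ^ r * 2 dvd 2 ^ r * (f - 1)" by (intro mult_dvd_mono) auto
    moreover have "2 ^ r * (f - 1) = j - 2 ^ r" "2 ^ r * 2 = (2::int) ^ m" unfolding f m by (simp_all add: right_diff_distrib)
    ultimately have "2 ^ m dvd j - 2 ^ r" by metis
    then have "a [^] (2 ^ r :: int) = a [^] j" using int_pow_eq[OF ac] ord by simp
    then have b2: "x \<otimes> x = a [^] (2 ^ r :: nat)" unfolding j using int_pow_int[of G a "2 ^ r"] by simp
    have "inv x \<otimes> a \<otimes> x = inv a"
    proof -
      have "inv x \<otimes> a \<otimes> inv (inv x) = inv a"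
      proof (rule inverts)
        show "inv x \<notin> cyc a" using x A.m_inv_closed by fastforce
      qed (use x in auto)
      then show ?thesis using x by simp
    qed
    moreover have "a [^] ((2::nat) ^ (Suc m - 1)) = \<one>" using pow_ord_eq_1[OF ac] ord by simp
    moreover have "x [^] (2::nat) = a [^] ((2::nat) ^ (Suc m - 2))"
      using b2 x(1) m by (simp add: numeral_2_eq_2)
    moreover have "Suc m \<ge> 3" using m2 by simp
    ultimately have "generalized_quaternion_group G"
      unfolding generalized_quaternion_group_def using is_group oG gen ac x(1) by blast
    then show ?thesis by blast
  qed
qed

end

section \<open>Uniqueness of the involution in cyclic and generalized quaternion 2-groups\<close>

context group
begin

text \<open>In the quaternion case the relations only bound \<open>ord a\<close> from above. The
  order of the group forces \<open>b\<close> outside \<open>cyc a\<close>, and then index 2 gives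
  \<open>ord a\<close> exactly. Elements outside \<open>cyc a\<close> all have the same square as
  \<open>b\<close>, which is not \<one>, so involutions lie in a cyclic group.\<close>

lemma cyclic_or_generalized_quaternion_unique_involution:
  assumes fin: "finite (carrier G)" and G: "cyclic_2_group G \<or> generalized_quaternion_group G"
    and x: "x \<in> carrier G" "x \<noteq> \<one>" "x \<otimes> x = \<one>" and y: "y \<in> carrier G" "y \<noteq> \<one>" "y \<otimes> y = \<one>"
  shows "x = y"
  using G
proof
  assume "cyclic_2_group G"
  then obtain a m where a: "a \<in> carrier G" "carrier G = range (\<lambda>k::int. a [^] k)" "order G = 2 ^ m"
    unfolding cyclic_2_group_def cyclic_group by blast
  have ca: "carrier G = cyc a" unfolding a(2) cyc_eq[OF a(1)] by blast
  then have "ord a = 2 ^ m" using generate_pow_card[OF a(1)] a(3) by (simp add: order_def)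
  then show ?thesis using involution_in_cyc_unique[OF a(1)] x y ca by blast
next
  assume "generalized_quaternion_group G"
  then obtain n a b where n: "n \<ge> 3" "order G = 2 ^ n" and a: "a \<in> carrier G" and b: "b \<in> carrier G"
    and gen: "generate G {a, b} = carrier G" and a1: "a [^] ((2::nat) ^ (n - 1)) = \<one>"
    and b2: "b [^] (2::nat) = a [^] ((2::nat) ^ (n - 2))" and conj: "inv b \<otimes> a \<otimes> b = inv a"
    unfolding generalized_quaternion_group_def by blast
  have A: "subgroup (cyc a) G" by (rule cyc_subgroup[OF a])
  interpret A: subgroup "cyc a" G by (rule A)
  have bab: "b \<otimes> a \<otimes> inv b = inv a"
  proof -
    have "b \<otimes> inv (inv b \<otimes> a \<otimes> b) \<otimes> inv b = inv a" using a b by (simp add: inv_mult_group m_assoc inv_mult_cancel)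
    then show ?thesis using conj a by simp
  qed
  have n1: "2 ^ n = 2 * (2::nat) ^ (n - 1)" using n(1) by (metis Suc_diff_1 less_le_trans power_Suc zero_less_numeral)
  have od: "ord a dvd 2 ^ (n - 1)" using pow_eq_id[OF a] a1 by simp
  have cA: "card (cyc a) = ord a" using generate_pow_card[OF a] by simp
  have bA: "b \<notin> cyc a"
  proof
    assume "b \<in> cyc a"
    then have "generate G {a, b} \<subseteq> cyc a" using generate_subgroup_incl[OF _ A] cyc_self by simp
    then have "carrier G = cyc a" using gen A.subset by simp
    then have "2 ^ n \<le> (2::nat) ^ (n - 1)" using n(2) cA od dvd_imp_le by (simp add: order_def)
    then show False using n1 by simp
  qed
  have finA: "finite (cyc a)" using finite_subset[OF A.subset fin] .
  have conjA: "conj_set b (cyc a) = cyc a"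
    by (rule conj_set_fixI[OF finA A.subset b conj_cyc_closed[OF a b]]) (use bab cyc_self[of a] in auto)
  have b2A: "b [^] (2::nat) \<in> cyc a" unfolding b2 using subgroup_pow_closed[OF A cyc_self] .
  note X = extend_props[OF fin A b bA conjA two_is_prime_nat b2A]
  have "generate G {a, b} \<subseteq> extend (cyc a) b"
  proof (rule generate_subgroup_incl[OF _ X(1)])
    show "{a, b} \<subseteq> extend (cyc a) b" using X(3) subsetD[OF X(2) cyc_self[of a]] by simp
  qed
  then have cG: "carrier G = extend (cyc a) b" using gen subgroup.subset[OF X(1)] by blast
  then have "2 ^ n = 2 * ord a" using X(4) cA n(2) by (simp add: order_def)
  then have ord: "ord a = 2 ^ (n - 1)" using n1 by simp
  have bb: "b \<otimes> b = a [^] ((2::nat) ^ (n - 2))" using b2 b by (simp add: numeral_2_eq_2)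
  have "\<not> (2::nat) ^ (n - 1) dvd 2 ^ (n - 2)"
  proof
    assume "(2::nat) ^ (n - 1) dvd 2 ^ (n - 2)"
    then have "(2::nat) ^ (n - 1) \<le> 2 ^ (n - 2)" by (simp add: dvd_imp_le)
    then have "n - 1 \<le> n - 2" by simp
    then show False using n(1) by simp
  qed
  then have bb1: "b \<otimes> b \<noteq> \<one>" unfolding bb pow_eq_id[OF a] ord .
  have inA: "w \<in> cyc a" if w: "w \<in> carrier G" "w \<otimes> w = \<one>" for w
  proof (rule ccontr)
    assume wA: "w \<notin> cyc a"
    have bbA: "b \<otimes> b \<in> cyc a" using b2A b by (simp add: numeral_2_eq_2)
    obtain c where c: "c \<in> cyc a" "w = c \<otimes> b" using extend_two[OF A b bbA, of w] w wA cG by blast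
    obtain i :: int where i: "c = a [^] i" using cycE[OF a c(1)] .
    have "b \<otimes> c \<otimes> inv b = inv c" unfolding i conj_int_pow[OF b a] bab using int_pow_inv[OF a] .
    moreover have "w \<otimes> w = c \<otimes> (b \<otimes> c \<otimes> inv b) \<otimes> (b \<otimes> b)"
      unfolding c(2) using c(1) b by (simp add: m_assoc inv_mult_cancel)
    ultimately have "w \<otimes> w = b \<otimes> b" using c(1) b by simp
    then show False using w bb1 by simp
  qed
  show ?thesis by (rule involution_in_cyc_unique[OF a ord inA x(2,3) inA y(2,3)]) (use x y in auto)
qed

end

section \<open>Classes of perfect codes and of Hall subgroups\<close>

lemma squarefree_odd_part_iff:
  assumes "n > 0"
  shows "squarefree (odd_part n) \<longleftrightarrow> (\<forall>p. Factorial_Ring.prime p \<longrightarrow> odd p \<longrightarrow> \<not> p\<^sup>2 dvd n)"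
proof -
  define m where "m = multiplicity 2 n"
  obtain r where r: "n = 2 ^ m * r" "odd r"
    unfolding m_def using multiplicity_decompose'[of n 2] assms by auto
  have "odd_part n = n div 2 ^ m" by (simp add: odd_part_def m_def)
  also have "\<dots> = (2 ^ m * r) div 2 ^ m" by (rule arg_cong[OF r(1)])
  finally have o: "odd_part n = r" by simp
  have "r \<noteq> 0" using r(2) by (metis dvd_0_right)
  have d: "p\<^sup>2 dvd n \<longleftrightarrow> p\<^sup>2 dvd r" if "Factorial_Ring.prime p" "odd p" for p
  proof -
    have "coprime (p\<^sup>2) (2 ^ m)" using that by (simp add: coprime_right_2_iff_odd)
    then show ?thesis unfolding r(1) by (simp add: coprime_dvd_mult_right_iff)
  qed
  have e: "\<not> p\<^sup>2 dvd r" if "Factorial_Ring.prime p" "even p" for p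
  proof
    assume "p\<^sup>2 dvd r"
    then have "2 dvd r" using that(2) by (metis dvd_trans dvd_triv_left power2_eq_square)
    then show False using r(2) by simp
  qed
  show ?thesis unfolding o squarefree_factorial_semiring[OF \<open>r \<noteq> 0\<close>] using d e by blast
qed

context group
begin

lemma order_two_subgroup:
  assumes u: "u \<in> carrier G" "u \<otimes> u = \<one>"
  shows "subgroup {\<one>, u} G"
proof (rule subgroupI)
  fix a assume "a \<in> {\<one>, u}"
  then show "inv a \<in> {\<one>, u}" using inv_equality[OF u(2) u(1) u(1)] by auto
qed (use u in auto)

text \<open>From here on the condition on Sylow 2-subgroups enters only through the number of
  involutions.\<close>

lemma two_subgroup_cyclic_or_quaternion_iff:
  assumes fin: "finite (carrier G)" and P: "subgroup P G" "card P = 2 ^ n"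
  shows "cyclic_2_group (G\<lparr>carrier := P\<rparr>) \<or> generalized_quaternion_group (G\<lparr>carrier := P\<rparr>) \<longleftrightarrow>
    (\<forall>x\<in>P. \<forall>y\<in>P. x \<noteq> \<one> \<longrightarrow> y \<noteq> \<one> \<longrightarrow> x \<otimes> x = \<one> \<longrightarrow> y \<otimes> y = \<one> \<longrightarrow> x = y)"
    (is "?c \<longleftrightarrow> ?u")
proof -
  interpret GP: group "G\<lparr>carrier := P\<rparr>" using P(1) by (rule subgroup_imp_group)
  have finP: "finite P" using fin subgroup.subset[OF P(1)] finite_subset by blast
  show ?thesis
  proof
    assume c: ?c
    show ?u
    proof (intro ballI impI)
      fix x y assume "x \<in> P" "y \<in> P" "x \<noteq> \<one>" "y \<noteq> \<one>" "x \<otimes> x = \<one>" "y \<otimes> y = \<one>"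
      then show "x = y"
        using GP.cyclic_or_generalized_quaternion_unique_involution[OF _ c, of x y] finP by simp
    qed
  next
    assume u: ?u
    interpret unique_involution_2_group "G\<lparr>carrier := P\<rparr>" n
    proof (intro unique_involution_2_group.intro unique_involution_2_group_axioms.intro GP.is_group)
      show "finite (carrier (G\<lparr>carrier := P\<rparr>))" using finP by simp
      show "order (G\<lparr>carrier := P\<rparr>) = 2 ^ n" using P(2) by (simp add: order_def)
    qed (use u in simp)
    show ?c by (rule cyclic_or_generalized_quaternion)
  qed
qed

lemma finite_subgroupI: "finite (carrier G) \<Longrightarrow> subgroup H G \<Longrightarrow> finite_subgroup G H"
  by (simp add: finite_subgroup_def finite_subgroup_axioms_def is_group)

lemma order_eq_card_mult_index: "subgroup H G \<Longrightarrow> order G = card H * (order G div card H)"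
  using card_subgroup_dvd[of H "carrier G"] subgroup.subset[of H G] subgroup_self by (simp add: order_def)

lemma conjugacy_class_eq: "conjugacy_class G H = {conj_set g H | g. g \<in> carrier G}"
  by (simp add: conjugacy_class_def conj_set_eq)

lemma self_in_conjugacy_class: "H \<subseteq> carrier G \<Longrightarrow> H \<in> conjugacy_class G H"
  unfolding conjugacy_class_eq using conj_set_one by (metis (mono_tags, lifting) mem_Collect_eq one_closed)

lemma conjugacy_class_conj_set:
  assumes g: "g \<in> carrier G" and H: "H \<subseteq> carrier G"
  shows "conjugacy_class G (conj_set g H) = conjugacy_class G H"
proof
  have 1: "conj_set x (conj_set g H) = conj_set (x \<otimes> g) H" if "x \<in> carrier G" for x
    by (rule conj_set_mult[OF that g H])
  show "conjugacy_class G (conj_set g H) \<subseteq> conjugacy_class G H"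
    unfolding conjugacy_class_eq using 1 g by blast
  show "conjugacy_class G H \<subseteq> conjugacy_class G (conj_set g H)"
  proof
    fix C assume "C \<in> conjugacy_class G H"
    then obtain x where x: "x \<in> carrier G" "C = conj_set x H" by (auto simp: conjugacy_class_eq)
    have "C = conj_set (x \<otimes> inv g) (conj_set g H)"
      using 1[of "x \<otimes> inv g"] x g by (simp add: m_assoc)
    then show "C \<in> conjugacy_class G (conj_set g H)" using x g by (auto simp: conjugacy_class_eq)
  qed
qed

abbreviation hall :: "nat set \<Rightarrow> 'a set \<Rightarrow> bool" where
  "hall S \<equiv> hall_subgroup S (carrier G)"

lemma hall_imp_perfect_code:
  assumes fin: "finite (carrier G)" and H: "hall S H"
  shows "subgroup_perfect_code G H"
proof -
  have sub: "subgroup H G" using H by (simp add: hall_subgroup_def)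
  interpret FS: finite_subgroup G H by (rule finite_subgroupI[OF fin sub])
  show ?thesis
  proof (cases "odd (card H)")
    case True
    then show ?thesis by (rule FS.odd_order_perfect_code)
  next
    case False
    then have "2 \<in> S" using H two_is_prime_nat unfolding hall_subgroup_def by blast
    then have "odd (order G div card H)" using H two_is_prime_nat unfolding hall_subgroup_def order_def by blast
    then show ?thesis by (rule FS.odd_index_perfect_code)
  qed
qed

text \<open>For \<open>S\<close> inside the primes of the order, \<open>S\<close> can be read off
  from \<open>card H\<close>; hence different \<open>S\<close> give nonconjugate Hall
  subgroups.\<close>

lemma hall_primes:
  assumes H: "hall S H" and S: "S \<subseteq> order_primes G"
  shows "{p. Factorial_Ring.prime p \<and> p dvd card H} = S"
proof
  show "{p. Factorial_Ring.prime p \<and> p dvd card H} \<subseteq> S" using H by (auto simp: hall_subgroup_def)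
  show "S \<subseteq> {p. Factorial_Ring.prime p \<and> p dvd card H}"
  proof
    fix p assume p: "p \<in> S"
    then have pp: "Factorial_Ring.prime p" "p dvd order G" using S by (auto simp: order_primes_def)
    have "\<not> p dvd order G div card H" using H p pp(1) unfolding hall_subgroup_def order_def by blast
    moreover have "order G = card H * (order G div card H)"
      using H order_eq_card_mult_index by (simp add: hall_subgroup_def)
    ultimately have "p dvd card H" using pp prime_dvd_mult_iff by metis
    then show "p \<in> {p. Factorial_Ring.prime p \<and> p dvd card H}" using pp(1) by simp
  qed
qed

lemma hall_of_coprime:
  assumes "subgroup H G" and "\<And>p. Factorial_Ring.prime p \<Longrightarrow> p dvd card H \<Longrightarrow> \<not> p dvd order G div card H"
  shows "hall {p. Factorial_Ring.prime p \<and> p dvd card H} H"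
  using assms subgroup.subset by (auto simp: hall_subgroup_def order_def)

end

section \<open>Counting the classes and the equality case\<close>

locale finite_solvable_group = group +
  assumes fin: "finite (carrier G)" and solv: "solvable G" and nontrivial: "carrier G \<noteq> {\<one>}"
begin

lemma order_pos: "order G > 0" using fin order_gt_0_iff_finite by simp

lemma order_gt_1: "order G > 1"
  using nontrivial order_pos order_one_triv_iff by (metis One_nat_def Suc_lessI)

lemma finite_order_primes: "finite (order_primes G)"
  by (rule finite_subset[of _ "{..order G}"]) (use order_pos dvd_imp_le in \<open>auto simp: order_primes_def\<close>)

lemma order_primes_nonempty: "order_primes G \<noteq> {}"
  using prime_factor_nat[of "order G"] order_gt_1 by (auto simp: order_primes_def)

definition hall_rep :: "nat set \<Rightarrow> 'a set" where
  "hall_rep S = (SOME H. hall S H)"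

lemma hall_rep: "hall S (hall_rep S)"
  unfolding hall_rep_def using hall_theorem[OF fin] solv solvable_def by (metis someI_ex)

lemma hall_conj:
  assumes "hall S H" "hall S K"
  shows "\<exists>g\<in>carrier G. K = conj_set g H"
  using hall_theorem[OF fin] solv assms unfolding solvable_def by blast

definition proper_sets :: "nat set set" where
  "proper_sets = Pow (order_primes G) - {{}, order_primes G}"

lemma card_proper_sets: "int (card proper_sets) = 2 ^ card (order_primes G) - 2"
proof -
  have "card {{}, order_primes G} = 2" using order_primes_nonempty by (simp add: card_insert_if)
  moreover have "{{}, order_primes G} \<subseteq> Pow (order_primes G)" by simp
  ultimately have "card proper_sets = 2 ^ card (order_primes G) - 2" "2 \<le> (2::nat) ^ card (order_primes G)"
    unfolding proper_sets_def using card_Diff_subset[of "{{}, order_primes G}" "Pow (order_primes G)"]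
      card_mono[of "Pow (order_primes G)" "{{}, order_primes G}"] finite_order_primes by (simp_all add: card_Pow)
  then show ?thesis by (simp add: of_nat_diff)
qed

definition hall_class :: "nat set \<Rightarrow> 'a set set" where
  "hall_class S = conjugacy_class G (hall_rep S)"

lemma hall_class_in_Delta:
  assumes S: "S \<in> proper_sets"
  shows "hall_class S \<in> Delta G"
proof -
  have S': "S \<subseteq> order_primes G" "S \<noteq> {}" "S \<noteq> order_primes G" using S by (auto simp: proper_sets_def)
  note pr = hall_primes[OF hall_rep S'(1)]
  have "hall_rep S \<noteq> {\<one>}"
  proof
    assume "hall_rep S = {\<one>}"
    then have "S = {}" using pr by (auto simp: prime_nat_iff)
    then show False using S' by simp
  qed
  moreover have "hall_rep S \<noteq> carrier G" using pr S'(3) by (auto simp: order_primes_def order_def)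
  ultimately show ?thesis
    using hall_imp_perfect_code[OF fin hall_rep[of S]]
    by (auto simp: Delta_def hall_class_def nontrivial_subgroup_perfect_codes_def)
qed

lemma hall_rep_carrier: "hall_rep S \<subseteq> carrier G"
  using hall_rep[of S] by (auto simp: hall_subgroup_def)

lemma inj_hall_class: "inj_on hall_class proper_sets"
proof (rule inj_onI)
  fix S T assume S: "S \<in> proper_sets" and T: "T \<in> proper_sets" and e: "hall_class S = hall_class T"
  have "hall_rep S \<in> conjugacy_class G (hall_rep T)"
    using self_in_conjugacy_class[OF hall_rep_carrier[of S]] e by (simp add: hall_class_def)
  then obtain g where "g \<in> carrier G" "hall_rep S = conj_set g (hall_rep T)" by (auto simp: conjugacy_class_eq)
  then have c: "card (hall_rep S) = card (hall_rep T)" using card_conj_set hall_rep_carrier by simp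
  have "S \<subseteq> order_primes G" "T \<subseteq> order_primes G" using S T by (auto simp: proper_sets_def)
  note pr = this[THEN hall_primes[OF hall_rep]]
  show "S = T" using pr(1) unfolding c pr(2) by (rule sym)
qed

lemma finite_Delta: "finite (Delta G)"
proof -
  have "nontrivial_subgroup_perfect_codes G \<subseteq> Pow (carrier G)"
    using subgroup.subset by (auto simp: nontrivial_subgroup_perfect_codes_def subgroup_perfect_code_def)
  then show ?thesis unfolding Delta_def using fin by (metis finite_Pow_iff finite_imageI finite_subset)
qed

lemma hall_classes_subset: "hall_class ` proper_sets \<subseteq> Delta G"
  using hall_class_in_Delta by blast

lemma card_Delta_ge: "card proper_sets \<le> card (Delta G)"
  using card_mono[OF finite_Delta hall_classes_subset] card_image[OF inj_hall_class] by simp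

lemma card_Delta_eq_iff: "card (Delta G) = card proper_sets \<longleftrightarrow> Delta G \<subseteq> hall_class ` proper_sets"
proof
  assume "card (Delta G) = card proper_sets"
  then have "hall_class ` proper_sets = Delta G"
    using card_subset_eq[OF finite_Delta hall_classes_subset] card_image[OF inj_hall_class] by simp
  then show "Delta G \<subseteq> hall_class ` proper_sets" by simp
next
  assume "Delta G \<subseteq> hall_class ` proper_sets"
  then have "Delta G = hall_class ` proper_sets" using hall_classes_subset by blast
  then show "card (Delta G) = card proper_sets" using card_image[OF inj_hall_class] by simp
qed

text \<open>A subgroup with coprime order and index is a Hall subgroup for the set of primes of its
  order, and nontriviality makes that set nonempty and proper. Conjugacy in Hall's theorem
  identifies its class with that of the chosen representative.\<close>

lemma Delta_subset_iff:
  "Delta G \<subseteq> hall_class ` proper_sets \<longleftrightarrow>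
    (\<forall>H\<in>nontrivial_subgroup_perfect_codes G. \<forall>p. Factorial_Ring.prime p \<longrightarrow> p dvd card H \<longrightarrow> \<not> p dvd order G div card H)"
proof
  assume sub: "Delta G \<subseteq> hall_class ` proper_sets"
  show "\<forall>H\<in>nontrivial_subgroup_perfect_codes G. \<forall>p. Factorial_Ring.prime p \<longrightarrow> p dvd card H \<longrightarrow> \<not> p dvd order G div card H"
  proof (intro ballI allI impI)
    fix H p assume H: "H \<in> nontrivial_subgroup_perfect_codes G" and p: "Factorial_Ring.prime p" "p dvd card H"
    have Hc: "H \<subseteq> carrier G" using H subgroup.subset
      by (auto simp: nontrivial_subgroup_perfect_codes_def subgroup_perfect_code_def)
    have "conjugacy_class G H \<in> Delta G" using H by (simp add: Delta_def)
    then obtain S where S: "S \<in> proper_sets" "conjugacy_class G H = conjugacy_class G (hall_rep S)"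
      using sub by (auto simp: hall_class_def)
    then have "H \<in> conjugacy_class G (hall_rep S)" using self_in_conjugacy_class[OF Hc] by simp
    then obtain g where g: "g \<in> carrier G" "H = conj_set g (hall_rep S)" by (auto simp: conjugacy_class_eq)
    have "hall S H" unfolding g(2) by (rule hall_subgroup_conj[OF subgroup_self g(1) hall_rep])
    then show "\<not> p dvd order G div card H" using p unfolding hall_subgroup_def order_def by blast
  qed
next
  assume cop: "\<forall>H\<in>nontrivial_subgroup_perfect_codes G. \<forall>p. Factorial_Ring.prime p \<longrightarrow> p dvd card H \<longrightarrow> \<not> p dvd order G div card H"
  show "Delta G \<subseteq> hall_class ` proper_sets"
  proof
    fix C assume "C \<in> Delta G"
    then obtain H where H: "H \<in> nontrivial_subgroup_perfect_codes G" "C = conjugacy_class G H" by (auto simp: Delta_def)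
    have sub: "subgroup H G" and nt: "H \<noteq> {\<one>}" "H \<noteq> carrier G"
      using H(1) by (auto simp: nontrivial_subgroup_perfect_codes_def subgroup_perfect_code_def)
    define S where "S = {p. Factorial_Ring.prime p \<and> p dvd card H}"
    have hS: "hall S H" unfolding S_def by (rule hall_of_coprime[OF sub]) (use cop H(1) in blast)
    have oH: "order G = card H * (order G div card H)" using order_eq_card_mult_index[OF sub] .
    have "card H \<noteq> 1"
    proof
      assume "card H = 1"
      then obtain h where "H = {h}" by (rule card_1_singletonE)
      then show False using nt(1) subgroup.one_closed[OF sub] by auto
    qed
    then obtain p where "Factorial_Ring.prime p" "p dvd card H" using prime_factor_nat by blast
    then have "S \<noteq> {}" by (auto simp: S_def)
    moreover have "S \<noteq> order_primes G"
    proof -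
      have "order G div card H \<noteq> 1"
      proof
        assume "order G div card H = 1"
        then have "card H = card (carrier G)" using oH by (simp add: order_def)
        then show False using nt(2) card_subset_eq[OF fin subgroup.subset[OF sub]] by simp
      qed
      then obtain q where q: "Factorial_Ring.prime q" "q dvd order G div card H" using prime_factor_nat by blast
      then have "q dvd order G" using oH by (metis dvd_mult)
      then have "q \<in> order_primes G" using q by (simp add: order_primes_def)
      moreover have "q \<notin> S" using cop H(1) q by (auto simp: S_def)
      ultimately show ?thesis by blast
    qed
    moreover have "S \<subseteq> order_primes G"
      unfolding S_def order_primes_def using oH by (metis (mono_tags, lifting) Collect_mono dvd_mult2)
    ultimately have "S \<in> proper_sets" by (simp add: proper_sets_def)
    moreover obtain g where "g \<in> carrier G" "H = conj_set g (hall_rep S)" using hall_conj[OF hall_rep hS] by blast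
    then have "C = hall_class S" using H(2) conjugacy_class_conj_set hall_rep_carrier by (simp add: hall_class_def)
    ultimately show "C \<in> hall_class ` proper_sets" by blast
  qed
qed

lemma prime_square_dvd_order:
  assumes sub: "subgroup H G" and p: "p dvd card H" "p dvd order G div card H"
  shows "p\<^sup>2 dvd order G"
proof -
  have "p * p dvd card H * (order G div card H)" using p by (rule mult_dvd_mono)
  then show ?thesis using order_eq_card_mult_index[OF sub] by (simp add: power2_eq_square)
qed

lemma ex_sylow_2: "\<exists>P. sylow_subgroup 2 G P \<and> odd (order G div card P)"
proof -
  obtain r where r: "order G = 2 ^ multiplicity 2 (order G) * r" "odd r"
    using multiplicity_decompose'[of "order G" 2] order_pos by auto
  obtain P where P: "subgroup P G" "card P = 2 ^ multiplicity 2 (order G)"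
    using sylow_thm[OF two_is_prime_nat is_group r(1) fin] by blast
  moreover have "order G div card P = r" unfolding P(2) using r(1) by (metis nonzero_mult_div_cancel_left power_not_zero zero_neq_numeral)
  ultimately show ?thesis using r(2) by (auto simp: sylow_subgroup_def)
qed

lemma coprime_if_condition:
  assumes sq: "squarefree (odd_part (order G))"
    and syl: "\<forall>P. sylow_subgroup 2 G P \<longrightarrow>
      cyclic_2_group (G\<lparr>carrier := P\<rparr>) \<or> generalized_quaternion_group (G\<lparr>carrier := P\<rparr>)"
    and H: "H \<in> nontrivial_subgroup_perfect_codes G" and p: "Factorial_Ring.prime p" "p dvd card H"
  shows "\<not> p dvd order G div card H"
proof
  assume pi: "p dvd order G div card H"
  have pc: "subgroup_perfect_code G H" and sub: "subgroup H G"
    using H by (auto simp: nontrivial_subgroup_perfect_codes_def subgroup_perfect_code_def)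
  have "even p"
  proof (rule ccontr)
    assume "odd p"
    then show False using sq squarefree_odd_part_iff[OF order_pos] prime_square_dvd_order[OF sub p(2) pi] p(1) by blast
  qed
  then have p2: "p = 2" using p(1) primes_dvd_imp_eq[OF two_is_prime_nat] by metis
  interpret FS: finite_subgroup G H by (rule finite_subgroupI[OF fin sub])
  have ev: "even (card H)" "even (order G div card H)" using p(2) pi p2 by simp_all
  obtain t u where tu: "t \<in> carrier G" "u \<in> carrier G" "t \<otimes> t = \<one>" "u \<otimes> u = \<one>" "t \<noteq> \<one>" "u \<noteq> \<one>" "t \<noteq> u" "t \<otimes> u = u \<otimes> t"
    using FS.perfect_code_commuting_involutions[OF pc ev] by blast
  obtain P where P: "sylow_subgroup 2 G P" "odd (order G div card P)" using ex_sylow_2 by blast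
  then have P': "subgroup P G" "card P = 2 ^ multiplicity 2 (order G)" by (auto simp: sylow_subgroup_def)
  have "\<exists>a\<in>P. \<exists>b\<in>P. a \<noteq> b \<and> a \<noteq> \<one> \<and> b \<noteq> \<one> \<and> a \<otimes> a = \<one> \<and> b \<otimes> b = \<one>"
    by (rule commuting_involutions_in_odd_index_subgroup[OF fin P'(1) P(2) tu(1,3,5) tu(2,4,6) tu(7,8)])
  moreover have "\<forall>x\<in>P. \<forall>y\<in>P. x \<noteq> \<one> \<longrightarrow> y \<noteq> \<one> \<longrightarrow> x \<otimes> x = \<one> \<longrightarrow> y \<otimes> y = \<one> \<longrightarrow> x = y"
    using two_subgroup_cyclic_or_quaternion_iff[OF fin P'] syl P(1) by simp
  ultimately show False by blast
qed

lemma squarefree_if_coprime: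
  assumes cop: "\<And>H p. H \<in> nontrivial_subgroup_perfect_codes G \<Longrightarrow> Factorial_Ring.prime p \<Longrightarrow> p dvd card H \<Longrightarrow> \<not> p dvd order G div card H"
  shows "squarefree (odd_part (order G))"
  unfolding squarefree_odd_part_iff[OF order_pos]
proof (intro allI impI notI)
  fix p assume p: "Factorial_Ring.prime p" "odd p" "p\<^sup>2 dvd order G"
  obtain r where r: "order G = p\<^sup>2 * r" using p(3) by (elim dvdE)
  \<comment> \<open>Exponent 1 is chosen in Sylow's theorem, leaving a factor \<open>p\<close> in
    the index. The subgroup of order \<open>p\<close> is a perfect code by odd order, but
    \<open>p\<close> divides both its order and its index.\<close>
  have "order G = p ^ 1 * (p * r)" using r by (simp add: power2_eq_square)
  then obtain H where H: "subgroup H G" "card H = p" using sylow_thm[OF p(1) is_group _ fin] by (metis power_one_right)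
  have p1: "p > 1" using p(1) prime_gt_1_nat by blast
  have idx: "order G div card H = p * r" using H(2) r p1 by (simp add: power2_eq_square)
  interpret FS: finite_subgroup G H by (rule finite_subgroupI[OF fin H(1)])
  have "subgroup_perfect_code G H" using FS.odd_order_perfect_code p(2) H(2) by simp
  moreover have "H \<noteq> {\<one>}" using H(2) p1 by auto
  moreover have "H \<noteq> carrier G"
  proof
    assume "H = carrier G"
    then have "order G = p" using H(2) by (simp add: order_def)
    then have "p * r = 1" using idx H(2) p1 by simp
    then show False using p1 by simp
  qed
  ultimately have "H \<in> nontrivial_subgroup_perfect_codes G" by (simp add: nontrivial_subgroup_perfect_codes_def)
  then have "\<not> p dvd order G div card H" by (rule cop[OF _ p(1)]) (simp add: H(2))
  then show False using idx by simp
qed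

text \<open>The maximal subgroup \<open>Q\<close> exists because \<open>{\<one>, a}\<close> is a
  candidate. It has even order, and its index is even as well: for odd index a conjugate of
  \<open>P\<close> would lie in \<open>Q\<close> and carry the two involutions \<open>a\<close> and
  \<open>b\<close> to the single one of \<open>Q\<close>.\<close>

lemma sylow_if_coprime:
  assumes cop: "\<And>H p. H \<in> nontrivial_subgroup_perfect_codes G \<Longrightarrow> Factorial_Ring.prime p \<Longrightarrow> p dvd card H \<Longrightarrow> \<not> p dvd order G div card H"
    and P: "sylow_subgroup 2 G P"
  shows "cyclic_2_group (G\<lparr>carrier := P\<rparr>) \<or> generalized_quaternion_group (G\<lparr>carrier := P\<rparr>)"
proof (rule ccontr)
  assume neg: "\<not> ?thesis"
  have P': "subgroup P G" "card P = 2 ^ multiplicity 2 (order G)" using P by (auto simp: sylow_subgroup_def)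
  obtain a b where ab: "a \<in> P" "b \<in> P" "a \<noteq> \<one>" "b \<noteq> \<one>" "a \<otimes> a = \<one>" "b \<otimes> b = \<one>" "a \<noteq> b"
    using neg two_subgroup_cyclic_or_quaternion_iff[OF fin P'] by blast
  have abc: "a \<in> carrier G" "b \<in> carrier G" using ab(1,2) subgroup.subset[OF P'(1)] by blast+
  define U where "U Q \<longleftrightarrow> (\<exists>!u. u \<in> Q \<and> u \<noteq> \<one> \<and> u \<otimes> u = \<one>)" for Q
  define Qs where "Qs = {Q. subgroup Q G \<and> (\<exists>k. card Q = 2 ^ k) \<and> U Q}"
  have "card {\<one>, a} = 2 ^ 1" using ab(3) by simp
  then have k: "\<exists>k. card {\<one>, a} = 2 ^ k" by (rule exI)
  have "U {\<one>, a}" unfolding U_def using ab(3,5) by blast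
  then have "{\<one>, a} \<in> Qs" unfolding Qs_def using order_two_subgroup[OF abc(1) ab(5)] k by blast
  moreover have "finite Qs" by (rule finite_subset[of _ "Pow (carrier G)"]) (use fin subgroup.subset in \<open>auto simp: Qs_def\<close>)
  ultimately obtain Q where Q: "Q \<in> Qs" and max: "\<And>R. R \<in> Qs \<Longrightarrow> card R \<le> card Q"
    using ex_max_nat[of Qs card] by blast
  obtain k where Q': "subgroup Q G" "card Q = 2 ^ k" "U Q" using Q by (auto simp: Qs_def)
  interpret FS: finite_subgroup G Q by (rule finite_subgroupI[OF fin Q'(1)])
  have pc: "subgroup_perfect_code G Q"
  proof (rule FS.maximal_unique_involution_perfect_code[OF Q'(2) Q'(3)[unfolded U_def]])
    fix R assume R: "subgroup R G" "Q \<subseteq> R" "card R = 2 ^ Suc k"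
    show "\<not> (\<exists>!u. u \<in> R \<and> u \<noteq> \<one> \<and> u \<otimes> u = \<one>)"
    proof
      assume "\<exists>!u. u \<in> R \<and> u \<noteq> \<one> \<and> u \<otimes> u = \<one>"
      then have "R \<in> Qs" using R(1,3) unfolding Qs_def U_def by blast
      then have "card R \<le> card Q" by (rule max)
      then show False using R(3) Q'(2) by simp
    qed
  qed
  obtain v where v: "v \<in> Q" "v \<noteq> \<one>" and vu: "\<And>w. w \<in> Q \<Longrightarrow> w \<noteq> \<one> \<Longrightarrow> w \<otimes> w = \<one> \<Longrightarrow> w = v"
    using Q'(3) unfolding U_def by blast
  have "k \<noteq> 0"
  proof
    assume "k = 0"
    then obtain h where "Q = {h}" using Q'(2) card_1_singletonE by auto
    then show False using v subgroup.one_closed[OF Q'(1)] by auto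
  qed
  then have evQ: "even (card Q)" using Q'(2) by simp
  have ev: "even (order G div card Q)"
  proof (rule ccontr)
    assume odd: "odd (order G div card Q)"
    obtain n where n: "n \<in> carrier G" "P \<subseteq> conj_set n Q"
      using p_subgroup_conjugate_into[OF fin subgroup_self P'(1) subgroup.subset[OF P'(1)] P'(2) Q'(1) FS.H.subset two_is_prime_nat]
        odd unfolding order_def by blast
    let ?f = "\<lambda>x. inv n \<otimes> x \<otimes> n"
    have inj: "x = y" if "x \<in> carrier G" "y \<in> carrier G" "?f x = ?f y" for x y
      using that n(1) by simp
    have f: "?f x = v" if "x \<in> P" "x \<noteq> \<one>" "x \<otimes> x = \<one>" for x
    proof (rule vu)
      have xc: "x \<in> carrier G" using that(1) subgroup.subset[OF P'(1)] by blast
      show "?f x \<in> Q" using n(2) that(1) mem_conj_set[OF n(1) xc FS.H.subset] by blast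
      have "?f x \<otimes> ?f x = ?f (x \<otimes> x)" using xc n(1) by (simp add: m_assoc inv_mult_cancel)
      then show "?f x \<otimes> ?f x = \<one>" using that(3) n(1) by simp
      show "?f x \<noteq> \<one>"
      proof
        assume "?f x = \<one>"
        then have "?f x = ?f \<one>" using n(1) by simp
        then show False using inj[OF xc one_closed] that(2) by blast
      qed
    qed
    have "?f a = ?f b" using f[OF ab(1,3,5)] f[OF ab(2,4,6)] by simp
    then show False using ab(7) abc n(1) by simp
  qed
  have "Q \<noteq> {\<one>}" using v by blast
  moreover have "Q \<noteq> carrier G"
  proof
    assume "Q = carrier G"
    then have "order G div card Q = 1" using order_pos by (simp add: order_def)
    then show False using ev by simp
  qed
  ultimately have "Q \<in> nontrivial_subgroup_perfect_codes G" using pc by (simp add: nontrivial_subgroup_perfect_codes_def)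
  then show False using cop[OF _ two_is_prime_nat evQ] ev by blast
qed

end

theorem theorem1p9:
  fixes G :: "('a, 'b) monoid_scheme"
  assumes "Group.group G"
    and "finite (carrier G)"
    and "solvable G"
    and "carrier G \<noteq> {\<one>\<^bsub>G\<^esub>}"
  shows "int (card (Delta G)) \<ge> 2 ^ card (order_primes G) - 2 \<and>
    (int (card (Delta G)) = 2 ^ card (order_primes G) - 2 \<longleftrightarrow>
      squarefree (odd_part (Coset.order G)) \<and>
      (\<forall>P. sylow_subgroup 2 G P \<longrightarrow>
        cyclic_2_group (G\<lparr>carrier := P\<rparr>) \<or>
        generalized_quaternion_group (G\<lparr>carrier := P\<rparr>)))"
proof -
  interpret finite_solvable_group G
    using assms by (simp add: finite_solvable_group_def finite_solvable_group_axioms_def)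
  have "card (Delta G) = card proper_sets \<longleftrightarrow>
    (\<forall>H\<in>nontrivial_subgroup_perfect_codes G. \<forall>p. Factorial_Ring.prime p \<longrightarrow> p dvd card H \<longrightarrow> \<not> p dvd order G div card H)"
    unfolding card_Delta_eq_iff Delta_subset_iff ..
  also have "\<dots> \<longleftrightarrow> squarefree (odd_part (order G)) \<and>
      (\<forall>P. sylow_subgroup 2 G P \<longrightarrow>
        cyclic_2_group (G\<lparr>carrier := P\<rparr>) \<or> generalized_quaternion_group (G\<lparr>carrier := P\<rparr>))"
    using coprime_if_condition squarefree_if_coprime sylow_if_coprime by blast
  finally show ?thesis
    using card_Delta_ge unfolding card_proper_sets[symmetric] by (simp only: of_nat_le_iff of_nat_eq_iff)
qed

end
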